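(* For every sufficiently large absolute constant $c_2$ there is a constant $c>0$ (depending only on $c_2$) such that the following holds. Let $\epsilon,\delta\in(0,1)$ and let $\mathbf A\in\mathbb R^{n\times n}$ be symmetric and nonzero with eigenvalues $\lambda_1(\mathbf A)\ge\dots\ge\lambda_n(\mathbf A)$. Let $s>0$ and let $S\subseteq[n]$ be a random set formed by including each index $i$ independently with probability $p_i=\min\left(1,\frac{s\|\mathbf A_i\|_2^2}{\|\mathbf A\|_F^2}+\frac1{n^2}\right)$. Let $\tilde\lambda_1(\mathbf A),\dots,\tilde\lambda_n(\mathbf A)$ be the estimates computed from $\mathbf A_S$ by the row-norm-based procedure described in the context (with parameters $\epsilon$ and $c_2$). If $s\ge\frac{c\log^{10}n}{\epsilon^8\delta^4}$, then with probability at least $1-\delta$, for all $i\in[n]$, $$|\tilde\lambda_i(\mathbf A)-\lambda_i(\mathbf A)|\le\epsilon\|\mathbf A\|_F.$$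
   Context: $[n]=\{1,\dots,n\}$; $\mathbf A_i$ is the $i$-th row of $\mathbf A$, $\|\mathbf A_i\|_2$ its Euclidean norm, $\|\mathbf A\|_F$ the Frobenius norm. $\mathbf A_S$ denotes the principal submatrix indexed by $S$. Convention: $\log x$ is read as $\max\{1,\ln x\}$, and $\log^k n=(\log n)^k$. Row-norm-based procedure: given $S$, form the symmetric $|S|\times|S|$ matrix $\mathbf A'_S$ (rows and columns indexed by $i,j\in S$) with $$[\mathbf A'_S]_{i,j}=\begin{cases}0 & \text{if } i=j \text{ and } \|\mathbf A_i\|_2^2<\frac{\epsilon^2}{4}\|\mathbf A\|_F^2,\\ 0 & \text{if } i\ne j \text{ and } \|\mathbf A_i\|_2^2\cdot\|\mathbf A_j\|_2^2<\frac{\epsilon^2\|\mathbf A\|_F^2\,|\mathbf A_{ij}|^2}{c_2\log^4 n},\\ \frac1{\sqrt{p_ip_j}}\mathbf A_{ij} & \text{otherwise.}\end{cases}$$ Let $\lambda_1(\mathbf A'_S)\ge\dots\ge\lambda_{|S|}(\mathbf A'_S)$ be its eigenvalues. For $i\in[|S|]$ with $\lambda_i(\mathbf A'_S)\ge0$ set $\tilde\lambda_i(\mathbf A)=\lambda_i(\mathbf A'_S)$; for $i\in[|S|]$ with $\lambda_i(\mathbf A'_S)<0$ set $\tilde\lambda_{n-(|S|-i)}(\mathbf A)=\lambda_i(\mathbf A'_S)$; for all remaining $i\in[n]$ set $\tilde\lambda_i(\mathbf A)=0$. *)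

theory Defs
  imports
    "HOL-Probability.Probability"
    "Jordan_Normal_Form.Char_Poly"
    "Jordan_Normal_Form.DL_Submatrix"
begin

text \<open>
  Indices start at 0, as is usual for matrices of variable dimension:
  \<open>[n]\<close> becomes \<open>{..<n}\<close>.
\<close>

definition row_norm :: "real mat \<Rightarrow> nat \<Rightarrow> real" where
  "row_norm A i = L2_set (\<lambda>j. A $$ (i, j)) {..<dim_col A}"

definition frobenius_norm :: "real mat \<Rightarrow> real" where
  "frobenius_norm A = L2_set (\<lambda>(i, j). A $$ (i, j)) ({..<dim_row A} \<times> {..<dim_col A})"

definition log1 :: "real \<Rightarrow> real" where
  "log1 x = max 1 (ln x)"

text \<open>
  The real eigenvalues with algebraic multiplicity, in decreasing order. For a real symmetric
  \<open>n \<times> n\<close> matrix the characteristic polynomial splits over the reals, so the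
  list has length \<open>n\<close>.
\<close>

definition eigenvalues_desc :: "real mat \<Rightarrow> real list" where
  "eigenvalues_desc A = rev (sorted_list_of_multiset (proots (char_poly A)))"

definition sample_prob :: "real mat \<Rightarrow> real \<Rightarrow> nat \<Rightarrow> real" where
  "sample_prob A s i =
     min 1 (s * (row_norm A i)\<^sup>2 / (frobenius_norm A)\<^sup>2 + 1 / (real (dim_row A))\<^sup>2)"

definition random_index_set :: "nat \<Rightarrow> (nat \<Rightarrow> real) \<Rightarrow> nat set pmf" where
  "random_index_set n p =
     map_pmf (\<lambda>b. {i \<in> {..<n}. b i}) (Pi_pmf {..<n} False (\<lambda>i. bernoulli_pmf (p i)))"

definition rescaled_entry :: "real \<Rightarrow> real \<Rightarrow> real \<Rightarrow> real mat \<Rightarrow> nat \<Rightarrow> nat \<Rightarrow> real" where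
  "rescaled_entry c2 \<epsilon> s A i j =
     (if i = j \<and> (row_norm A i)\<^sup>2 < \<epsilon>\<^sup>2 / 4 * (frobenius_norm A)\<^sup>2 then 0
      else if i \<noteq> j \<and> (row_norm A i)\<^sup>2 * (row_norm A j)\<^sup>2
                < \<epsilon>\<^sup>2 * (frobenius_norm A)\<^sup>2 * \<bar>A $$ (i, j)\<bar>\<^sup>2
                    / (c2 * log1 (real (dim_row A)) ^ 4) then 0
      else 1 / sqrt (sample_prob A s i * sample_prob A s j) * A $$ (i, j))"

text \<open>
  An entry indexed by \<open>i, j \<in> S\<close> depends on \<open>S\<close> only through its position,
  so all \<open>n \<times> n\<close> entries are formed first and the principal submatrix is taken afterwards.
\<close>

definition sampled_matrix :: "real \<Rightarrow> real \<Rightarrow> real \<Rightarrow> real mat \<Rightarrow> nat set \<Rightarrow> real mat" where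
  "sampled_matrix c2 \<epsilon> s A S =
     submatrix (mat (dim_row A) (dim_row A) (\<lambda>(i, j). rescaled_entry c2 \<epsilon> s A i j)) S S"

text \<open>
  With \<open>m = |S|\<close> and 0-based indices, the \<open>i\<close>-th eigenvalue of the sampled
  matrix is placed at position \<open>i\<close> if it is nonnegative and at position
  \<open>n - m + i\<close> if it is negative. Both cases cannot meet at the same position, since
  the eigenvalues decrease and \<open>m \<le> n\<close>.
\<close>

definition eigenvalue_estimate ::
  "real \<Rightarrow> real \<Rightarrow> real \<Rightarrow> real mat \<Rightarrow> nat set \<Rightarrow> nat \<Rightarrow> real" where
  "eigenvalue_estimate c2 \<epsilon> s A S k =
     (let n = dim_row A; m = card S; ev = eigenvalues_desc (sampled_matrix c2 \<epsilon> s A S)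
      in if k < m \<and> ev ! k \<ge> 0 then ev ! k
         else if n \<le> k + m \<and> ev ! (k + m - n) < 0 then ev ! (k + m - n)
         else 0)"

end

theory Submission
  imports Defs
begin

text \<open>
  Let \<open>F\<close> be the Frobenius norm and \<open>r i\<close> the row norms of \<open>A\<close>. Zeroing entries changes all
  eigenvalues by at most \<open>3/4 \<epsilon> F\<close>: the diagonal part is trivial, and the off-diagonal part is a
  Schur test with weights \<open>r i\<close>. Let \<open>B\<close> be the thresholded matrix. Its spectral
  decomposition is cut at the level \<open>\<beta> = \<epsilon>\<^sup>2 \<delta> F / 2\<^sup>1\<^sup>5\<close>.

  For the eigenvectors with \<open>\<bar>\<alpha> k\<bar> \<ge> \<beta>\<close>, the bound
  \<open>\<Sum>k. (\<alpha> k * u k i)\<^sup>2 \<le> (r i)\<^sup>2\<close> makes them incoherent. So, by a second moment estimate,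
  sampling nearly preserves their Gram matrix weighted by \<open>sqrt \<bar>\<alpha> k * \<alpha> l\<bar>\<close>, and the
  min-max principle transfers the large eigenvalues in both directions. For the remaining part,
  the expected trace of the fourth power, off the diagonal, is at most
  \<open>4 \<beta>\<^sup>2 F\<^sup>2\<close> plus terms that are small in \<open>1 / s\<close>. By the choice of \<open>\<beta>\<close>,
  Markov's inequality bounds its norm by \<open>\<epsilon> F / 64\<close>; no matrix concentration inequality is needed.
\<close>

section \<open>Linear systems and real symmetric matrices\<close>

text \<open>The comparison of spectra is deterministic: \<open>spectral_sample\<close> lists what a
  set \<open>S\<close> must satisfy, and probability serves only to show that a random
  \<open>S\<close> does so. The weights \<open>sqrt \<bar>\<alpha> k * \<alpha> l\<bar>\<close>
  measure each Gram error at the scale of the eigenvalues it disturbs; the result is an additive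
  error of order \<tau>, without a factor for the number of dominant eigenvectors. The two
  thresholds make the tail fit for sampling. A sampled diagonal entry is divided by
  \<open>p i\<close> with nothing to average it against; the diagonal rule forces
  \<open>B i i = 0\<close> whenever \<open>p i < 1\<close>. The off-diagonal rule bounds
  \<open>B i j\<close> by a multiple of \<open>r i * r j\<close>, which pays for the collision term
  of order \<open>(G i j)^4 / (p i * p j)\<close> in the fourth moment. Spectral bounds are proved
  for the k-th largest eigenvalue; negating the kernel and reversing the order gives the negative
  side. Near zero, an eigenvalue and its estimate may have opposite signs, so the sampling accuracy
  \<theta> = \<epsilon> F / 8 counts twice, and 2 \<theta> is the quarter of \<epsilon> F that
  thresholding leaves.\<close>

lemma homogeneous_system_nontrivial_solution:
  fixes M :: "'a \<Rightarrow> 'b \<Rightarrow> real"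
  assumes "finite E" "finite J" "card E < card J"
  shows "\<exists>c. (\<exists>l\<in>J. c l \<noteq> 0) \<and> (\<forall>e\<in>E. (\<Sum>l\<in>J. c l * M e l) = 0)"
  using assms
proof (induction E arbitrary: J M rule: finite_induct)
  case empty
  then have "J \<noteq> {}" by auto
  then show ?case by (intro exI[of _ "\<lambda>_. 1"]) auto
next
  case (insert e E)
  show ?case
  proof (cases "\<forall>l\<in>J. M e l = 0")
    case True
    obtain c where "\<exists>l\<in>J. c l \<noteq> 0" "\<forall>e\<in>E. (\<Sum>l\<in>J. c l * M e l) = 0"
      using insert.IH[of J M] insert.prems insert.hyps by auto
    with True show ?thesis by (intro exI[of _ c]) auto
  next
    case False
    then obtain p where p: "p \<in> J" "M e p \<noteq> 0" by auto
    let ?J = "J - {p}"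
    have "card E < card ?J"
      using insert.prems insert.hyps p by (simp add: card_Diff_singleton)
    \<comment> \<open>Gaussian elimination with pivot \<open>M e p\<close>: equation
      \<open>e\<close> cancels the unknown \<open>p\<close> in all other equations, and
      \<open>d\<close> below is the back substitution.\<close>
    with insert.IH[of ?J "\<lambda>a l. M a l - M a p / M e p * M e l"] insert.prems
    obtain c where c: "\<exists>l\<in>?J. c l \<noteq> 0"
      "\<forall>a\<in>E. (\<Sum>l\<in>?J. c l * (M a l - M a p / M e p * M e l)) = 0" by auto
    define d where "d = c(p := - (\<Sum>l\<in>?J. c l * M e l) / M e p)"
    have sum_d: "(\<Sum>l\<in>J. d l * M a l) = d p * M a p + (\<Sum>l\<in>?J. c l * M a l)" for a
      using insert.prems p by (simp add: sum.remove[of J p] d_def)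
    have "(\<Sum>l\<in>J. d l * M a l) = 0" if "a \<in> insert e E" for a
    proof (cases "a = e")
      case True
      then show ?thesis using p by (simp only: sum_d) (simp add: d_def)
    next
      case False
      with that c(2) have "(\<Sum>l\<in>?J. c l * M a l) = M a p / M e p * (\<Sum>l\<in>?J. c l * M e l)"
        by (simp add: algebra_simps sum_subtractf sum_distrib_left)
      then show ?thesis using p by (simp only: sum_d) (simp add: d_def)
    qed
    moreover have "\<exists>l\<in>J. d l \<noteq> 0" using c(1) by (auto simp: d_def)
    ultimately show ?thesis by blast
  qed
qed

text \<open>The characteristic polynomial has a complex root \<open>a\<close>. Pairing the real and
  imaginary parts of its eigenvector through the symmetric form gives \<open>Im a = 0\<close>; then
  whichever of the two parts is nonzero is a real eigenvector.\<close>

lemma real_symmetric_eigenvector_exists: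
  fixes A :: "real mat"
  assumes A: "A \<in> carrier_mat n n" and sym: "A\<^sup>T = A" and n: "n > 0"
  shows "\<exists>v e. v \<in> carrier_vec n \<and> v \<bullet> v = 1 \<and> A *\<^sub>v v = e \<cdot>\<^sub>v v"
proof -
  let ?C = "map_mat complex_of_real A"
  have C: "?C \<in> carrier_mat n n" using A by auto
  obtain as where as: "char_poly ?C = (\<Prod>a\<leftarrow>as. [:- a, 1:])" "length as = n"
    using char_poly_factorized[OF C] by auto
  then obtain a where "a \<in> set as" using n by (cases as) auto
  then have "poly (char_poly ?C) a = 0" unfolding as by (auto simp: poly_prod_list prod_list_zero_iff)
  then have "eigenvalue ?C a" using eigenvalue_root_char_poly[OF C] by simp
  then obtain w where w: "w \<in> carrier_vec n" "w \<noteq> 0\<^sub>v n" "?C *\<^sub>v w = a \<cdot>\<^sub>v w"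
    using C unfolding eigenvalue_def eigenvector_def by auto
  let ?A = "\<lambda>i j. A $$ (i, j)"
  have A_sym: "?A i j = ?A j i" if "i < n" "j < n" for i j
    using that A sym by (metis carrier_matD index_transpose_mat(1))
  have ev: "(\<Sum>j<n. complex_of_real (?A i j) * w $ j) = a * w $ i" if "i < n" for i
    using arg_cong[OF w(3), of "\<lambda>v. v $ i"] that w(1) A
    by (simp add: scalar_prod_def lessThan_atLeast0)
  define x y where "x = (\<lambda>i. Re (w $ i))" and "y = (\<lambda>i. Im (w $ i))"
  have re: "(\<Sum>j<n. ?A i j * x j) = Re a * x i - Im a * y i" if "i < n" for i
    using arg_cong[OF ev[OF that], of Re] by (simp add: x_def y_def)
  have im: "(\<Sum>j<n. ?A i j * y j) = Re a * y i + Im a * x i" if "i < n" for i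
    using arg_cong[OF ev[OF that], of Im] by (simp add: x_def y_def)
  have "(\<Sum>i<n. y i * (\<Sum>j<n. ?A i j * x j)) = (\<Sum>i<n. x i * (\<Sum>j<n. ?A i j * y j))"
    unfolding sum_distrib_left
    by (subst sum.swap) (auto intro!: sum.cong simp: A_sym)
  then have "(\<Sum>i<n. y i * (Re a * x i - Im a * y i)) = (\<Sum>i<n. x i * (Re a * y i + Im a * x i))"
    using re im by simp
  then have "(\<Sum>i<n. Im a * ((x i)\<^sup>2 + (y i)\<^sup>2)) = 0"
    by (simp add: algebra_simps sum.distrib sum_subtractf power2_eq_square)
  then have *: "Im a * (\<Sum>i<n. (x i)\<^sup>2 + (y i)\<^sup>2) = 0"
    by (simp only: sum_distrib_left)
  obtain i where i: "i < n" "w $ i \<noteq> 0"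
    using w(1,2) by (metis carrier_vecD eq_vecI index_zero_vec(1) index_zero_vec(2))
  then have "(x i)\<^sup>2 + (y i)\<^sup>2 > 0"
    by (simp add: x_def y_def complex_eq_iff sum_power2_gt_zero_iff)
  then have pos: "(\<Sum>i<n. (x i)\<^sup>2 + (y i)\<^sup>2) > 0"
    using i by (intro sum_pos2[of _ i]) auto
  with * have Im0: "Im a = 0" by simp
  have "\<exists>z. (\<Sum>i<n. (z i)\<^sup>2) > 0 \<and> (\<forall>i<n. (\<Sum>j<n. ?A i j * z j) = Re a * z i)"
  proof (cases "(\<Sum>i<n. (x i)\<^sup>2) > 0")
    case True
    then show ?thesis using re Im0 by (intro exI[of _ x]) auto
  next
    case False
    then have "(\<Sum>i<n. (y i)\<^sup>2) > 0" using pos by (simp add: sum.distrib)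
    then show ?thesis using im Im0 by (intro exI[of _ y]) auto
  qed
  then obtain z where z: "(\<Sum>i<n. (z i)\<^sup>2) > 0" "\<And>i. i < n \<Longrightarrow> (\<Sum>j<n. ?A i j * z j) = Re a * z i"
    by auto
  define c where "c = sqrt (\<Sum>i<n. (z i)\<^sup>2)"
  have c: "c > 0" "c\<^sup>2 = (\<Sum>i<n. (z i)\<^sup>2)" using z(1) by (auto simp: c_def)
  define v where "v = vec n (\<lambda>i. z i / c)"
  have "v \<bullet> v = 1"
    using c z(1) by (simp add: v_def scalar_prod_def power2_eq_square lessThan_atLeast0 [symmetric]
        flip: sum_divide_distrib)
  moreover have "A *\<^sub>v v = Re a \<cdot>\<^sub>v v"
  proof (intro eq_vecI)
    fix i assume "i < dim_vec (Re a \<cdot>\<^sub>v v)"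
    then have i: "i < n" by (simp add: v_def)
    have "(A *\<^sub>v v) $ i = (\<Sum>j<n. ?A i j * (z j / c))"
      using i A by (simp add: v_def scalar_prod_def lessThan_atLeast0)
    also have "\<dots> = Re a * z i / c" using z(2)[OF i] by (simp flip: sum_divide_distrib)
    finally show "(A *\<^sub>v v) $ i = (Re a \<cdot>\<^sub>v v) $ i" using i by (simp add: v_def)
  qed (use A in \<open>auto simp: v_def\<close>)
  moreover have "v \<in> carrier_vec n" by (simp add: v_def)
  ultimately show ?thesis by blast
qed

lemma orthogonal_mat_with_first_col:
  fixes v :: "real vec"
  assumes v: "v \<in> carrier_vec n" "v \<bullet> v = 1" and n: "n > 0"
  shows "\<exists>Q \<in> carrier_mat n n. Q\<^sup>T = Q \<and> Q * Q = 1\<^sub>m n \<and> col Q 0 = v"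
proof -
  text \<open>The Householder reflection that exchanges \<open>v\<close> and the first unit vector.\<close>
  define w where "w = (\<lambda>i. v $ i - (if i = 0 then 1 else 0))"
  define h where "h = (\<Sum>i<n. (w i)\<^sup>2)"
  \<comment> \<open>If \<open>v\<close> is the first unit vector, then \<open>h = 0\<close>, and
    division by zero makes \<open>Q\<close> the identity matrix, which is the right choice in this
    case.\<close>
  define Q where "Q = mat n n (\<lambda>(i, j). (if i = j then 1 else 0) - 2 / h * w i * w j)"
  have vv: "(\<Sum>i<n. (v $ i)\<^sup>2) = 1"
    using v by (simp add: scalar_prod_def lessThan_atLeast0 power2_eq_square)
  have "(\<Sum>i<n. v $ i * (if i = 0 then 1 else 0)) = v $ 0"
    using n by (simp add: if_distrib cong: if_cong)
  moreover have "(\<Sum>i<n. (if i = 0 then 1 else 0)\<^sup>2) = (1 :: real)"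
    using n by (simp add: if_distrib[of "\<lambda>x. x\<^sup>2"] cong: if_cong)
  ultimately have h: "h = 2 - 2 * v $ 0"
    by (simp add: h_def w_def power2_diff sum.distrib sum_subtractf vv mult.assoc
        flip: sum_distrib_left)
  have hw: "w i = 0" if "h = 0" "i < n" for i
    using that by (simp add: h_def sum_nonneg_eq_0_iff)
  have Q: "Q \<in> carrier_mat n n" by (simp add: Q_def)
  moreover have "Q\<^sup>T = Q" by (rule eq_matI) (auto simp: Q_def)
  moreover have "Q * Q = 1\<^sub>m n"
  proof (rule eq_matI)
    fix i j assume "i < dim_row (1\<^sub>m n :: real mat)" "j < dim_col (1\<^sub>m n :: real mat)"
    then have ij: "i < n" "j < n" by auto
    have "(Q * Q) $$ (i, j) = (\<Sum>k<n. ((if i = k then 1 else 0) - 2 / h * w i * w k) *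
        ((if k = j then 1 else 0) - 2 / h * w k * w j))"
      using ij by (simp add: Q_def scalar_prod_def lessThan_atLeast0)
    also have "\<dots> = (\<Sum>k<n. (if k = i then (if i = j then 1 else 0) - 2 / h * w i * w j else 0)
        - (if k = j then 2 / h * w i * w j else 0) + (2 / h)\<^sup>2 * w i * w j * (w k)\<^sup>2)"
      by (intro sum.cong) (auto simp: algebra_simps power2_eq_square)
    also have "\<dots> = (if i = j then 1 else 0) - 4 / h * w i * w j + (2 / h)\<^sup>2 * w i * w j * h"
      using ij by (simp add: sum.distrib sum_subtractf h_def flip: sum_distrib_left)
    also have "\<dots> = (if i = j then 1 else 0)"
      by (cases "h = 0") (auto simp: power2_eq_square)
    finally show "(Q * Q) $$ (i, j) = (1\<^sub>m n) $$ (i, j)" using ij by simp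
  qed (auto simp: Q_def)
  moreover have "col Q 0 = v"
  proof (rule eq_vecI)
    fix i assume "i < dim_vec v"
    then have i: "i < n" using v by auto
    have "Q $$ (i, 0) = v $ i"
    proof (cases "h = 0")
      case True
      then show ?thesis using hw[OF True i] i n by (auto simp: Q_def w_def split: if_splits)
    next
      case False
      have "w 0 = - h / 2" by (simp add: w_def h)
      then have "Q $$ (i, 0) = (if i = 0 then 1 else 0) + w i"
        using False i n by (simp add: Q_def)
      then show ?thesis by (simp add: w_def)
    qed
    then show "col Q 0 $ i = v $ i" using i n Q by simp
  qed (use v Q in auto)
  ultimately show ?thesis by blast
qed

text \<open>Deflation: conjugation by a reflection whose first column is a unit eigenvector clears
  the first column off the diagonal, hence by symmetry the first row, and the induction hypothesis
  diagonalizes the remaining block.\<close>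

lemma real_symmetric_diagonalization:
  fixes A :: "real mat"
  assumes "A \<in> carrier_mat n n" "A\<^sup>T = A"
  shows "\<exists>Q D. Q \<in> carrier_mat n n \<and> D \<in> carrier_mat n n \<and> diagonal_mat D \<and>
    Q * Q\<^sup>T = 1\<^sub>m n \<and> Q\<^sup>T * Q = 1\<^sub>m n \<and> A = Q * D * Q\<^sup>T"
  using assms
proof (induction n arbitrary: A)
  case 0
  then show ?case
    by (intro exI[of _ "1\<^sub>m 0"] exI[of _ A]) (auto simp: diagonal_mat_def)
next
  case (Suc n)
  note A = Suc.prems(1) and sym = Suc.prems(2)
  obtain v :: "real vec" and e where v: "v \<in> carrier_vec (Suc n)" "v \<bullet> v = 1" "A *\<^sub>v v = e \<cdot>\<^sub>v v"
    using real_symmetric_eigenvector_exists[OF A sym] by auto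
  obtain P where P: "P \<in> carrier_mat (Suc n) (Suc n)" "P\<^sup>T = P" "P * P = 1\<^sub>m (Suc n)" "col P 0 = v"
    using orthogonal_mat_with_first_col[OF v(1,2)] by auto
  define B where "B = P * A * P"
  have B: "B \<in> carrier_mat (Suc n) (Suc n)" using P A by (simp add: B_def)
  have B_sym: "B\<^sup>T = B"
    unfolding B_def using P(1,2) A sym
    by (simp add: transpose_mult[of _ "Suc n" "Suc n" _ "Suc n"] assoc_mult_mat[of _ "Suc n" "Suc n" _ "Suc n" _ "Suc n"])
  have PBP: "P * B * P = A"
  proof -
    have "P * B * P = (P * P) * A * (P * P)"
      unfolding B_def using P(1) A
      by (simp add: assoc_mult_mat[of _ "Suc n" "Suc n" _ "Suc n" _ "Suc n"])
    then show ?thesis using P A by simp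
  qed
  have col_B: "col B 0 = e \<cdot>\<^sub>v unit_vec (Suc n) 0"
  proof -
    have "col B 0 = (P * A) *\<^sub>v col P 0"
      unfolding B_def using P(1) A by (intro col_mult2[of _ "Suc n" "Suc n" _ "Suc n"]) auto
    also have "\<dots> = P *\<^sub>v (A *\<^sub>v col P 0)"
      using P(1,4) A v(1) by (intro assoc_mult_mat_vec[of _ "Suc n" "Suc n" _ "Suc n"]) auto
    also have "\<dots> = e \<cdot>\<^sub>v (P *\<^sub>v col P 0)"
      using P v by (simp add: mult_mat_vec[of _ "Suc n" "Suc n"])
    also have "P *\<^sub>v col P 0 = col (P * P) 0"
      using P(1) by (intro col_mult2[of _ "Suc n" "Suc n" _ "Suc n", symmetric]) auto
    finally show ?thesis using P(3) by simp
  qed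
  have B0: "B $$ (i, 0) = (if i = 0 then e else 0)" "B $$ (0, i) = (if i = 0 then e else 0)"
    if "i < Suc n" for i
  proof -
    show *: "B $$ (i, 0) = (if i = 0 then e else 0)"
      using arg_cong[OF col_B, of "\<lambda>v. vec_index v i"] that B by auto
    show "B $$ (0, i) = (if i = 0 then e else 0)"
      using * that B B_sym by (metis carrier_matD index_transpose_mat(1) zero_less_Suc)
  qed
  define C where "C = mat n n (\<lambda>(i, j). B $$ (Suc i, Suc j))"
  have "C\<^sup>T = C"
  proof (rule eq_matI)
    fix i j assume "i < dim_row C" "j < dim_col C"
    then have "i < n" "j < n" by (auto simp: C_def)
    then show "C\<^sup>T $$ (i, j) = C $$ (i, j)"
      using B B_sym by (simp add: C_def) (metis Suc_less_eq carrier_matD index_transpose_mat(1))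
  qed (auto simp: C_def)
  then obtain Q D where Q: "Q \<in> carrier_mat n n" "Q * Q\<^sup>T = 1\<^sub>m n" "Q\<^sup>T * Q = 1\<^sub>m n"
    and D: "D \<in> carrier_mat n n" "diagonal_mat D" and C_eq: "C = Q * D * Q\<^sup>T"
    using Suc.IH[of C] by (auto simp: C_def)
  let ?block = "\<lambda>a M. four_block_mat (mat 1 1 (\<lambda>_. a)) (0\<^sub>m 1 n) (0\<^sub>m n 1) M"
  have block_mult: "?block a M * ?block b N = ?block (a * b) (M * N)"
    if "M \<in> carrier_mat n n" "N \<in> carrier_mat n n" for a b M N
  proof -
    have "mat 1 1 (\<lambda>_. a) * mat 1 1 (\<lambda>_. b) = mat 1 1 (\<lambda>_. a * b)"
      by (rule eq_matI) (auto simp: scalar_prod_def)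
    then show ?thesis
      using that by (subst mult_four_block_mat[of _ 1 1 _ n _ n _ _ 1 _ n]) auto
  qed
  have block_transpose: "(?block a M)\<^sup>T = ?block a M\<^sup>T" if "M \<in> carrier_mat n n" for a M
  proof -
    have "(mat 1 1 (\<lambda>_. a))\<^sup>T = mat 1 1 (\<lambda>_. a)" by (rule eq_matI) auto
    then show ?thesis
      using that by (subst transpose_four_block_mat[of _ 1 1 _ n _ n]) auto
  qed
  have block_one: "?block 1 (1\<^sub>m n) = 1\<^sub>m (Suc n)"
    by (rule eq_matI) auto
  have B_eq: "B = ?block e C"
    using B by (intro eq_matI) (auto simp: B0 C_def)
  define R where "R = ?block 1 Q"
  have R: "R \<in> carrier_mat (Suc n) (Suc n)"
    using Q(1) by (auto simp: R_def)
  have RR: "R * R\<^sup>T = 1\<^sub>m (Suc n)" "R\<^sup>T * R = 1\<^sub>m (Suc n)"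
    using Q by (simp_all add: R_def block_transpose block_mult block_one del: One_nat_def)
  define E where "E = ?block e D"
  have E: "E \<in> carrier_mat (Suc n) (Suc n)" "diagonal_mat E"
    using D by (auto simp: E_def diagonal_mat_def)
  have B_RER: "B = R * E * R\<^sup>T"
    using Q(1) D(1)
    by (simp add: B_eq C_eq R_def E_def block_transpose block_mult del: One_nat_def)
  note assoc = assoc_mult_mat[of _ "Suc n" "Suc n" _ "Suc n" _ "Suc n"]
  have "(P * R) * (P * R)\<^sup>T = P * (R * R\<^sup>T) * P"
    using P(1,2) R by (simp add: transpose_mult[of _ "Suc n" "Suc n" _ "Suc n"] assoc)
  then have "(P * R) * (P * R)\<^sup>T = 1\<^sub>m (Suc n)" using P RR by simp
  moreover have "(P * R)\<^sup>T * (P * R) = R\<^sup>T * (P * P) * R"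
    using P(1,2) R by (simp add: transpose_mult[of _ "Suc n" "Suc n" _ "Suc n"] assoc)
  then have "(P * R)\<^sup>T * (P * R) = 1\<^sub>m (Suc n)" using P(3) RR R by simp
  moreover have "A = (P * R) * E * (P * R)\<^sup>T"
    using PBP P(1,2) R E(1) unfolding B_RER
    by (simp add: transpose_mult[of _ "Suc n" "Suc n" _ "Suc n"] assoc)
  ultimately show ?case
    using P(1) R E by (intro exI[of _ "P * R"] exI[of _ E]) auto
qed

section \<open>Orthonormal eigensystems of symmetric kernels\<close>

lemma mset_eq_imp_bij_betw_nth:
  assumes "mset xs = mset ys"
  obtains \<pi> where "bij_betw \<pi> {..<length xs} {..<length xs}" "\<And>i. i < length xs \<Longrightarrow> ys ! \<pi> i = xs ! i"
proof -
  obtain p where p: "p permutes {..<length ys}" "permute_list p ys = xs"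
    using mset_eq_permutation[OF assms] by auto
  have "length xs = length ys" using assms mset_eq_length by blast
  with p that[of p] show ?thesis
    by (auto simp: permutes_imp_bij permute_list_nth)
qed

text \<open>
  The functions \<open>w a\<close>, for \<open>a < card S\<close>, form an orthonormal basis of the functions on
  \<open>S\<close> that diagonalizes the kernel \<open>B\<close>.
\<close>

locale eigensystem =
  fixes S :: "nat set" and B :: "nat \<Rightarrow> nat \<Rightarrow> real" and \<mu> :: "nat \<Rightarrow> real" and w :: "nat \<Rightarrow> nat \<Rightarrow> real"
  assumes finite_S: "finite S"
    and orthonormal: "\<And>a b. a < card S \<Longrightarrow> b < card S \<Longrightarrow>
      (\<Sum>i\<in>S. w a i * w b i) = (if a = b then 1 else 0)"
    and complete: "\<And>i j. i \<in> S \<Longrightarrow> j \<in> S \<Longrightarrow>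
      (\<Sum>a<card S. w a i * w a j) = (if i = j then 1 else 0)"
    and decomp: "\<And>i j. i \<in> S \<Longrightarrow> j \<in> S \<Longrightarrow> B i j = (\<Sum>a<card S. \<mu> a * w a i * w a j)"
    and decreasing: "\<And>a b. a \<le> b \<Longrightarrow> b < card S \<Longrightarrow> \<mu> b \<le> \<mu> a"
begin

lemma eigen:
  assumes "i \<in> S" "a < card S"
  shows "(\<Sum>j\<in>S. B i j * w a j) = \<mu> a * w a i"
proof -
  have "(\<Sum>j\<in>S. B i j * w a j) = (\<Sum>b<card S. \<mu> b * w b i * (\<Sum>j\<in>S. w b j * w a j))"
    using assms unfolding sum_distrib_left
    by (subst sum.swap) (simp add: decomp sum_distrib_right mult.assoc)
  also have "\<dots> = (\<Sum>b<card S. if b = a then \<mu> a * w a i else 0)"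
    using assms by (intro sum.cong) (auto simp: orthonormal)
  finally show ?thesis using assms by simp
qed

lemma parseval:
  "(\<Sum>i\<in>S. x i * y i) = (\<Sum>a<card S. (\<Sum>i\<in>S. w a i * x i) * (\<Sum>i\<in>S. w a i * y i))"
proof -
  have "(\<Sum>a<card S. (\<Sum>i\<in>S. w a i * x i) * (\<Sum>i\<in>S. w a i * y i)) =
      (\<Sum>a<card S. \<Sum>i\<in>S. \<Sum>j\<in>S. x i * y j * (w a i * w a j))"
    by (simp add: sum_product mult_ac)
  also have "\<dots> = (\<Sum>i\<in>S. \<Sum>a<card S. \<Sum>j\<in>S. x i * y j * (w a i * w a j))"
    by (rule sum.swap)
  also have "\<dots> = (\<Sum>i\<in>S. \<Sum>j\<in>S. \<Sum>a<card S. x i * y j * (w a i * w a j))"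
    by (intro sum.cong refl sum.swap)
  also have "\<dots> = (\<Sum>i\<in>S. \<Sum>j\<in>S. x i * y j * (\<Sum>a<card S. w a i * w a j))"
    by (simp only: sum_distrib_left)
  also have "\<dots> = (\<Sum>i\<in>S. \<Sum>j\<in>S. if j = i then x i * y j else 0)"
    by (intro sum.cong) (auto simp: complete)
  finally show ?thesis using finite_S by simp
qed

lemma synthesis_norm: "(\<Sum>i\<in>S. (\<Sum>a<card S. c a * w a i)\<^sup>2) = (\<Sum>a<card S. (c a)\<^sup>2)"
proof -
  have "(\<Sum>i\<in>S. w b i * (\<Sum>a<card S. c a * w a i)) = c b" if "b < card S" for b
  proof -
    have "(\<Sum>i\<in>S. w b i * (\<Sum>a<card S. c a * w a i)) = (\<Sum>a<card S. c a * (\<Sum>i\<in>S. w b i * w a i))"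
      unfolding sum_distrib_left by (subst sum.swap) (simp add: mult_ac)
    also have "\<dots> = (\<Sum>a<card S. if a = b then c a else 0)"
      using that by (intro sum.cong) (auto simp: orthonormal)
    finally show ?thesis using that by simp
  qed
  then show ?thesis
    by (simp add: power2_eq_square parseval[of "\<lambda>i. \<Sum>a<card S. c a * w a i"])
qed

lemma quadratic_form:
  "(\<Sum>i\<in>S. \<Sum>j\<in>S. B i j * x i * x j) = (\<Sum>a<card S. \<mu> a * (\<Sum>i\<in>S. w a i * x i)\<^sup>2)"
proof -
  have "(\<Sum>a<card S. \<mu> a * (\<Sum>i\<in>S. w a i * x i)\<^sup>2) =
      (\<Sum>a<card S. \<Sum>i\<in>S. \<Sum>j\<in>S. \<mu> a * w a i * w a j * x i * x j)"
    by (simp add: power2_eq_square sum_product sum_distrib_left mult_ac)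
  also have "\<dots> = (\<Sum>i\<in>S. \<Sum>a<card S. \<Sum>j\<in>S. \<mu> a * w a i * w a j * x i * x j)"
    by (rule sum.swap)
  also have "\<dots> = (\<Sum>i\<in>S. \<Sum>j\<in>S. \<Sum>a<card S. \<mu> a * w a i * w a j * x i * x j)"
    by (intro sum.cong refl sum.swap)
  finally show ?thesis by (simp add: decomp sum_distrib_right)
qed

lemma row_product:
  assumes "i \<in> S" "k \<in> S"
  shows "(\<Sum>j\<in>S. B i j * B k j) = (\<Sum>a<card S. (\<mu> a)\<^sup>2 * w a i * w a k)"
proof -
  have sym: "(\<Sum>j\<in>S. w a j * B i j) = \<mu> a * w a i" if "i \<in> S" "a < card S" for i a
    using eigen[OF that] by (simp add: mult.commute)
  show ?thesis
    using assms by (subst parseval) (simp add: sym power2_eq_square mult.assoc mult.left_commute)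
qed

lemma row_sum_squares: "i \<in> S \<Longrightarrow> (\<Sum>j\<in>S. (B i j)\<^sup>2) = (\<Sum>a<card S. (\<mu> a * w a i)\<^sup>2)"
  using row_product[of i i] by (simp add: power2_eq_square mult_ac)

text \<open>Turns statements about the k-th largest eigenvalue into statements about the k-th
  smallest; reversing the index restores the decreasing order after negation.\<close>

lemma reverse: "eigensystem S (\<lambda>i j. - B i j) (\<lambda>a. - \<mu> (card S - 1 - a)) (\<lambda>a. w (card S - 1 - a))"
proof
  fix i j assume ij: "i \<in> S" "j \<in> S"
  have re: "(\<Sum>a<card S. f (card S - 1 - a)) = (\<Sum>a<card S. f a)" for f :: "nat \<Rightarrow> real"
    by (rule sum.reindex_bij_witness[of _ "\<lambda>a. card S - 1 - a" "\<lambda>a. card S - 1 - a"]) auto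
  show "(\<Sum>a<card S. w (card S - 1 - a) i * w (card S - 1 - a) j) = (if i = j then 1 else 0)"
    using re[of "\<lambda>a. w a i * w a j"] ij by (simp add: complete)
  show "- B i j = (\<Sum>a<card S. - \<mu> (card S - 1 - a) * w (card S - 1 - a) i * w (card S - 1 - a) j)"
    using re[of "\<lambda>a. - \<mu> a * w a i * w a j"] ij by (simp add: decomp sum_negf)
qed (auto simp: finite_S orthonormal intro: decreasing)

lemma quadratic_form_le:
  assumes k: "k < card S" and orth: "\<And>a. a < k \<Longrightarrow> (\<Sum>i\<in>S. w a i * x i) = 0"
  shows "(\<Sum>i\<in>S. \<Sum>j\<in>S. B i j * x i * x j) \<le> \<mu> k * (\<Sum>i\<in>S. (x i)\<^sup>2)"
proof -
  have "(\<Sum>a<card S. \<mu> a * (\<Sum>i\<in>S. w a i * x i)\<^sup>2) \<le> (\<Sum>a<card S. \<mu> k * (\<Sum>i\<in>S. w a i * x i)\<^sup>2)"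
  proof (rule sum_mono)
    fix a assume "a \<in> {..<card S}"
    then show "\<mu> a * (\<Sum>i\<in>S. w a i * x i)\<^sup>2 \<le> \<mu> k * (\<Sum>i\<in>S. w a i * x i)\<^sup>2"
      using orth[of a] decreasing[of k a] by (cases "a < k") (auto intro: mult_right_mono)
  qed
  then show ?thesis
    using parseval[of x x] by (simp add: quadratic_form power2_eq_square sum_distrib_left)
qed

text \<open>The min-max principle with explicit test vectors: the first hypothesis says that the
  \<open>k + 1\<close> functions \<open>y l\<close> are linearly independent on \<open>S\<close>,
  the second that the Rayleigh quotient is at least \<open>t\<close> on their span. Some nonzero
  combination is orthogonal to \<open>w 0, ..., w (k - 1)\<close>, and there the form is at most
  \<open>\<mu> k\<close> times the squared norm.\<close>

lemma eigenvalue_lower_bound: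
  fixes y :: "nat \<Rightarrow> nat \<Rightarrow> real"
  assumes "\<And>c. \<exists>l\<le>k. c l \<noteq> 0 \<Longrightarrow> (\<Sum>i\<in>S. (\<Sum>l\<le>k. c l * y l i)\<^sup>2) > 0"
    and "\<And>c. \<exists>l\<le>k. c l \<noteq> 0 \<Longrightarrow>
      (\<Sum>i\<in>S. \<Sum>j\<in>S. B i j * (\<Sum>l\<le>k. c l * y l i) * (\<Sum>l\<le>k. c l * y l j))
        \<ge> t * (\<Sum>i\<in>S. (\<Sum>l\<le>k. c l * y l i)\<^sup>2)"
  shows "k < card S" "\<mu> k \<ge> t"
proof -
  \<comment> \<open>The minimum serves both conclusions. If \<open>card S \<le> k\<close>, then
    orthogonality to the whole basis makes the combination vanish, a contradiction; otherwise the
    minimum is \<open>k\<close>.\<close>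
  have "\<exists>c. (\<exists>l\<in>{..k}. c l \<noteq> 0) \<and>
      (\<forall>a\<in>{..<min k (card S)}. (\<Sum>l\<le>k. c l * (\<Sum>i\<in>S. w a i * y l i)) = 0)"
    by (rule homogeneous_system_nontrivial_solution) auto
  then obtain c where c: "\<exists>l\<le>k. c l \<noteq> 0"
    "\<And>a. a < min k (card S) \<Longrightarrow> (\<Sum>l\<le>k. c l * (\<Sum>i\<in>S. w a i * y l i)) = 0"
    by (meson atMost_iff lessThan_iff)
  define x where "x = (\<lambda>i. \<Sum>l\<le>k. c l * y l i)"
  have orth: "(\<Sum>i\<in>S. w a i * x i) = 0" if "a < min k (card S)" for a
  proof -
    have "(\<Sum>i\<in>S. w a i * x i) = (\<Sum>l\<le>k. c l * (\<Sum>i\<in>S. w a i * y l i))"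
      unfolding x_def sum_distrib_left by (subst sum.swap) (simp add: mult_ac)
    then show ?thesis using c(2)[OF that] by simp
  qed
  have pos: "(\<Sum>i\<in>S. (x i)\<^sup>2) > 0" using assms(1)[OF c(1)] by (simp add: x_def)
  show k: "k < card S"
  proof (rule ccontr)
    assume "\<not> k < card S"
    then have "(\<Sum>i\<in>S. (x i)\<^sup>2) = 0"
      using parseval[of x x] orth by (simp add: power2_eq_square)
    then show False using pos by simp
  qed
  have "t * (\<Sum>i\<in>S. (x i)\<^sup>2) \<le> \<mu> k * (\<Sum>i\<in>S. (x i)\<^sup>2)"
    using assms(2)[OF c(1)] quadratic_form_le[OF k, of x] orth k by (simp add: x_def)
  then show "\<mu> k \<ge> t" using pos by simp
qed

lemma quadratic_form_leading_span:
  fixes c :: "nat \<Rightarrow> real"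
  assumes k: "k < card S"
  defines "x \<equiv> \<lambda>i. \<Sum>l\<le>k. c l * w l i"
  shows "(\<Sum>i\<in>S. (x i)\<^sup>2) = (\<Sum>l\<le>k. (c l)\<^sup>2)"
    and "(\<Sum>i\<in>S. \<Sum>j\<in>S. B i j * x i * x j) \<ge> \<mu> k * (\<Sum>i\<in>S. (x i)\<^sup>2)"
proof -
  have coeff: "(\<Sum>i\<in>S. w a i * x i) = (if a \<le> k then c a else 0)" if "a < card S" for a
  proof -
    have "(\<Sum>i\<in>S. w a i * x i) = (\<Sum>l\<le>k. c l * (\<Sum>i\<in>S. w a i * w l i))"
      unfolding x_def sum_distrib_left by (subst sum.swap) (simp add: mult_ac)
    also have "\<dots> = (\<Sum>l\<le>k. if l = a then c a else 0)"
      using k that by (intro sum.cong) (auto simp: orthonormal)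
    finally show ?thesis by simp
  qed
  have split: "(\<Sum>a<card S. if a \<le> k then f a else 0) = (\<Sum>a\<le>k. f a)" for f :: "nat \<Rightarrow> real"
    using k by (intro sum.mono_neutral_cong_right) auto
  have "(\<Sum>i\<in>S. (x i)\<^sup>2) = (\<Sum>a<card S. if a \<le> k then (c a)\<^sup>2 else 0)"
    using parseval[of x x] by (auto simp: power2_eq_square coeff intro!: sum.cong)
  then show norm: "(\<Sum>i\<in>S. (x i)\<^sup>2) = (\<Sum>l\<le>k. (c l)\<^sup>2)" by (simp only: split)
  have "(\<Sum>i\<in>S. \<Sum>j\<in>S. B i j * x i * x j) = (\<Sum>a<card S. if a \<le> k then \<mu> a * (c a)\<^sup>2 else 0)"
    unfolding quadratic_form by (auto simp: coeff intro!: sum.cong)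
  also have "\<dots> = (\<Sum>a\<le>k. \<mu> a * (c a)\<^sup>2)" by (simp only: split)
  also have "\<dots> \<ge> (\<Sum>a\<le>k. \<mu> k * (c a)\<^sup>2)"
    using k by (intro sum_mono mult_right_mono decreasing) auto
  finally show "(\<Sum>i\<in>S. \<Sum>j\<in>S. B i j * x i * x j) \<ge> \<mu> k * (\<Sum>i\<in>S. (x i)\<^sup>2)"
    by (simp add: norm sum_distrib_left)
qed

end

text \<open>One-sided Weyl inequality: the leading eigenvectors of \<open>A\<close> are the test
  vectors for \<open>B\<close>.\<close>

lemma eigensystem_weyl:
  assumes "eigensystem S A \<alpha> u" "eigensystem S B \<beta> w"
    and "\<And>x. (\<Sum>i\<in>S. \<Sum>j\<in>S. (B i j - A i j) * x i * x j) \<ge> - t * (\<Sum>i\<in>S. (x i)\<^sup>2)"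
    and k: "k < card S"
  shows "\<beta> k \<ge> \<alpha> k - t"
proof -
  interpret A: eigensystem S A \<alpha> u by fact
  interpret B: eigensystem S B \<beta> w by fact
  show ?thesis
  proof (rule B.eigenvalue_lower_bound)
    fix c :: "nat \<Rightarrow> real" assume c: "\<exists>l\<le>k. c l \<noteq> 0"
    let ?x = "\<lambda>i. \<Sum>l\<le>k. c l * u l i"
    from c have "(\<Sum>l\<le>k. (c l)\<^sup>2) > 0" by (auto intro: sum_pos2)
    then show "(\<Sum>i\<in>S. (?x i)\<^sup>2) > 0" by (simp add: A.quadratic_form_leading_span(1)[OF k])
    have "(\<Sum>i\<in>S. \<Sum>j\<in>S. B i j * ?x i * ?x j) =
        (\<Sum>i\<in>S. \<Sum>j\<in>S. A i j * ?x i * ?x j) + (\<Sum>i\<in>S. \<Sum>j\<in>S. (B i j - A i j) * ?x i * ?x j)"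
      by (simp only: sum.distrib [symmetric]) (simp add: algebra_simps)
    then show "(\<Sum>i\<in>S. \<Sum>j\<in>S. B i j * ?x i * ?x j) \<ge> (\<alpha> k - t) * (\<Sum>i\<in>S. (?x i)\<^sup>2)"
      using assms(3)[of ?x] A.quadratic_form_leading_span(2)[OF k, of c] by (simp add: algebra_simps)
  qed
qed

lemma eigensystem_reindex:
  assumes "eigensystem T B \<mu> w" "bij_betw g S T"
    and "\<And>i j. i \<in> S \<Longrightarrow> j \<in> S \<Longrightarrow> C i j = B (g i) (g j)"
  shows "eigensystem S C \<mu> (\<lambda>a i. w a (g i))"
proof -
  interpret eigensystem T B \<mu> w by fact
  have card: "card S = card T" using assms(2) by (rule bij_betw_same_card)
  have inj: "inj_on g S" and mem: "\<And>i. i \<in> S \<Longrightarrow> g i \<in> T"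
    using assms(2) by (auto simp: bij_betw_def)
  show ?thesis
  proof
    fix a b assume "a < card S" "b < card S"
    then show "(\<Sum>i\<in>S. w a (g i) * w b (g i)) = (if a = b then 1 else 0)"
      using sum.reindex_bij_betw[OF assms(2), of "\<lambda>i. w a i * w b i"] by (simp add: card orthonormal)
  qed (use assms(2,3) inj mem in \<open>auto simp: card complete decomp decreasing finite_S
        inj_on_eq_iff bij_betw_finite\<close>)
qed

section \<open>Eigenvalues of matrices and of their principal submatrices\<close>

lemma proots_prod_linear_factors: "proots (\<Prod>a\<leftarrow>as. [:- a, 1:] :: real poly) = mset as"
proof (induction as)
  case (Cons a as)
  have "(\<Prod>a\<leftarrow>as. [:- a, 1:] :: real poly) \<noteq> 0" by (auto simp: prod_list_zero_iff)
  then have "proots ([:- a, 1:] * (\<Prod>a\<leftarrow>as. [:- a, 1:])) = {#a#} + mset as"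
    using Cons proots_mult[of "[:- a, 1:]"] by (simp del: mult_pCons_left)
  then show ?case by (simp del: mult_pCons_left)
qed simp

text \<open>Similar matrices share their characteristic polynomial, so the sorted list of roots is a
  permutation \<pi> of the diagonal of \<open>D\<close>, and column \<open>\<pi> a\<close> of
  \<open>Q\<close> is an eigenvector for the \<open>a\<close>-th entry of the list.\<close>

lemma real_symmetric_eigensystem:
  fixes A :: "real mat"
  assumes A: "A \<in> carrier_mat n n" and sym: "A\<^sup>T = A"
  shows "\<exists>w. eigensystem {..<n} (\<lambda>i j. A $$ (i, j)) (\<lambda>a. eigenvalues_desc A ! a) w"
proof -
  obtain Q D where Q: "Q \<in> carrier_mat n n" "Q * Q\<^sup>T = 1\<^sub>m n" "Q\<^sup>T * Q = 1\<^sub>m n"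
    and D: "D \<in> carrier_mat n n" "diagonal_mat D" and A_eq: "A = Q * D * Q\<^sup>T"
    using real_symmetric_diagonalization[OF assms] by auto
  have "similar_mat_wit A D Q Q\<^sup>T"
    using A D Q A_eq by (intro similar_mat_witI[of _ _ n]) auto
  then have "char_poly A = char_poly D"
    by (intro char_poly_similar) (auto simp: similar_mat_def)
  also have "\<dots> = (\<Prod>a\<leftarrow>diag_mat D. [:- a, 1:])"
    using D by (intro char_poly_upper_triangular[of _ n]) (auto simp: diagonal_mat_def)
  finally have "mset (eigenvalues_desc A) = mset (diag_mat D)"
    by (simp add: eigenvalues_desc_def proots_prod_linear_factors)
  note mset = this
  have len: "length (diag_mat D) = n" "length (eigenvalues_desc A) = n"
    using D mset_eq_length[OF mset] by (auto simp: diag_mat_def)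
  obtain \<pi> where \<pi>: "bij_betw \<pi> {..<n} {..<n}"
    and diag': "\<And>a. a < n \<Longrightarrow> diag_mat D ! \<pi> a = eigenvalues_desc A ! a"
    using mset_eq_imp_bij_betw_nth[OF mset] len by metis
  have \<pi>_lt: "\<pi> a < n" if "a < n" for a using \<pi> that by (auto simp: bij_betw_def)
  have diag: "D $$ (\<pi> a, \<pi> a) = eigenvalues_desc A ! a" if "a < n" for a
    using diag'[OF that] \<pi>_lt[OF that] D by (simp add: diag_mat_def)
  have \<pi>_inj: "\<pi> a = \<pi> b \<longleftrightarrow> a = b" if "a < n" "b < n" for a b
    using \<pi> that by (auto simp: bij_betw_def inj_on_def)
  have "eigensystem {..<n} (\<lambda>i j. A $$ (i, j)) (\<lambda>a. eigenvalues_desc A ! a) (\<lambda>a i. Q $$ (i, \<pi> a))"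
  proof
    fix a b assume "a < card {..<n}" "b < card {..<n}"
    then have ab: "a < n" "b < n" by auto
    have "(Q\<^sup>T * Q) $$ (\<pi> a, \<pi> b) = (\<Sum>i<n. Q $$ (i, \<pi> a) * Q $$ (i, \<pi> b))"
      using ab \<pi>_lt Q(1) by (simp add: scalar_prod_def lessThan_atLeast0)
    then show "(\<Sum>i<n. Q $$ (i, \<pi> a) * Q $$ (i, \<pi> b)) = (if a = b then 1 else 0)"
      using ab \<pi>_lt \<pi>_inj by (simp add: Q(3))
  next
    fix i j assume "i \<in> {..<n}" "j \<in> {..<n}"
    then have ij: "i < n" "j < n" by auto
    have "(Q * Q\<^sup>T) $$ (i, j) = (\<Sum>a<n. Q $$ (i, a) * Q $$ (j, a))"
      using ij Q(1) by (simp add: scalar_prod_def lessThan_atLeast0)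
    also have "\<dots> = (\<Sum>a<n. Q $$ (i, \<pi> a) * Q $$ (j, \<pi> a))"
      by (rule sum.reindex_bij_betw[OF \<pi>, symmetric])
    finally show "(\<Sum>a<card {..<n}. Q $$ (i, \<pi> a) * Q $$ (j, \<pi> a)) = (if i = j then 1 else 0)"
      using ij by (simp add: Q(2))
    have QD: "(Q * D) $$ (i, a) = Q $$ (i, a) * D $$ (a, a)" if "a < n" for a
    proof -
      have "(Q * D) $$ (i, a) = (\<Sum>k<n. Q $$ (i, k) * D $$ (k, a))"
        using ij Q(1) D(1) that by (simp add: scalar_prod_def lessThan_atLeast0)
      also have "\<dots> = (\<Sum>k<n. if k = a then Q $$ (i, a) * D $$ (a, a) else 0)"
        using D that by (intro sum.cong) (auto simp: diagonal_mat_def)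
      finally show ?thesis using that by simp
    qed
    have "A $$ (i, j) = (\<Sum>a<n. (Q * D) $$ (i, a) * Q $$ (j, a))"
      unfolding A_eq using ij Q(1) D(1)
      by (simp add: scalar_prod_def lessThan_atLeast0 del: assoc_mult_mat)
    also have "\<dots> = (\<Sum>a<n. D $$ (a, a) * Q $$ (i, a) * Q $$ (j, a))"
      by (simp add: QD mult_ac)
    also have "\<dots> = (\<Sum>a<n. D $$ (\<pi> a, \<pi> a) * Q $$ (i, \<pi> a) * Q $$ (j, \<pi> a))"
      by (rule sum.reindex_bij_betw[OF \<pi>, symmetric])
    finally show "A $$ (i, j) =
        (\<Sum>a<card {..<n}. eigenvalues_desc A ! a * Q $$ (i, \<pi> a) * Q $$ (j, \<pi> a))"
      by (simp add: diag)
  next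
    fix a b :: nat assume "a \<le> b" "b < card {..<n}"
    then show "eigenvalues_desc A ! b \<le> eigenvalues_desc A ! a"
      using len unfolding eigenvalues_desc_def
      by (simp add: rev_nth sorted_nth_mono)
  qed simp
  then show ?thesis by blast
qed

text \<open>\<open>submatrix\<close> renumbers the elements of \<open>S\<close> by their rank
  \<open>g\<close>. The eigensystem is carried back along \<open>g\<close>, so that all later sums
  run over \<open>S\<close> itself.\<close>

lemma submatrix_eigensystem:
  fixes B :: "nat \<Rightarrow> nat \<Rightarrow> real"
  assumes S: "S \<subseteq> {..<n}" and sym: "\<And>i j. i \<in> S \<Longrightarrow> j \<in> S \<Longrightarrow> B i j = B j i"
  shows "\<exists>w. eigensystem S B
    (\<lambda>a. eigenvalues_desc (submatrix (mat n n (\<lambda>(i, j). B i j)) S S) ! a) w"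
proof -
  let ?M = "submatrix (mat n n (\<lambda>(i, j). B i j)) S S"
  define g where "g = (\<lambda>i. card {a \<in> S. a < i})"
  have fin: "finite S" using S finite_subset by auto
  have restrict: "{i. i < n \<and> i \<in> S} = S" using S by auto
  have M: "?M \<in> carrier_mat (card S) (card S)"
    by (auto simp: submatrix_def restrict)
  have g_mem: "g ` S \<subseteq> {..<card S}"
    unfolding g_def using fin by (auto intro!: psubset_card_mono)
  have g_inj: "inj_on g S"
    by (rule inj_on_inverseI[of _ "pick S"]) (simp add: g_def pick_card_in_set)
  have g: "bij_betw g S {..<card S}"
    unfolding bij_betw_def using g_mem g_inj by (simp add: card_image card_subset_eq)
  have entry: "?M $$ (g i, g j) = B i j" if "i \<in> S" "j \<in> S" for i j
    using that S submatrix_index_card[of i "mat n n (\<lambda>(i, j). B i j)" j S S]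
    by (auto simp: g_def)
  have "?M\<^sup>T = ?M"
  proof (rule eq_matI)
    fix a b assume "a < dim_row ?M" "b < dim_col ?M"
    then obtain i j where ij: "i \<in> S" "j \<in> S" "a = g i" "b = g j" and ab: "a < card S" "b < card S"
      using M g by (auto simp: bij_betw_def) (metis imageE lessThan_iff)
    then show "?M\<^sup>T $$ (a, b) = ?M $$ (a, b)"
      using M entry[of i j] entry[of j i] sym[of i j] by simp
  qed (use M in auto)
  then obtain w where "eigensystem {..<card S} (\<lambda>i j. ?M $$ (i, j)) (\<lambda>a. eigenvalues_desc ?M ! a) w"
    using real_symmetric_eigensystem[OF M] by auto
  from eigensystem_reindex[OF this g, of B] show ?thesis using entry by auto
qed

section \<open>Eigenvalues of a sampled kernel\<close>

definition dominant :: "nat \<Rightarrow> (nat \<Rightarrow> real) \<Rightarrow> real \<Rightarrow> nat set" where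
  "dominant n \<alpha> \<beta> = {k. k < n \<and> \<beta> \<le> \<bar>\<alpha> k\<bar>}"

text \<open>Defined by subtraction, not as a sum over the small eigenvalues, so that the entrywise
  facts on \<open>B\<close> apply at once; \<open>tail_decomp\<close> gives the other form.\<close>

definition spectral_tail ::
  "nat \<Rightarrow> (nat \<Rightarrow> nat \<Rightarrow> real) \<Rightarrow> (nat \<Rightarrow> real) \<Rightarrow> (nat \<Rightarrow> nat \<Rightarrow> real) \<Rightarrow> real \<Rightarrow> nat \<Rightarrow> nat \<Rightarrow> real" where
  "spectral_tail n B \<alpha> u \<beta> i j = B i j - (\<Sum>k\<in>dominant n \<alpha> \<beta>. \<alpha> k * u k i * u k j)"

text \<open>The deviation from orthonormality after sampling. If each \<open>i\<close> is included
  with probability \<open>p i\<close> and the \<open>u k\<close> are orthonormal, it has mean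
  zero.\<close>

definition gram_error :: "nat set \<Rightarrow> (nat \<Rightarrow> real) \<Rightarrow> (nat \<Rightarrow> nat \<Rightarrow> real) \<Rightarrow> nat \<Rightarrow> nat \<Rightarrow> real" where
  "gram_error S p u k l = (\<Sum>i\<in>S. u k i * u l i / p i) - (if k = l then 1 else 0)"

lemma finite_dominant [simp]: "finite (dominant n \<alpha> \<beta>)"
  by (simp add: dominant_def)

section \<open>Deterministic comparison of the spectra for a fixed sample\<close>

text \<open>\<open>tail_small\<close> bounds by \<eta> the operator norm of the tail restricted to
  \<open>S\<close> and rescaled by \<open>1 / sqrt (p i * p j)\<close>, written with
  \<open>y i = x i / sqrt (p i)\<close>. \<open>gram_small\<close> bounds by \<tau> the Frobenius
  norm of the matrix with entries \<open>sqrt \<bar>\<alpha> k\<bar> * \<Delta> k l * sqrt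
  \<bar>\<alpha> l\<bar>\<close>.\<close>

locale spectral_sample =
  fixes n :: nat and B :: "nat \<Rightarrow> nat \<Rightarrow> real" and \<alpha> :: "nat \<Rightarrow> real" and u :: "nat \<Rightarrow> nat \<Rightarrow> real"
    and \<beta> :: real and S :: "nat set" and p :: "nat \<Rightarrow> real" and \<eta> \<tau> :: real
  assumes eigensystem: "eigensystem {..<n} B \<alpha> u"
    and S_subset: "S \<subseteq> {..<n}" and p_pos: "\<And>i. i \<in> S \<Longrightarrow> p i > 0"
    and \<beta>_pos: "\<beta> > 0" and \<tau>_nonneg: "\<tau> \<ge> 0"
    and tail_small: "\<And>y. \<bar>\<Sum>i\<in>S. \<Sum>j\<in>S. spectral_tail n B \<alpha> u \<beta> i j * y i * y j\<bar>
      \<le> \<eta> * (\<Sum>i\<in>S. p i * (y i)\<^sup>2)"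
    and gram_small: "(\<Sum>k\<in>dominant n \<alpha> \<beta>. \<Sum>l\<in>dominant n \<alpha> \<beta>.
      \<bar>\<alpha> k\<bar> * \<bar>\<alpha> l\<bar> * (gram_error S p u k l)\<^sup>2) \<le> \<tau>\<^sup>2"
begin

sublocale full: eigensystem "{..<n}" B \<alpha> u by (rule eigensystem)

abbreviation "K \<equiv> dominant n \<alpha> \<beta>"
abbreviation "\<Delta> \<equiv> gram_error S p u"

lemma finite_S [simp]: "finite S" using S_subset finite_subset by blast

lemma dominant_abs_pos: "k \<in> K \<Longrightarrow> \<bar>\<alpha> k\<bar> > 0" using \<beta>_pos by (auto simp: dominant_def)

text \<open>In the coordinates \<open>c l / sqrt \<bar>\<alpha> l\<bar>\<close> the Gram error
  becomes the weighted matrix of \<open>gram_small\<close>, and a Frobenius norm bounds an operator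
  norm. \<open>gram_error_form\<close> is the same bound for its quadratic form.\<close>

lemma gram_error_apply:
  "(\<Sum>k\<in>K. \<bar>\<alpha> k\<bar> * (\<Sum>l\<in>K. \<Delta> k l * c l)\<^sup>2) \<le> \<tau>\<^sup>2 * (\<Sum>l\<in>K. (c l)\<^sup>2 / \<bar>\<alpha> l\<bar>)"
proof -
  have "\<bar>\<alpha> k\<bar> * (\<Sum>l\<in>K. \<Delta> k l * c l)\<^sup>2 \<le>
      (\<Sum>l\<in>K. \<bar>\<alpha> k\<bar> * \<bar>\<alpha> l\<bar> * (\<Delta> k l)\<^sup>2) * (\<Sum>l\<in>K. (c l)\<^sup>2 / \<bar>\<alpha> l\<bar>)" for k
  proof -
    have "(\<Sum>l\<in>K. \<Delta> k l * c l) = (\<Sum>l\<in>K. (sqrt \<bar>\<alpha> l\<bar> * \<Delta> k l) * (c l / sqrt \<bar>\<alpha> l\<bar>))"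
      using dominant_abs_pos by (intro sum.cong) auto
    then have "(\<Sum>l\<in>K. \<Delta> k l * c l)\<^sup>2 \<le>
        (\<Sum>l\<in>K. (sqrt \<bar>\<alpha> l\<bar> * \<Delta> k l)\<^sup>2) * (\<Sum>l\<in>K. (c l / sqrt \<bar>\<alpha> l\<bar>)\<^sup>2)"
      by (simp only: Cauchy_Schwarz_ineq_sum)
    also have "\<dots> = (\<Sum>l\<in>K. \<bar>\<alpha> l\<bar> * (\<Delta> k l)\<^sup>2) * (\<Sum>l\<in>K. (c l)\<^sup>2 / \<bar>\<alpha> l\<bar>)"
      by (simp add: power_mult_distrib power_divide)
    finally have "\<bar>\<alpha> k\<bar> * (\<Sum>l\<in>K. \<Delta> k l * c l)\<^sup>2 \<le>
        \<bar>\<alpha> k\<bar> * ((\<Sum>l\<in>K. \<bar>\<alpha> l\<bar> * (\<Delta> k l)\<^sup>2) * (\<Sum>l\<in>K. (c l)\<^sup>2 / \<bar>\<alpha> l\<bar>))"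
      by (rule mult_left_mono) simp
    then show ?thesis
      unfolding mult.assoc [symmetric] sum_distrib_left [of "\<bar>\<alpha> k\<bar>"] .
  qed
  then have "(\<Sum>k\<in>K. \<bar>\<alpha> k\<bar> * (\<Sum>l\<in>K. \<Delta> k l * c l)\<^sup>2) \<le>
      (\<Sum>k\<in>K. (\<Sum>l\<in>K. \<bar>\<alpha> k\<bar> * \<bar>\<alpha> l\<bar> * (\<Delta> k l)\<^sup>2) * (\<Sum>l\<in>K. (c l)\<^sup>2 / \<bar>\<alpha> l\<bar>))"
    by (intro sum_mono) auto
  also have "\<dots> = (\<Sum>k\<in>K. \<Sum>l\<in>K. \<bar>\<alpha> k\<bar> * \<bar>\<alpha> l\<bar> * (\<Delta> k l)\<^sup>2) * (\<Sum>l\<in>K. (c l)\<^sup>2 / \<bar>\<alpha> l\<bar>)"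
    by (simp add: sum_distrib_right)
  also have "\<dots> \<le> \<tau>\<^sup>2 * (\<Sum>l\<in>K. (c l)\<^sup>2 / \<bar>\<alpha> l\<bar>)"
    using gram_small by (intro mult_right_mono) (auto intro: sum_nonneg)
  finally show ?thesis .
qed

lemma gram_error_form:
  "\<bar>\<Sum>k\<in>K. c k * (\<Sum>l\<in>K. \<Delta> k l * c l)\<bar> \<le> \<tau> * (\<Sum>l\<in>K. (c l)\<^sup>2 / \<bar>\<alpha> l\<bar>)"
proof (rule power2_le_imp_le)
  let ?g = "\<lambda>k. \<Sum>l\<in>K. \<Delta> k l * c l" and ?N = "\<Sum>l\<in>K. (c l)\<^sup>2 / \<bar>\<alpha> l\<bar>"
  have N: "?N \<ge> 0" by (intro sum_nonneg) auto
  have "(\<Sum>k\<in>K. c k * ?g k) = (\<Sum>k\<in>K. (c k / sqrt \<bar>\<alpha> k\<bar>) * (sqrt \<bar>\<alpha> k\<bar> * ?g k))"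
    using dominant_abs_pos by (intro sum.cong) auto
  then have "(\<Sum>k\<in>K. c k * ?g k)\<^sup>2 \<le>
      (\<Sum>k\<in>K. (c k / sqrt \<bar>\<alpha> k\<bar>)\<^sup>2) * (\<Sum>k\<in>K. (sqrt \<bar>\<alpha> k\<bar> * ?g k)\<^sup>2)"
    by (simp only: Cauchy_Schwarz_ineq_sum)
  also have "\<dots> = ?N * (\<Sum>k\<in>K. \<bar>\<alpha> k\<bar> * (?g k)\<^sup>2)"
    by (simp add: power_mult_distrib power_divide)
  also have "\<dots> \<le> ?N * (\<tau>\<^sup>2 * ?N)"
    using N by (intro mult_left_mono gram_error_apply)
  finally show "\<bar>\<Sum>k\<in>K. c k * ?g k\<bar>\<^sup>2 \<le> (\<tau> * ?N)\<^sup>2"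
    by (simp add: power2_eq_square mult_ac)
  show "0 \<le> \<tau> * ?N" using N \<tau>_nonneg by simp
qed

lemma weighted_inner:
  assumes "k \<in> K"
  shows "(\<Sum>i\<in>S. u k i * ((\<Sum>l\<in>K. c l * u l i) / p i)) = c k + (\<Sum>l\<in>K. \<Delta> k l * c l)"
proof -
  have "(\<Sum>i\<in>S. u k i * ((\<Sum>l\<in>K. c l * u l i) / p i)) = (\<Sum>i\<in>S. \<Sum>l\<in>K. c l * (u k i * u l i / p i))"
    by (simp add: sum_distrib_left sum_divide_distrib mult_ac)
  also have "\<dots> = (\<Sum>l\<in>K. \<Sum>i\<in>S. c l * (u k i * u l i / p i))" by (rule sum.swap)
  also have "\<dots> = (\<Sum>l\<in>K. c l * (\<Sum>i\<in>S. u k i * u l i / p i))"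
    by (simp add: sum_distrib_left)
  also have "\<dots> = (\<Sum>l\<in>K. \<Delta> k l * c l + (if l = k then c k else 0))"
    by (intro sum.cong) (auto simp: gram_error_def algebra_simps)
  finally show ?thesis using assms by (simp add: sum.distrib)
qed

lemma weighted_norm:
  "(\<Sum>i\<in>S. (\<Sum>l\<in>K. c l * u l i)\<^sup>2 / p i) = (\<Sum>k\<in>K. c k * (c k + (\<Sum>l\<in>K. \<Delta> k l * c l)))"
proof -
  have "(\<Sum>i\<in>S. (\<Sum>l\<in>K. c l * u l i)\<^sup>2 / p i) =
      (\<Sum>i\<in>S. \<Sum>k\<in>K. c k * (u k i * ((\<Sum>l\<in>K. c l * u l i) / p i)))"
    by (simp add: power2_eq_square sum_distrib_right mult.assoc flip: sum_divide_distrib)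
  also have "\<dots> = (\<Sum>k\<in>K. \<Sum>i\<in>S. c k * (u k i * ((\<Sum>l\<in>K. c l * u l i) / p i)))"
    by (rule sum.swap)
  also have "\<dots> = (\<Sum>k\<in>K. c k * (\<Sum>i\<in>S. u k i * ((\<Sum>l\<in>K. c l * u l i) / p i)))"
    by (simp add: sum_distrib_left)
  also have "\<dots> = (\<Sum>k\<in>K. c k * (c k + (\<Sum>l\<in>K. \<Delta> k l * c l)))"
    by (intro sum.cong refl) (simp only: weighted_inner)
  finally show ?thesis .
qed

lemma form_split:
  "(\<Sum>i\<in>S. \<Sum>j\<in>S. B i j * y i * y j) =
    (\<Sum>k\<in>K. \<alpha> k * (\<Sum>i\<in>S. u k i * y i)\<^sup>2) + (\<Sum>i\<in>S. \<Sum>j\<in>S. spectral_tail n B \<alpha> u \<beta> i j * y i * y j)"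
proof -
  have "(\<Sum>k\<in>K. \<alpha> k * (\<Sum>i\<in>S. u k i * y i)\<^sup>2) =
      (\<Sum>k\<in>K. \<Sum>i\<in>S. \<Sum>j\<in>S. \<alpha> k * u k i * u k j * y i * y j)"
    by (simp add: power2_eq_square sum_product sum_distrib_left mult_ac)
  also have "\<dots> = (\<Sum>i\<in>S. \<Sum>k\<in>K. \<Sum>j\<in>S. \<alpha> k * u k i * u k j * y i * y j)"
    by (rule sum.swap)
  also have "\<dots> = (\<Sum>i\<in>S. \<Sum>j\<in>S. \<Sum>k\<in>K. \<alpha> k * u k i * u k j * y i * y j)"
    by (intro sum.cong refl sum.swap)
  also have "\<dots> = (\<Sum>i\<in>S. \<Sum>j\<in>S. (\<Sum>k\<in>K. \<alpha> k * u k i * u k j) * y i * y j)"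
    by (simp add: sum_distrib_right)
  finally show ?thesis
    by (simp only: sum.distrib [symmetric]) (simp add: spectral_tail_def algebra_simps)
qed

lemma rescaled_form:
  assumes "\<And>i j. i \<in> S \<Longrightarrow> j \<in> S \<Longrightarrow> C i j = B i j / sqrt (p i * p j)"
  shows "(\<Sum>i\<in>S. \<Sum>j\<in>S. C i j * x i * x j) =
      (\<Sum>i\<in>S. \<Sum>j\<in>S. B i j * (x i / sqrt (p i)) * (x j / sqrt (p j)))"
  using assms p_pos by (intro sum.cong refl) (simp add: real_sqrt_mult)

lemma rescaled_norm: "(\<Sum>i\<in>S. p i * (x i / sqrt (p i))\<^sup>2) = (\<Sum>i\<in>S. (x i)\<^sup>2)"
proof (rule sum.cong)
  fix i assume "i \<in> S"
  then show "p i * (x i / sqrt (p i))\<^sup>2 = (x i)\<^sup>2"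
    using p_pos[of i] by (simp add: power_divide)
qed simp

text \<open>
  The test vectors are the leading eigenvectors of \<open>B\<close>, restricted to \<open>S\<close> and divided by
  \<open>sqrt (p i)\<close>; by \<open>gram_small\<close> they stay nearly orthonormal.
\<close>

lemma sampled_eigenvalue_ge:
  assumes C: "eigensystem S C \<mu> w" "\<And>i j. i \<in> S \<Longrightarrow> j \<in> S \<Longrightarrow> C i j = B i j / sqrt (p i * p j)"
    and k: "k < n" "\<alpha> k \<ge> \<beta>" "\<alpha> k \<ge> 2 * \<tau>"
  shows "k < card S" "\<mu> k \<ge> \<alpha> k - 2 * \<tau> - \<eta>"
proof -
  interpret C: eigensystem S C \<mu> w by fact
  have form: "(\<Sum>i\<in>S. \<Sum>j\<in>S. C i j * x i * x j) =
      (\<Sum>i\<in>S. \<Sum>j\<in>S. B i j * (x i / sqrt (p i)) * (x j / sqrt (p j)))" for x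
    using C(2) by (rule rescaled_form)
  have \<alpha>k: "\<alpha> k > 0" using k \<beta>_pos by auto
  have lead: "{..k} \<subseteq> K" and lead_ge: "\<And>l. l \<le> k \<Longrightarrow> \<alpha> l \<ge> \<alpha> k"
    using k full.decreasing[of _ k] by (force simp: dominant_def)+
  let ?y = "\<lambda>l i. u l i / sqrt (p i)"
  have "0 < (\<Sum>i\<in>S. (\<Sum>l\<le>k. c l * ?y l i)\<^sup>2) \<and>
    (\<alpha> k - 2 * \<tau> - \<eta>) * (\<Sum>i\<in>S. (\<Sum>l\<le>k. c l * ?y l i)\<^sup>2) \<le>
      (\<Sum>i\<in>S. \<Sum>j\<in>S. C i j * (\<Sum>l\<le>k. c l * ?y l i) * (\<Sum>l\<le>k. c l * ?y l j))"
    if c: "\<exists>l\<le>k. c l \<noteq> 0" for c :: "nat \<Rightarrow> real"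
  proof -
    \<comment> \<open>\<open>d\<close> extends \<open>c\<close> by zero to all of \<open>K\<close>,
      because the Gram error bounds sum over \<open>K\<close>; \<open>e\<close> is the Gram error
      applied to \<open>d\<close>, so that \<open>g = d + e\<close> on \<open>K\<close>.\<close>
    define d where "d = (\<lambda>l. if l \<le> k then c l else 0)"
    define x where "x = (\<lambda>i. \<Sum>l\<le>k. c l * ?y l i)"
    define g where "g = (\<lambda>l. \<Sum>i\<in>S. u l i * (x i / sqrt (p i)))"
    define e where "e = (\<lambda>k. \<Sum>l\<in>K. \<Delta> k l * d l)"
    define W N where "W = (\<Sum>i\<in>S. (x i)\<^sup>2)" and "N = (\<Sum>l\<le>k. (c l)\<^sup>2)"
    have sum_d: "(\<Sum>l\<in>K. d l * f l) = (\<Sum>l\<le>k. c l * f l)" for f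
      using lead by (intro sum.mono_neutral_cong_right) (auto simp: d_def)
    have x: "x i / sqrt (p i) = (\<Sum>l\<in>K. d l * u l i) / p i" if "i \<in> S" for i
      using p_pos[OF that] by (simp add: x_def sum_d flip: sum_divide_distrib)
    have x2: "(x i)\<^sup>2 = (\<Sum>l\<in>K. d l * u l i)\<^sup>2 / p i" if "i \<in> S" for i
      using p_pos[OF that] by (simp add: x_def sum_d power_divide flip: sum_divide_distrib)
    have N_pos: "N > 0" using c by (auto simp: N_def intro: sum_pos2)
    have g: "g l = d l + e l" if "l \<in> K" for l
      using weighted_inner[OF that, of d] by (simp add: g_def x e_def)
    have W_g: "W = (\<Sum>l\<le>k. c l * g l)"
    proof -
      have "W = (\<Sum>l\<in>K. d l * (d l + e l))"
        unfolding W_def e_def by (simp add: x2 weighted_norm)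
      also have "\<dots> = (\<Sum>l\<in>K. d l * g l)" by (intro sum.cong) (auto simp: g)
      finally show ?thesis by (simp add: sum_d)
    qed
    have inv: "(\<Sum>l\<in>K. (d l)\<^sup>2 / \<bar>\<alpha> l\<bar>) \<le> N / \<alpha> k"
    proof -
      have "(\<Sum>l\<in>K. (d l)\<^sup>2 / \<bar>\<alpha> l\<bar>) = (\<Sum>l\<le>k. (c l)\<^sup>2 / \<bar>\<alpha> l\<bar>)"
        using lead by (intro sum.mono_neutral_cong_right) (auto simp: d_def)
      also have "\<dots> \<le> (\<Sum>l\<le>k. (c l)\<^sup>2 / \<alpha> k)"
      proof (rule sum_mono)
        fix l assume "l \<in> {..k}"
        then have "\<alpha> k \<le> \<bar>\<alpha> l\<bar>" using lead_ge[of l] by simp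
        then show "(c l)\<^sup>2 / \<bar>\<alpha> l\<bar> \<le> (c l)\<^sup>2 / \<alpha> k" using \<alpha>k by (simp add: frac_le)
      qed
      finally show ?thesis by (simp add: N_def sum_divide_distrib)
    qed
    have WN: "\<bar>W - N\<bar> \<le> \<tau> * (N / \<alpha> k)"
    proof -
      have "W - N = (\<Sum>l\<le>k. c l * e l)"
        unfolding W_g N_def using lead
        by (simp add: sum_subtractf [symmetric]) (intro sum.cong, auto simp: g d_def power2_eq_square algebra_simps)
      also have "\<dots> = (\<Sum>l\<in>K. d l * e l)" by (simp add: sum_d)
      finally have "\<bar>W - N\<bar> \<le> \<tau> * (\<Sum>l\<in>K. (d l)\<^sup>2 / \<bar>\<alpha> l\<bar>)"
        using gram_error_form[of d] by (simp add: e_def)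
      also have "\<dots> \<le> \<tau> * (N / \<alpha> k)" using inv \<tau>_nonneg by (rule mult_left_mono)
      finally show ?thesis .
    qed
    \<comment> \<open>The relative Gram error on the leading span. The hypothesis
      \<open>\<alpha> k \<ge> 2 * \<tau>\<close> makes it at most 1/2, so the norms \<open>W\<close>
      after and \<open>N\<close> before sampling are comparable.\<close>
    define q where "q = \<tau> / \<alpha> k"
    have q: "0 \<le> q" "q \<le> 1/2" "\<tau> = q * \<alpha> k"
      using k \<alpha>k \<tau>_nonneg by (auto simp: q_def divide_simps)
    have W_ge: "W \<ge> (1 - q) * N" using WN by (simp add: q_def algebra_simps)
    have "q * N \<le> 1/2 * N" using q N_pos by (intro mult_right_mono) auto
    then have W_half: "N \<le> 2 * W" using W_ge by (simp add: algebra_simps)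
    then have W_pos: "W > 0" using N_pos by simp
    \<comment> \<open>Since \<open>W\<close> is the inner product of \<open>c\<close> and
      \<open>g\<close>, Cauchy-Schwarz bounds the sum of \<open>(g l)^2\<close> below by
      \<open>W^2 / N\<close>, and \<open>W \<ge> (1 - q) * N\<close> turns this into
      \<open>(1 - q) * W\<close>. The loss on the leading part is therefore only
      \<open>q * \<alpha> k = \<tau>\<close>.\<close>
    have "W\<^sup>2 \<le> N * (\<Sum>l\<le>k. (g l)\<^sup>2)"
      unfolding W_g N_def by (rule Cauchy_Schwarz_ineq_sum)
    moreover have "(1 - q) * W * N \<le> W\<^sup>2"
      using mult_right_mono[OF W_ge, of W] W_pos by (simp add: power2_eq_square mult_ac)
    ultimately have "N * ((1 - q) * W) \<le> N * (\<Sum>l\<le>k. (g l)\<^sup>2)" by (simp add: mult_ac)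
    then have "(1 - q) * W \<le> (\<Sum>l\<le>k. (g l)\<^sup>2)" using N_pos by simp
    then have "\<alpha> k * ((1 - q) * W) \<le> \<alpha> k * (\<Sum>l\<le>k. (g l)\<^sup>2)" using \<alpha>k by simp
    also have "\<dots> \<le> (\<Sum>l\<le>k. \<alpha> l * (g l)\<^sup>2)"
      unfolding sum_distrib_left using lead_ge by (intro sum_mono mult_right_mono) auto
    finally have lead_part: "(\<alpha> k - \<tau>) * W \<le> (\<Sum>l\<le>k. \<alpha> l * (g l)\<^sup>2)"
      by (simp add: q(3) algebra_simps)
    \<comment> \<open>Beyond index \<open>k\<close> the coefficients \<open>d\<close> vanish, so
      \<open>g = e\<close> there: this part, whatever its sign, is of second order in the Gram error
      and costs one more \<tau>.\<close>
    have rest: "- (\<tau> * W) \<le> (\<Sum>l\<in>K - {..k}. \<alpha> l * (g l)\<^sup>2)"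
    proof -
      have "(\<Sum>l\<in>K - {..k}. \<bar>\<alpha> l\<bar> * (g l)\<^sup>2) \<le> (\<Sum>l\<in>K - {..k}. \<bar>\<alpha> l\<bar> * (e l)\<^sup>2)"
        by (intro sum_mono) (auto simp: g d_def)
      also have "\<dots> \<le> (\<Sum>l\<in>K. \<bar>\<alpha> l\<bar> * (e l)\<^sup>2)" by (intro sum_mono2) auto
      also have "\<dots> \<le> \<tau>\<^sup>2 * (N / \<alpha> k)"
        using gram_error_apply[of d] mult_left_mono[OF inv, of "\<tau>\<^sup>2"] by (simp add: e_def)
      also have "\<dots> = \<tau> * (q * N)" by (simp add: q_def power2_eq_square)
      also have "\<dots> \<le> \<tau> * W"
        using \<open>q * N \<le> 1/2 * N\<close> W_half \<tau>_nonneg by (intro mult_left_mono) auto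
      finally have "(\<Sum>l\<in>K - {..k}. \<bar>\<alpha> l\<bar> * (g l)\<^sup>2) \<le> \<tau> * W" .
      moreover have "- (\<Sum>l\<in>K - {..k}. \<bar>\<alpha> l\<bar> * (g l)\<^sup>2) \<le> (\<Sum>l\<in>K - {..k}. \<alpha> l * (g l)\<^sup>2)"
        unfolding sum_negf [symmetric] mult_minus_left [symmetric]
        by (intro sum_mono mult_right_mono) auto
      ultimately show ?thesis by simp
    qed
    have "(\<Sum>l\<in>K. \<alpha> l * (g l)\<^sup>2) = (\<Sum>l\<in>K - {..k}. \<alpha> l * (g l)\<^sup>2) + (\<Sum>l\<le>k. \<alpha> l * (g l)\<^sup>2)"
      using lead by (intro sum.subset_diff) auto
    then have "(\<alpha> k - 2 * \<tau>) * W \<le> (\<Sum>l\<in>K. \<alpha> l * (g l)\<^sup>2)"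
      using lead_part rest by (simp add: algebra_simps)
    moreover have "(\<Sum>i\<in>S. \<Sum>j\<in>S. C i j * x i * x j) \<ge> (\<Sum>l\<in>K. \<alpha> l * (g l)\<^sup>2) - \<eta> * W"
      using abs_le_D2[OF tail_small[of "\<lambda>i. x i / sqrt (p i)"]]
      unfolding form form_split rescaled_norm W_def g_def by linarith
    ultimately show ?thesis
      using W_pos by (simp add: W_def x_def algebra_simps)
  qed
  then show "k < card S" "\<mu> k \<ge> \<alpha> k - 2 * \<tau> - \<eta>"
    using C.eigenvalue_lower_bound[of k ?y "\<alpha> k - 2 * \<tau> - \<eta>"] by blast+
qed

text \<open>A vector \<open>x\<close> in the span of the leading \<open>w l\<close> is chosen with
  \<open>g a = 0\<close> for all \<open>a < k\<close>, so only eigenvalues of \<open>B\<close> from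
  index \<open>k\<close> on contribute. Their positive contribution \<open>F\<close> is bounded by
  duality. The hypothesis \<open>\<mu> k > \<eta>\<close> gives \<open>F > 0\<close>, which allows a
  division by \<open>F\<close> at the end.\<close>

lemma sampled_eigenvalue_le:
  assumes C: "eigensystem S C \<mu> w" "\<And>i j. i \<in> S \<Longrightarrow> j \<in> S \<Longrightarrow> C i j = B i j / sqrt (p i * p j)"
    and k: "k < card S" "\<mu> k > \<eta>"
  shows "\<mu> k \<le> \<alpha> k + \<tau> + \<eta>"
proof -
  interpret C: eigensystem S C \<mu> w by fact
  have form: "(\<Sum>i\<in>S. \<Sum>j\<in>S. C i j * x i * x j) =
      (\<Sum>i\<in>S. \<Sum>j\<in>S. B i j * (x i / sqrt (p i)) * (x j / sqrt (p j)))" for x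
    using C(2) by (rule rescaled_form)
  have "card S \<le> n" using card_mono[OF _ S_subset] by simp
  with k have kn: "k < n" by simp
  have "\<exists>c. (\<exists>l\<in>{..k}. c l \<noteq> 0) \<and>
      (\<forall>a\<in>{..<k}. (\<Sum>l\<le>k. c l * (\<Sum>i\<in>S. u a i * (w l i / sqrt (p i)))) = 0)"
    by (rule homogeneous_system_nontrivial_solution) auto
  then obtain c where c: "\<exists>l\<le>k. c l \<noteq> 0"
    "\<And>a. a < k \<Longrightarrow> (\<Sum>l\<le>k. c l * (\<Sum>i\<in>S. u a i * (w l i / sqrt (p i)))) = 0"
    by (meson atMost_iff lessThan_iff)
  define x where "x = (\<lambda>i. \<Sum>l\<le>k. c l * w l i)"
  define g where "g = (\<lambda>l. \<Sum>i\<in>S. u l i * (x i / sqrt (p i)))"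
  define W where "W = (\<Sum>i\<in>S. (x i)\<^sup>2)"
  have g0: "g a = 0" if "a < k" for a
  proof -
    have "g a = (\<Sum>l\<le>k. c l * (\<Sum>i\<in>S. u a i * (w l i / sqrt (p i))))"
      unfolding g_def x_def sum_distrib_left sum_divide_distrib
      by (subst sum.swap) (simp add: mult_ac)
    then show ?thesis using c(2)[OF that] by simp
  qed
  have W_pos: "W > 0"
    using c(1) unfolding W_def x_def C.quadratic_form_leading_span(1)[OF k(1)]
    by (auto intro: sum_pos2)
  \<comment> \<open>The dominant indices that can raise the form: below \<open>k\<close> the
    coefficient \<open>g\<close> vanishes, and nonpositive eigenvalues only lower it.\<close>
  define P where "P = {l \<in> K. l \<ge> k \<and> \<alpha> l > 0}"
  have P: "finite P" "P \<subseteq> K" by (auto simp: P_def)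
  define F where "F = (\<Sum>l\<in>P. \<alpha> l * (g l)\<^sup>2)"
  have F_nonneg: "F \<ge> 0" unfolding F_def by (intro sum_nonneg) (auto simp: P_def)
  have "(\<Sum>l\<in>K. \<alpha> l * (g l)\<^sup>2) \<le> (\<Sum>l\<in>K. if l \<in> P then \<alpha> l * (g l)\<^sup>2 else 0)"
    by (intro sum_mono) (auto simp: P_def g0 not_le not_less mult_nonpos_nonneg)
  also have "\<dots> = F" using P by (simp add: F_def sum.If_cases Int_absorb1)
  finally have "(\<Sum>i\<in>S. \<Sum>j\<in>S. C i j * x i * x j) \<le> F + \<eta> * W"
    using abs_le_D1[OF tail_small[of "\<lambda>i. x i / sqrt (p i)"]]
    unfolding form form_split rescaled_norm W_def g_def by linarith
  moreover have "\<mu> k * W \<le> (\<Sum>i\<in>S. \<Sum>j\<in>S. C i j * x i * x j)"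
    unfolding W_def x_def by (rule C.quadratic_form_leading_span(2)[OF k(1)])
  ultimately have \<mu>_le: "(\<mu> k - \<eta>) * W \<le> F" by (simp add: algebra_simps)
  then have F_pos: "F > 0" using k(2) W_pos by (smt (verit) mult_pos_pos)
  then obtain l where l: "l \<in> P" unfolding F_def by (metis less_irrefl sum.empty ex_in_conv)
  \<comment> \<open>\<open>F\<close> is the inner product of \<open>x\<close> with the sampled and
    rescaled combination of the \<open>u l\<close> with coefficients
    \<open>h l = \<alpha> l * g l\<close>. The squared norm of that combination is at most
    \<open>(\<alpha> k + \<tau>) * F\<close>: one \<alpha> in \<open>(h l)^2\<close> is bounded by
    \<open>\<alpha> k\<close>, and in the Gram error term it cancels against the weight
    \<open>1 / \<bar>\<alpha> l\<bar>\<close>.\<close>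
  define h where "h = (\<lambda>l. if l \<in> P then \<alpha> l * g l else 0)"
  have sum_h: "(\<Sum>l\<in>K. h l * f l) = (\<Sum>l\<in>P. \<alpha> l * g l * f l)" for f
    using P by (intro sum.mono_neutral_cong_right) (auto simp: h_def)
  have "F = (\<Sum>i\<in>S. x i * ((\<Sum>l\<in>K. h l * u l i) / sqrt (p i)))"
  proof -
    have g_apply: "g l = (\<Sum>i\<in>S. u l i * (x i / sqrt (p i)))" for l
      by (simp only: g_def)
    have "F = (\<Sum>l\<in>P. \<alpha> l * g l * (\<Sum>i\<in>S. u l i * (x i / sqrt (p i))))"
      unfolding g_apply [symmetric] by (simp add: F_def power2_eq_square mult.assoc)
    also have "\<dots> = (\<Sum>l\<in>P. \<Sum>i\<in>S. \<alpha> l * g l * (u l i * (x i / sqrt (p i))))"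
      by (simp only: sum_distrib_left)
    also have "\<dots> = (\<Sum>i\<in>S. \<Sum>l\<in>P. \<alpha> l * g l * (u l i * (x i / sqrt (p i))))" by (rule sum.swap)
    finally show ?thesis
      by (simp add: sum_h sum_distrib_left sum_divide_distrib mult_ac)
  qed
  then have "F\<^sup>2 \<le> W * (\<Sum>i\<in>S. ((\<Sum>l\<in>K. h l * u l i) / sqrt (p i))\<^sup>2)"
    unfolding W_def by (simp only: Cauchy_Schwarz_ineq_sum)
  also have "(\<Sum>i\<in>S. ((\<Sum>l\<in>K. h l * u l i) / sqrt (p i))\<^sup>2) = (\<Sum>i\<in>S. (\<Sum>l\<in>K. h l * u l i)\<^sup>2 / p i)"
  proof (rule sum.cong)
    fix i assume "i \<in> S"
    then show "((\<Sum>l\<in>K. h l * u l i) / sqrt (p i))\<^sup>2 = (\<Sum>l\<in>K. h l * u l i)\<^sup>2 / p i"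
      using p_pos[of i] by (simp add: power_divide)
  qed simp
  also have "\<dots> = (\<Sum>l\<in>K. h l * h l) + (\<Sum>l\<in>K. h l * (\<Sum>m\<in>K. \<Delta> l m * h m))"
    by (simp add: weighted_norm distrib_left sum.distrib)
  also have "\<dots> \<le> \<alpha> k * F + \<tau> * F"
  proof (rule add_mono)
    have "(\<Sum>l\<in>K. h l * h l) = (\<Sum>l\<in>P. \<alpha> l * (\<alpha> l * (g l)\<^sup>2))"
      unfolding sum_h by (intro sum.cong) (auto simp: h_def power2_eq_square)
    also have "\<dots> \<le> (\<Sum>l\<in>P. \<alpha> k * (\<alpha> l * (g l)\<^sup>2))"
      by (intro sum_mono mult_right_mono full.decreasing) (auto simp: P_def dominant_def)
    finally show "(\<Sum>l\<in>K. h l * h l) \<le> \<alpha> k * F" by (simp add: F_def sum_distrib_left)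
    have "(\<Sum>l\<in>K. (h l)\<^sup>2 / \<bar>\<alpha> l\<bar>) = F"
      unfolding F_def using P
      by (intro sum.mono_neutral_cong_right) (auto simp: h_def P_def power2_eq_square)
    then show "(\<Sum>l\<in>K. h l * (\<Sum>m\<in>K. \<Delta> l m * h m)) \<le> \<tau> * F"
      using gram_error_form[of h] by simp
  qed
  finally have "F * F \<le> ((\<alpha> k + \<tau>) * W) * F"
    using W_pos by (simp add: power2_eq_square algebra_simps mult_left_mono)
  then have "F \<le> (\<alpha> k + \<tau>) * W" using F_pos by simp
  with \<mu>_le have "(\<mu> k - \<eta>) * W \<le> (\<alpha> k + \<tau>) * W" by simp
  then show ?thesis using W_pos by simp
qed

lemma sum_dominant_reverse:
  "(\<Sum>k\<in>dominant n (\<lambda>a. - \<alpha> (n - 1 - a)) \<beta>. f (n - 1 - k)) = (\<Sum>k\<in>K. f k)"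
  by (rule sum.reindex_bij_witness[of _ "\<lambda>a. n - 1 - a" "\<lambda>a. n - 1 - a"]) (auto simp: dominant_def)

text \<open>The conditions on \<open>S\<close> are invariant under negation of \<open>B\<close>, so
  both bounds above also hold for eigenvalues counted from the bottom.\<close>

lemma reversed:
  "spectral_sample n (\<lambda>i j. - B i j) (\<lambda>a. - \<alpha> (n - 1 - a)) (\<lambda>a. u (n - 1 - a)) \<beta> S p \<eta> \<tau>"
proof (rule spectral_sample.intro)
  show "eigensystem {..<n} (\<lambda>i j. - B i j) (\<lambda>a. - \<alpha> (n - 1 - a)) (\<lambda>a. u (n - 1 - a))"
    using full.reverse by simp
  have tail: "spectral_tail n (\<lambda>i j. - B i j) (\<lambda>a. - \<alpha> (n - 1 - a)) (\<lambda>a. u (n - 1 - a)) \<beta> i j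
      = - spectral_tail n B \<alpha> u \<beta> i j" for i j
    using sum_dominant_reverse[of "\<lambda>k. - \<alpha> k * u k i * u k j"]
    by (simp add: spectral_tail_def sum_negf)
  show "\<bar>\<Sum>i\<in>S. \<Sum>j\<in>S. spectral_tail n (\<lambda>i j. - B i j) (\<lambda>a. - \<alpha> (n - 1 - a))
      (\<lambda>a. u (n - 1 - a)) \<beta> i j * y i * y j\<bar> \<le> \<eta> * (\<Sum>i\<in>S. p i * (y i)\<^sup>2)" for y
    using tail_small[of y] by (simp only: tail sum_negf mult_minus_left abs_minus_cancel)
  let ?K = "dominant n (\<lambda>a. - \<alpha> (n - 1 - a)) \<beta>"
  have "(\<Sum>k\<in>?K. \<Sum>l\<in>?K. \<bar>- \<alpha> (n - 1 - k)\<bar> * \<bar>- \<alpha> (n - 1 - l)\<bar> *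
        (gram_error S p (\<lambda>a. u (n - 1 - a)) k l)\<^sup>2) =
      (\<Sum>k\<in>?K. \<Sum>l\<in>?K. \<bar>\<alpha> (n - 1 - k)\<bar> * \<bar>\<alpha> (n - 1 - l)\<bar> * (\<Delta> (n - 1 - k) (n - 1 - l))\<^sup>2)"
    by (intro sum.cong refl) (auto simp: gram_error_def dominant_def)
  also have "\<dots> = (\<Sum>k\<in>?K. \<Sum>l\<in>K. \<bar>\<alpha> (n - 1 - k)\<bar> * \<bar>\<alpha> l\<bar> * (\<Delta> (n - 1 - k) l)\<^sup>2)"
    by (intro sum.cong refl sum_dominant_reverse)
  also have "\<dots> = (\<Sum>k\<in>K. \<Sum>l\<in>K. \<bar>\<alpha> k\<bar> * \<bar>\<alpha> l\<bar> * (\<Delta> k l)\<^sup>2)"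
    by (rule sum_dominant_reverse)
  finally show "(\<Sum>k\<in>?K. \<Sum>l\<in>?K. \<bar>- \<alpha> (n - 1 - k)\<bar> * \<bar>- \<alpha> (n - 1 - l)\<bar> *
        (gram_error S p (\<lambda>a. u (n - 1 - a)) k l)\<^sup>2) \<le> \<tau>\<^sup>2"
    using gram_small by simp
qed (use S_subset p_pos \<beta>_pos \<tau>_nonneg in auto)

text \<open>Eigenvalues above \<theta> are matched by their position from the top, those below
  \<open>- \<theta>\<close> by their position from the bottom, each with error at most \<theta>. At
  the other indices the eigenvalue and its estimate both lie between \<open>- \<theta>\<close> and
  \<theta>, whence the factor 2.\<close>

lemma aligned_eigenvalue_close:
  assumes C: "eigensystem S C \<mu> w" "\<And>i j. i \<in> S \<Longrightarrow> j \<in> S \<Longrightarrow> C i j = B i j / sqrt (p i * p j)"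
    and \<theta>: "\<beta> \<le> \<theta>" "2 * \<tau> + \<eta> \<le> \<theta>" "\<eta> \<ge> 0"
    and i: "i < n"
  shows "\<bar>(if i < card S \<and> \<mu> i \<ge> 0 then \<mu> i
      else if n \<le> i + card S \<and> \<mu> (i + card S - n) < 0 then \<mu> (i + card S - n) else 0) - \<alpha> i\<bar> \<le> 2 * \<theta>"
proof -
  interpret C: eigensystem S C \<mu> w by fact
  interpret R: spectral_sample n "\<lambda>i j. - B i j" "\<lambda>a. - \<alpha> (n - 1 - a)" "\<lambda>a. u (n - 1 - a)" \<beta> S p \<eta> \<tau>
    by (rule reversed)
  have CR: "- C i j = - B i j / sqrt (p i * p j)" if "i \<in> S" "j \<in> S" for i j
    using C(2)[OF that] by simp
  let ?m = "card S"
  have m: "?m \<le> n" using card_mono[OF _ S_subset] by simp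
  have \<theta>0: "\<theta> > 0" using \<theta>(1) \<beta>_pos by simp
  have pos_lower: "k < ?m \<and> \<mu> k \<ge> \<alpha> k - \<theta>" if "k < n" "\<alpha> k > \<theta>" for k
    using sampled_eigenvalue_ge[OF C that(1)] that \<theta> by auto
  have pos_upper: "\<mu> k \<le> \<alpha> k + \<theta>" if "k < ?m" "\<mu> k > \<theta>" for k
    using sampled_eigenvalue_le[OF C that(1)] that \<theta> \<tau>_nonneg by auto
  \<comment> \<open>Index \<open>k\<close> of \<open>n\<close> is position \<open>n - 1 - k\<close>
    from the bottom; the same position among the \<open>?m\<close> sampled eigenvalues has index
    \<open>k + ?m - n\<close>.\<close>
  have neg_lower: "n \<le> k + ?m \<and> \<mu> (k + ?m - n) \<le> \<alpha> k + \<theta>" if "k < n" "\<alpha> k < - \<theta>" for k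
  proof -
    have k: "n - 1 - (n - 1 - k) = k" "n - 1 - k < n" using that by auto
    have "n - 1 - k < ?m \<and> - \<mu> (?m - 1 - (n - 1 - k)) \<ge> - \<alpha> k - \<theta>"
      using R.sampled_eigenvalue_ge[OF C.reverse CR k(2)] that \<theta> unfolding k(1) by auto
    moreover from this have "?m - 1 - (n - 1 - k) = k + ?m - n" using that by auto
    ultimately show ?thesis using that by auto
  qed
  have neg_upper: "\<mu> k \<ge> \<alpha> (k + n - ?m) - \<theta>" if "k < ?m" "\<mu> k < - \<theta>" for k
  proof -
    have k: "?m - 1 - (?m - 1 - k) = k" "n - 1 - (?m - 1 - k) = k + n - ?m" "?m - 1 - k < ?m"
      using that m by auto
    show ?thesis
      using R.sampled_eigenvalue_le[OF C.reverse CR k(3)] that \<theta> \<tau>_nonneg unfolding k(1,2) by auto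
  qed
  consider (pos) "i < ?m" "\<mu> i \<ge> 0"
    | (neg) "\<not> (i < ?m \<and> \<mu> i \<ge> 0)" "n \<le> i + ?m" "\<mu> (i + ?m - n) < 0"
    | (zero) "\<not> (i < ?m \<and> \<mu> i \<ge> 0)" "\<not> (n \<le> i + ?m \<and> \<mu> (i + ?m - n) < 0)"
    by blast
  then show ?thesis
  proof cases
    case pos
    \<comment> \<open>Otherwise the sampled eigenvalue matched from the bottom is negative; its
      index is at most \<open>i\<close>, so by monotonicity \<open>\<mu> i\<close> would be negative
      too.\<close>
    have "\<alpha> i \<ge> - \<theta>"
    proof (rule ccontr)
      assume "\<not> \<alpha> i \<ge> - \<theta>"
      then have "n \<le> i + ?m" "\<mu> (i + ?m - n) < 0" using neg_lower[OF i] by auto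
      moreover have "i + ?m - n \<le> i" using m by linarith
      ultimately show False using C.decreasing[of "i + ?m - n" i] pos by auto
    qed
    then show ?thesis
      using pos pos_lower[OF i] pos_upper[of i] \<theta>0 by (cases "\<mu> i > \<theta>"; cases "\<alpha> i > \<theta>") auto
  next
    case neg
    then have j: "i + ?m - n < ?m" "i + ?m - n + n - ?m = i" using i by auto
    have "\<alpha> i \<le> \<theta>" using neg(1) pos_lower[OF i] by (cases "\<alpha> i > \<theta>") auto
    then show ?thesis
      using neg neg_lower[OF i] neg_upper[OF j(1)] \<theta>0 j(2)
      by (cases "\<mu> (i + ?m - n) < - \<theta>"; cases "\<alpha> i < - \<theta>") auto
  next
    case zero
    have "\<alpha> i \<le> \<theta>" using zero(1) pos_lower[OF i] by (cases "\<alpha> i > \<theta>") auto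
    moreover have "\<alpha> i \<ge> - \<theta>" using zero(2) neg_lower[OF i] by (cases "\<alpha> i < - \<theta>") auto
    ultimately show ?thesis using zero \<theta>0 by auto
  qed
qed

end

section \<open>The error caused by thresholding\<close>

text \<open>By the weighted inequality \<open>2 * \<bar>x i * x j\<bar> \<le> r j / r i * (x i)^2 +
  r i / r j * (x j)^2\<close>; symmetry of \<open>E\<close> makes the two halves equal, leaving one
  weighted row sum per \<open>i\<close>.\<close>

lemma schur_test:
  fixes E :: "'a \<Rightarrow> 'a \<Rightarrow> real" and r :: "'a \<Rightarrow> real"
  assumes sym: "\<And>i j. i \<in> S \<Longrightarrow> j \<in> S \<Longrightarrow> E i j = E j i"
    and supp: "\<And>i j. i \<in> S \<Longrightarrow> j \<in> S \<Longrightarrow> E i j \<noteq> 0 \<Longrightarrow> r i > 0"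
    and row: "\<And>i. i \<in> S \<Longrightarrow> (\<Sum>j\<in>S. \<bar>E i j\<bar> * r j / r i) \<le> t"
  shows "\<bar>\<Sum>i\<in>S. \<Sum>j\<in>S. E i j * x i * x j\<bar> \<le> t * (\<Sum>i\<in>S. (x i)\<^sup>2)"
proof -
  have "\<bar>\<Sum>i\<in>S. \<Sum>j\<in>S. E i j * x i * x j\<bar> \<le> (\<Sum>i\<in>S. \<Sum>j\<in>S. \<bar>E i j * x i * x j\<bar>)"
    by (intro order_trans[OF sum_abs] sum_mono sum_abs)
  also have "\<dots> \<le> (\<Sum>i\<in>S. \<Sum>j\<in>S. (\<bar>E i j\<bar> * r j / r i * (x i)\<^sup>2 + \<bar>E j i\<bar> * r i / r j * (x j)\<^sup>2) / 2)"
  proof (intro sum_mono)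
    fix i j assume ij: "i \<in> S" "j \<in> S"
    show "\<bar>E i j * x i * x j\<bar> \<le> (\<bar>E i j\<bar> * r j / r i * (x i)\<^sup>2 + \<bar>E j i\<bar> * r i / r j * (x j)\<^sup>2) / 2"
    proof (cases "E i j = 0")
      case False
      then have r: "r i > 0" "r j > 0" using supp[OF ij] supp[of j i] sym[OF ij] ij by auto
      have "0 \<le> (r j * \<bar>x i\<bar> - r i * \<bar>x j\<bar>)\<^sup>2" by simp
      then have "2 * (\<bar>x i\<bar> * \<bar>x j\<bar>) * (r i * r j) \<le> (r j)\<^sup>2 * (x i)\<^sup>2 + (r i)\<^sup>2 * (x j)\<^sup>2"
        by (simp add: power2_diff power_mult_distrib mult_ac)
      then have "2 * (\<bar>x i\<bar> * \<bar>x j\<bar>) \<le> r j / r i * (x i)\<^sup>2 + r i / r j * (x j)\<^sup>2"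
        using r by (simp add: field_simps power2_eq_square)
      from mult_left_mono[OF this, of "\<bar>E i j\<bar>"] show ?thesis
        using sym[OF ij] by (simp add: abs_mult algebra_simps)
    qed (use sym[OF ij] in simp)
  qed
  also have "\<dots> = (\<Sum>i\<in>S. (x i)\<^sup>2 * (\<Sum>j\<in>S. \<bar>E i j\<bar> * r j / r i))"
  proof -
    let ?f = "\<lambda>i j. \<bar>E i j\<bar> * r j / r i * (x i)\<^sup>2"
    have "(\<Sum>i\<in>S. \<Sum>j\<in>S. (?f i j + ?f j i) / 2) = ((\<Sum>i\<in>S. \<Sum>j\<in>S. ?f i j) + (\<Sum>i\<in>S. \<Sum>j\<in>S. ?f j i)) / 2"
      by (simp only: sum_divide_distrib [symmetric] sum.distrib)
    also have "(\<Sum>i\<in>S. \<Sum>j\<in>S. ?f j i) = (\<Sum>i\<in>S. \<Sum>j\<in>S. ?f i j)" by (rule sum.swap)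
    also have "((\<Sum>i\<in>S. \<Sum>j\<in>S. ?f i j) + (\<Sum>i\<in>S. \<Sum>j\<in>S. ?f i j)) / 2 =
        (\<Sum>i\<in>S. (x i)\<^sup>2 * (\<Sum>j\<in>S. \<bar>E i j\<bar> * r j / r i))"
      by (simp add: sum_distrib_left mult_ac)
    finally show ?thesis .
  qed
  also have "\<dots> \<le> (\<Sum>i\<in>S. (x i)\<^sup>2 * t)"
    by (intro sum_mono mult_left_mono row) auto
  finally show ?thesis by (simp add: sum_distrib_left mult_ac)
qed

text \<open>The entry rule without the sampling factor. It separates the deterministic thresholding
  from the sampling: the matrix of the procedure is a rescaled principal submatrix of this fixed
  matrix.\<close>

definition thresholded_entry :: "real \<Rightarrow> real \<Rightarrow> real mat \<Rightarrow> nat \<Rightarrow> nat \<Rightarrow> real" where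
  "thresholded_entry c2 \<epsilon> A i j =
     (if i = j \<and> (row_norm A i)\<^sup>2 < \<epsilon>\<^sup>2 / 4 * (frobenius_norm A)\<^sup>2 then 0
      else if i \<noteq> j \<and> (row_norm A i)\<^sup>2 * (row_norm A j)\<^sup>2
                < \<epsilon>\<^sup>2 * (frobenius_norm A)\<^sup>2 * \<bar>A $$ (i, j)\<bar>\<^sup>2
                    / (c2 * log1 (real (dim_row A)) ^ 4) then 0
      else A $$ (i, j))"

lemma rescaled_entry_eq:
  "rescaled_entry c2 \<epsilon> s A i j =
    thresholded_entry c2 \<epsilon> A i j / sqrt (sample_prob A s i * sample_prob A s j)"
  unfolding rescaled_entry_def thresholded_entry_def by (cases "i = j") simp_all

lemma log1_ge_1: "log1 x \<ge> 1"
  by (simp add: log1_def)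

lemma row_norm_nonneg: "row_norm A i \<ge> 0"
  by (simp add: row_norm_def L2_set_nonneg)

lemma frobenius_norm_nonneg: "frobenius_norm A \<ge> 0"
  by (simp add: frobenius_norm_def L2_set_nonneg)

lemma row_norm_power2: "A \<in> carrier_mat n m \<Longrightarrow> (row_norm A i)\<^sup>2 = (\<Sum>j<m. (A $$ (i, j))\<^sup>2)"
  by (simp add: row_norm_def L2_set_def sum_nonneg)

lemma frobenius_norm_power2:
  "A \<in> carrier_mat n m \<Longrightarrow> (frobenius_norm A)\<^sup>2 = (\<Sum>i<n. (row_norm A i)\<^sup>2)"
  by (auto simp: row_norm_power2 frobenius_norm_def L2_set_def sum_nonneg sum.cartesian_product
      case_prod_unfold intro!: sum.cong)

lemma entry_le_row_norm:
  assumes "A \<in> carrier_mat n m" "j < m"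
  shows "\<bar>A $$ (i, j)\<bar> \<le> row_norm A i"
proof (rule power2_le_imp_le)
  show "\<bar>A $$ (i, j)\<bar>\<^sup>2 \<le> (row_norm A i)\<^sup>2"
    using assms by (simp add: row_norm_power2 member_le_sum[of j "{..<m}" "\<lambda>j. (A $$ (i, j))\<^sup>2"])
qed (rule row_norm_nonneg)

text \<open>The constant is 1/4 + 1/2: the off-diagonal rule contributes \<open>1 / sqrt 16\<close>,
  by \<open>c2 \<ge> 16\<close>, and a removed diagonal entry is at most its row norm, which is
  below \<epsilon> F / 2.\<close>

lemma thresholding_error:
  assumes A: "A \<in> carrier_mat n n" "A\<^sup>T = A" and \<epsilon>: "\<epsilon> > 0" and c2: "c2 \<ge> 16"
  shows "\<bar>\<Sum>i<n. \<Sum>j<n. (A $$ (i, j) - thresholded_entry c2 \<epsilon> A i j) * x i * x j\<bar>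
    \<le> 3 / 4 * (\<epsilon> * frobenius_norm A) * (\<Sum>i<n. (x i)\<^sup>2)"
proof -
  let ?F = "frobenius_norm A" and ?r = "row_norm A"
  have sym: "A $$ (i, j) = A $$ (j, i)" if "i < n" "j < n" for i j
    using that A by (metis carrier_matD index_transpose_mat(1))
  define T where "T = (\<lambda>i j. A $$ (i, j) - thresholded_entry c2 \<epsilon> A i j)"
  have T_apply: "T i j = A $$ (i, j) - thresholded_entry c2 \<epsilon> A i j" for i j
    by (simp only: T_def)
  define E where "E = (\<lambda>i j. if i = j then 0 else T i j)"
  have E_cases: "E i j = 0 \<or> i \<noteq> j \<and> E i j = A $$ (i, j) \<and> ?r i * ?r j < \<epsilon> * ?F / 4 * \<bar>A $$ (i, j)\<bar>" for i j
  proof (cases "i \<noteq> j \<and> (?r i)\<^sup>2 * (?r j)\<^sup>2 < \<epsilon>\<^sup>2 * ?F\<^sup>2 * \<bar>A $$ (i, j)\<bar>\<^sup>2 / (c2 * log1 (real (dim_row A)) ^ 4)")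
    case True
    have "16 * 1 \<le> c2 * log1 (real (dim_row A)) ^ 4"
      using c2 by (intro mult_mono one_le_power log1_ge_1) auto
    then have "\<epsilon>\<^sup>2 * ?F\<^sup>2 * \<bar>A $$ (i, j)\<bar>\<^sup>2 / (c2 * log1 (real (dim_row A)) ^ 4) \<le> \<epsilon>\<^sup>2 * ?F\<^sup>2 * \<bar>A $$ (i, j)\<bar>\<^sup>2 / 16"
      by (intro divide_left_mono) auto
    from less_le_trans[OF conjunct2[OF True] this] have "(?r i * ?r j)\<^sup>2 < (\<epsilon> * ?F / 4 * \<bar>A $$ (i, j)\<bar>)\<^sup>2"
      by (simp add: power_mult_distrib power_divide)
    then have "?r i * ?r j < \<epsilon> * ?F / 4 * \<bar>A $$ (i, j)\<bar>"
      by (rule power2_less_imp_less) (use \<epsilon> frobenius_norm_nonneg in auto)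
    then show ?thesis using True by (simp add: E_def T_def thresholded_entry_def)
  qed (auto simp: E_def T_def thresholded_entry_def)
  \<comment> \<open>A removed entry satisfies \<open>?r j < \<epsilon> * ?F / 4 * \<bar>A $$ (i, j)\<bar> / ?r i\<close>, so with the row norms as
    weights each row of the Schur test is bounded by the full row sum of squares.\<close>
  have "\<bar>\<Sum>i<n. \<Sum>j<n. E i j * x i * x j\<bar> \<le> \<epsilon> * ?F / 4 * (\<Sum>i<n. (x i)\<^sup>2)"
  proof (rule schur_test[where r = ?r])
    fix i j assume ij: "i \<in> {..<n}" "j \<in> {..<n}"
    then show "E i j = E j i"
      using sym[of i j] by (auto simp: E_def T_def thresholded_entry_def mult_ac)
    assume "E i j \<noteq> 0"
    then show "?r i > 0"
      using E_cases[of i j] entry_le_row_norm[OF A(1), of j i] ij by auto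
  next
    fix i assume i: "i \<in> {..<n}"
    show "(\<Sum>j<n. \<bar>E i j\<bar> * ?r j / ?r i) \<le> \<epsilon> * ?F / 4"
    proof (cases "?r i = 0")
      case True
      then show ?thesis using \<epsilon> frobenius_norm_nonneg by simp
    next
      case False
      then have r: "?r i > 0" using row_norm_nonneg[of A i] by simp
      have "\<bar>E i j\<bar> * ?r j / ?r i \<le> \<epsilon> * ?F / 4 * (A $$ (i, j))\<^sup>2 / (?r i)\<^sup>2" for j
      proof -
        have "\<bar>E i j\<bar> * (?r i * ?r j) \<le> \<epsilon> * ?F / 4 * (A $$ (i, j))\<^sup>2"
          using E_cases[of i j] mult_left_mono[of "?r i * ?r j" "\<epsilon> * ?F / 4 * \<bar>A $$ (i, j)\<bar>" "\<bar>E i j\<bar>"]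
            \<epsilon> frobenius_norm_nonneg[of A]
          by (auto simp: power2_eq_square mult_ac abs_mult_self_eq)
        then have "\<bar>E i j\<bar> * (?r i * ?r j) / (?r i)\<^sup>2 \<le> \<epsilon> * ?F / 4 * (A $$ (i, j))\<^sup>2 / (?r i)\<^sup>2"
          by (rule divide_right_mono) simp
        then show ?thesis using r by (simp add: power2_eq_square)
      qed
      then have "(\<Sum>j<n. \<bar>E i j\<bar> * ?r j / ?r i) \<le> (\<Sum>j<n. \<epsilon> * ?F / 4 * (A $$ (i, j))\<^sup>2 / (?r i)\<^sup>2)"
        by (intro sum_mono)
      also have "\<dots> = \<epsilon> * ?F / 4 * (\<Sum>j<n. (A $$ (i, j))\<^sup>2) / (?r i)\<^sup>2"
        by (simp only: sum_distrib_left sum_divide_distrib)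
      also have "\<dots> = \<epsilon> * ?F / 4" using r by (simp add: row_norm_power2[OF A(1), symmetric])
      finally show ?thesis .
    qed
  qed
  moreover have "\<bar>\<Sum>i<n. T i i * (x i)\<^sup>2\<bar> \<le> \<epsilon> * ?F / 2 * (\<Sum>i<n. (x i)\<^sup>2)"
  proof -
    have T: "\<bar>T i i\<bar> \<le> \<epsilon> * ?F / 2" if "i < n" for i
    proof (cases "(?r i)\<^sup>2 < \<epsilon>\<^sup>2 / 4 * ?F\<^sup>2")
      case True
      then have "(?r i)\<^sup>2 < (\<epsilon> * ?F / 2)\<^sup>2" by (simp add: power_mult_distrib power_divide)
      then have "?r i < \<epsilon> * ?F / 2"
        by (rule power2_less_imp_less) (use \<epsilon> frobenius_norm_nonneg in auto)
      then show ?thesis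
        using True entry_le_row_norm[OF A(1) that, of i] by (simp add: T_def thresholded_entry_def)
    qed (use \<epsilon> frobenius_norm_nonneg in \<open>auto simp: T_def thresholded_entry_def\<close>)
    have "(\<Sum>i<n. \<bar>T i i * (x i)\<^sup>2\<bar>) \<le> (\<Sum>i<n. \<epsilon> * ?F / 2 * (x i)\<^sup>2)"
    proof (rule sum_mono)
      fix i assume "i \<in> {..<n}"
      then show "\<bar>T i i * (x i)\<^sup>2\<bar> \<le> \<epsilon> * ?F / 2 * (x i)\<^sup>2"
        using mult_right_mono[OF T[of i], of "(x i)\<^sup>2"] by (simp add: abs_mult)
    qed
    with sum_abs[of "\<lambda>i. T i i * (x i)\<^sup>2" "{..<n}"] show ?thesis
      by (simp only: sum_distrib_left)
  qed
  moreover have "(\<Sum>i<n. \<Sum>j<n. T i j * x i * x j) =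
      (\<Sum>i<n. \<Sum>j<n. E i j * x i * x j) + (\<Sum>i<n. T i i * (x i)\<^sup>2)"
  proof -
    have "(\<Sum>i<n. T i i * (x i)\<^sup>2) = (\<Sum>i<n. \<Sum>j<n. if j = i then T i j * x i * x j else 0)"
      by (simp add: power2_eq_square mult.assoc)
    then show ?thesis
      by (simp only: sum.distrib [symmetric] E_def) (intro sum.cong refl, auto)
  qed
  moreover have "\<bar>a + b\<bar> \<le> 3 / 4 * (\<epsilon> * ?F) * W" if "\<bar>a\<bar> \<le> \<epsilon> * ?F / 4 * W" "\<bar>b\<bar> \<le> \<epsilon> * ?F / 2 * W"
    for a b W
    using abs_triangle_ineq[of a b] that by simp
  ultimately show ?thesis
    unfolding T_apply [symmetric] by simp
qed

section \<open>Moments of the sampling weights\<close>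

text \<open>The inverse-probability (Horvitz-Thompson) weight, of mean 1.\<close>

definition sample_weight :: "(nat \<Rightarrow> real) \<Rightarrow> nat set \<Rightarrow> nat \<Rightarrow> real" where
  "sample_weight p S i = of_bool (i \<in> S) / p i"

lemma set_pmf_random_index_set: "set_pmf (random_index_set n p) \<subseteq> Pow {..<n}"
  by (auto simp: random_index_set_def)

lemma integrable_random_index_set:
  fixes f :: "nat set \<Rightarrow> real"
  shows "integrable (random_index_set n p) f"
  by (rule integrable_measure_pmf_finite) (rule finite_subset[OF set_pmf_random_index_set], simp)

locale index_sampling =
  fixes n :: nat and p :: "nat \<Rightarrow> real"
  assumes p_pos: "\<And>i. i < n \<Longrightarrow> p i > 0" and p_le_1: "\<And>i. i < n \<Longrightarrow> p i \<le> 1"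
begin

abbreviation "E \<equiv> measure_pmf.expectation (random_index_set n p)"
abbreviation "d \<equiv> sample_weight p"

lemma integrable [simp]: "integrable (random_index_set n p) (f :: nat set \<Rightarrow> real)"
  by (rule integrable_random_index_set)

text \<open>Independence factorizes the product over distinct indices, and each weight has mean 1.
  All mixed moments below reduce to this case by merging repeated indices with
  \<open>weight_mult_self\<close>.\<close>

lemma expectation_prod_weights:
  assumes "T \<subseteq> {..<n}"
  shows "E (\<lambda>S. \<Prod>i\<in>T. d S i) = 1"
proof -
  let ?f = "\<lambda>i (b :: bool). if i \<in> T then of_bool b / p i else (1 :: real)"
  have "E (\<lambda>S. \<Prod>i\<in>T. d S i) =
      measure_pmf.expectation (Pi_pmf {..<n} False (\<lambda>i. bernoulli_pmf (p i))) (\<lambda>b. \<Prod>i<n. ?f i (b i))"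
    unfolding random_index_set_def integral_map_pmf
  proof (rule arg_cong[where f = "measure_pmf.expectation _"], rule ext)
    fix b :: "nat \<Rightarrow> bool"
    have "(\<Prod>i<n. ?f i (b i)) = (\<Prod>i\<in>T. of_bool (b i) / p i)"
      using assms by (intro prod.mono_neutral_cong_right) auto
    also have "\<dots> = (\<Prod>i\<in>T. d {i \<in> {..<n}. b i} i)"
      using assms by (intro prod.cong) (auto simp: sample_weight_def)
    finally show "(\<Prod>i\<in>T. d {i \<in> {..<n}. b i} i) = (\<Prod>i<n. ?f i (b i))" by simp
  qed
  also have "\<dots> = (\<Prod>i<n. measure_pmf.expectation (bernoulli_pmf (p i)) (?f i))"
    using p_pos by (intro expectation_prod_Pi_pmf integrable_measure_pmf_finite)
      (auto simp: less_imp_le finite_subset[OF subset_UNIV])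
  also have "\<dots> = 1"
    using p_pos p_le_1 by (intro prod.neutral) (auto simp: less_imp_le less_imp_neq[symmetric])
  finally show ?thesis .
qed

lemma weight_mult_self: "d S i * d S i = d S i / p i"
  by (simp add: sample_weight_def)

lemma expectation_weight: "i < n \<Longrightarrow> E (\<lambda>S. d S i) = 1"
  using expectation_prod_weights[of "{i}"] by simp

lemma expectation_two_weights:
  "i < n \<Longrightarrow> j < n \<Longrightarrow> E (\<lambda>S. d S i * d S j) = (if i = j then 1 / p i else 1)"
  using expectation_prod_weights[of "{i, j}"]
  by (cases "i = j") (auto simp: weight_mult_self expectation_weight)

text \<open>The inequalities leave only the coincidences \<open>i = k\<close> and
  \<open>j = l\<close>; each merges two weights into one and leaves a factor
  \<open>1 / p\<close>.\<close>

lemma expectation_four_weights: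
  assumes "i < n" "j < n" "k < n" "l < n" and ne: "i \<noteq> j" "i \<noteq> l" "k \<noteq> j" "k \<noteq> l"
  shows "E (\<lambda>S. d S i * d S k * d S j * d S l) =
    (if i = k then 1 / p i else 1) * (if j = l then 1 / p j else 1)"
proof -
  have pair: "d S i * d S k = (if i = k then 1 / p i else 1) * (\<Prod>x\<in>{i, k}. d S x)" for S i k
    by (simp add: weight_mult_self)
  have "d S i * d S k * d S j * d S l =
      (if i = k then 1 / p i else 1) * (if j = l then 1 / p j else 1) * (\<Prod>x\<in>{i, k} \<union> {j, l}. d S x)" for S
  proof -
    have "(\<Prod>x\<in>{i, k} \<union> {j, l}. d S x) = (\<Prod>x\<in>{i, k}. d S x) * (\<Prod>x\<in>{j, l}. d S x)"
      using ne by (intro prod.union_disjoint) auto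
    then show ?thesis using pair[of S i k] pair[of S j l] by (simp only: mult.assoc mult.left_commute)
  qed
  then show ?thesis
    using expectation_prod_weights[of "{i, k} \<union> {j, l}"] assms(1-4)
    by (simp only:) simp
qed

text \<open>The centred weights are uncorrelated, with variance \<open>1 / p i - 1\<close>.\<close>

lemma second_moment:
  "E (\<lambda>S. (\<Sum>i<n. (d S i - 1) * a i)\<^sup>2) = (\<Sum>i<n. (1 / p i - 1) * (a i)\<^sup>2)"
proof -
  have "E (\<lambda>S. (\<Sum>i<n. (d S i - 1) * a i)\<^sup>2) =
      (\<Sum>i<n. \<Sum>j<n. E (\<lambda>S. (d S i - 1) * (d S j - 1) * (a i * a j)))"
    by (simp add: power2_eq_square sum_product mult_ac)
  also have "\<dots> = (\<Sum>i<n. \<Sum>j<n. if i = j then (1 / p i - 1) * (a i)\<^sup>2 else 0)"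
  proof (intro sum.cong refl)
    fix i j assume ij: "i \<in> {..<n}" "j \<in> {..<n}"
    have "E (\<lambda>S. (d S i - 1) * (d S j - 1)) = E (\<lambda>S. d S i * d S j - d S i - d S j + 1)"
      by (simp add: algebra_simps)
    also have "\<dots> = (if i = j then 1 / p i - 1 else 0)"
      using ij by (simp add: expectation_two_weights expectation_weight)
    finally show "E (\<lambda>S. (d S i - 1) * (d S j - 1) * (a i * a j)) =
        (if i = j then (1 / p i - 1) * (a i)\<^sup>2 else 0)"
      by (simp add: power2_eq_square)
  qed
  finally show ?thesis by simp
qed

text \<open>
  Up to the rescaling of rows and columns by \<open>sqrt (p i)\<close>, the sum is the trace of the fourth
  power of the sampled matrix. The diagonal of \<open>G\<close> has to vanish so that the only coincidences
  among the indices \<open>i, j, k, l\<close> are \<open>i = k\<close> and \<open>j = l\<close>.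
\<close>

lemma fourth_moment:
  assumes G0: "\<And>i. i < n \<Longrightarrow> G i i = 0" and G_sym: "\<And>i j. i < n \<Longrightarrow> j < n \<Longrightarrow> G i j = G j i"
  shows "E (\<lambda>S. \<Sum>i<n. \<Sum>k<n. d S i * d S k * (\<Sum>j<n. d S j * (G i j * G j k))\<^sup>2) =
    (\<Sum>i<n. \<Sum>k<n. (\<Sum>j<n. G i j * G j k)\<^sup>2) + 2 * (\<Sum>i<n. (1 / p i - 1) * (\<Sum>j<n. (G i j)\<^sup>2)\<^sup>2)
    + (\<Sum>i<n. \<Sum>j<n. (1 / p i - 1) * (1 / p j - 1) * (G i j) ^ 4)"
proof -
  let ?v = "\<lambda>i. 1 / p i - 1" and ?w = "\<lambda>i k. if i = k then 1 / p i else 1"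
  \<comment> \<open>The factor \<open>?w\<close> is the constant 1 plus the excess \<open>?v\<close>
    on the diagonal. Used once for the pair \<open>i, k\<close> and once for \<open>j, l\<close>, it
    produces the four terms: no coincidence, either one, both.\<close>
  have w_sum: "(\<Sum>i<n. \<Sum>k<n. ?w i k * f i k) = (\<Sum>i<n. \<Sum>k<n. f i k) + (\<Sum>i<n. ?v i * f i i)"
    for f :: "nat \<Rightarrow> nat \<Rightarrow> real"
  proof -
    have "(\<Sum>i<n. ?v i * f i i) = (\<Sum>i<n. \<Sum>k<n. if k = i then ?v i * f i k else 0)" by simp
    then show ?thesis
      by (simp only: sum.distrib [symmetric]) (intro sum.cong refl, auto simp: algebra_simps)
  qed
  define T where "T = (\<lambda>i k j l. G i j * G j k * (G i l * G l k))"
  have E_T: "E (\<lambda>S. d S i * d S k * d S j * d S l * T i k j l) = ?w i k * (?w j l * T i k j l)"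
    if "i < n" "k < n" "j < n" "l < n" for i k j l
  proof (cases "i \<noteq> j \<and> i \<noteq> l \<and> k \<noteq> j \<and> k \<noteq> l")
    case True
    then have "E (\<lambda>S. d S i * d S k * d S j * d S l) = ?w i k * ?w j l"
      using that by (intro expectation_four_weights) auto
    then have "E (\<lambda>S. d S i * d S k * d S j * d S l * T i k j l) = ?w i k * ?w j l * T i k j l"
      by (simp only: integral_mult_left_zero)
    then show ?thesis by (simp only: mult.assoc)
  next
    case False
    then have "T i k j l = 0" using that G0 by (auto simp: T_def)
    then show ?thesis by simp
  qed
  have "(\<Sum>i<n. \<Sum>k<n. d S i * d S k * (\<Sum>j<n. d S j * (G i j * G j k))\<^sup>2) =
      (\<Sum>i<n. \<Sum>k<n. \<Sum>j<n. \<Sum>l<n. d S i * d S k * d S j * d S l * T i k j l)" for S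
    by (simp add: T_def power2_eq_square sum_product sum_distrib_left mult_ac)
  then have "E (\<lambda>S. \<Sum>i<n. \<Sum>k<n. d S i * d S k * (\<Sum>j<n. d S j * (G i j * G j k))\<^sup>2) =
      (\<Sum>i<n. \<Sum>k<n. \<Sum>j<n. \<Sum>l<n. E (\<lambda>S. d S i * d S k * d S j * d S l * T i k j l))"
    by (simp only: Bochner_Integration.integral_sum integrable)
  also have "\<dots> = (\<Sum>i<n. \<Sum>k<n. \<Sum>j<n. \<Sum>l<n. ?w i k * (?w j l * T i k j l))"
    by (intro sum.cong refl E_T) auto
  also have "\<dots> = (\<Sum>i<n. \<Sum>k<n. ?w i k * ((\<Sum>j<n. G i j * G j k)\<^sup>2 + (\<Sum>j<n. ?v j * (G i j * G j k)\<^sup>2)))"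
    unfolding sum_distrib_left [symmetric] w_sum
    by (simp add: T_def power2_eq_square sum_product)
  also have "\<dots> = (\<Sum>i<n. \<Sum>k<n. (\<Sum>j<n. G i j * G j k)\<^sup>2) + (\<Sum>i<n. \<Sum>k<n. \<Sum>j<n. ?v j * (G i j * G j k)\<^sup>2)
      + (\<Sum>i<n. ?v i * (\<Sum>j<n. (G i j)\<^sup>2)\<^sup>2) + (\<Sum>i<n. ?v i * (\<Sum>j<n. ?v j * (G i j) ^ 4))"
  proof -
    have "G i j * G j i = (G i j)\<^sup>2" if "i < n" "j < n" for i j
      using G_sym[OF that] by (simp add: power2_eq_square)
    then show ?thesis
      unfolding w_sum by (simp add: sum.distrib distrib_left flip: power_mult)
  qed
  \<comment> \<open>By symmetry of \<open>G\<close> the two single coincidences contribute equally,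
    hence the factor 2.\<close>
  also have "(\<Sum>i<n. \<Sum>k<n. \<Sum>j<n. ?v j * (G i j * G j k)\<^sup>2) = (\<Sum>i<n. ?v i * (\<Sum>j<n. (G i j)\<^sup>2)\<^sup>2)"
  proof -
    have "(\<Sum>i<n. \<Sum>k<n. \<Sum>j<n. ?v j * (G i j * G j k)\<^sup>2) = (\<Sum>i<n. \<Sum>j<n. \<Sum>k<n. ?v j * (G i j * G j k)\<^sup>2)"
      by (intro sum.cong refl sum.swap)
    also have "\<dots> = (\<Sum>j<n. \<Sum>i<n. \<Sum>k<n. ?v j * (G i j * G j k)\<^sup>2)" by (rule sum.swap)
    also have "\<dots> = (\<Sum>j<n. \<Sum>i<n. \<Sum>k<n. ?v j * ((G j i)\<^sup>2 * (G j k)\<^sup>2))"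
      by (intro sum.cong refl) (simp add: power_mult_distrib G_sym)
    finally show ?thesis
      by (simp only: sum_distrib_left [symmetric] power2_eq_square[of "sum _ _"] sum_product)
  qed
  finally show ?thesis by (simp add: sum_distrib_left mult.assoc)
qed

end

text \<open>Cauchy-Schwarz twice: \<open>|Mx|^2\<close> is the form of \<open>M^2\<close> at
  \<open>x\<close>, so it is at most the Frobenius norm of \<open>M^2\<close> times
  \<open>|x|^2\<close>, which is at most \<open>\<eta>^2 * |x|^2\<close>; then the form of
  \<open>M\<close> is at most \<open>|x| * |Mx|\<close>.\<close>

lemma quadratic_form_fourth_power_le:
  fixes M :: "'a \<Rightarrow> 'a \<Rightarrow> real"
  assumes sym: "\<And>i j. i \<in> S \<Longrightarrow> j \<in> S \<Longrightarrow> M i j = M j i"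
    and \<eta>: "\<eta> \<ge> 0" "(\<Sum>i\<in>S. \<Sum>k\<in>S. (\<Sum>j\<in>S. M i j * M j k)\<^sup>2) \<le> \<eta> ^ 4"
  shows "\<bar>\<Sum>i\<in>S. \<Sum>j\<in>S. M i j * x i * x j\<bar> \<le> \<eta> * (\<Sum>i\<in>S. (x i)\<^sup>2)"
proof -
  define W where "W = (\<Sum>i\<in>S. (x i)\<^sup>2)"
  define y where "y = (\<lambda>i. \<Sum>j\<in>S. M i j * x j)"
  have W: "W \<ge> 0" by (simp add: W_def sum_nonneg)
  have "(\<Sum>j\<in>S. (y j)\<^sup>2) = (\<Sum>j\<in>S. \<Sum>i\<in>S. \<Sum>k\<in>S. (x i * x k) * (M i j * M j k))"
    unfolding y_def power2_eq_square sum_product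
    by (intro sum.cong refl) (simp add: sym mult_ac)
  also have "\<dots> = (\<Sum>i\<in>S. \<Sum>j\<in>S. \<Sum>k\<in>S. (x i * x k) * (M i j * M j k))" by (rule sum.swap)
  also have "\<dots> = (\<Sum>i\<in>S. \<Sum>k\<in>S. \<Sum>j\<in>S. (x i * x k) * (M i j * M j k))"
    by (intro sum.cong refl sum.swap)
  also have "\<dots> = (\<Sum>(i, k)\<in>S \<times> S. (x i * x k) * (\<Sum>j\<in>S. M i j * M j k))"
    unfolding sum.cartesian_product [symmetric] by (simp only: sum_distrib_left)
  finally have "(\<Sum>j\<in>S. (y j)\<^sup>2)\<^sup>2 \<le>
      (\<Sum>(i, k)\<in>S \<times> S. (x i * x k)\<^sup>2) * (\<Sum>(i, k)\<in>S \<times> S. (\<Sum>j\<in>S. M i j * M j k)\<^sup>2)"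
    unfolding case_prod_unfold by (simp only: Cauchy_Schwarz_ineq_sum)
  also have "(\<Sum>(i, k)\<in>S \<times> S. (x i * x k)\<^sup>2) = W\<^sup>2"
    unfolding W_def power2_eq_square[of "sum _ _"] sum_product sum.cartesian_product
    by (simp only: power_mult_distrib)
  also have "W\<^sup>2 * (\<Sum>(i, k)\<in>S \<times> S. (\<Sum>j\<in>S. M i j * M j k)\<^sup>2) \<le> W\<^sup>2 * \<eta> ^ 4"
    using \<eta>(2) unfolding sum.cartesian_product by (rule mult_left_mono) simp
  also have "\<dots> = (\<eta>\<^sup>2 * W)\<^sup>2" by (simp add: power_mult_distrib flip: power_mult)
  finally have "(\<Sum>j\<in>S. (y j)\<^sup>2)\<^sup>2 \<le> (\<eta>\<^sup>2 * W)\<^sup>2" .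
  then have y: "(\<Sum>j\<in>S. (y j)\<^sup>2) \<le> \<eta>\<^sup>2 * W"
    by (rule power2_le_imp_le) (use W in simp)
  have "(\<Sum>i\<in>S. \<Sum>j\<in>S. M i j * x i * x j) = (\<Sum>i\<in>S. x i * y i)"
    by (simp add: y_def sum_distrib_left mult_ac)
  then have "(\<Sum>i\<in>S. \<Sum>j\<in>S. M i j * x i * x j)\<^sup>2 \<le> W * (\<Sum>j\<in>S. (y j)\<^sup>2)"
    unfolding W_def by (simp only: Cauchy_Schwarz_ineq_sum)
  also have "\<dots> \<le> W * (\<eta>\<^sup>2 * W)" using y W by (rule mult_left_mono)
  finally have "\<bar>\<Sum>i\<in>S. \<Sum>j\<in>S. M i j * x i * x j\<bar>\<^sup>2 \<le> (\<eta> * W)\<^sup>2"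
    by (simp add: power2_eq_square mult_ac)
  then have "\<bar>\<Sum>i\<in>S. \<Sum>j\<in>S. M i j * x i * x j\<bar> \<le> \<eta> * W"
    by (rule power2_le_imp_le) (use W \<eta>(1) in simp)
  then show ?thesis by (simp only: W_def)
qed

section \<open>Sampling probabilities that dominate leverage\<close>

text \<open>In the application \<open>r\<close> is the row norm of \<open>A\<close>,
  \<open>f\<close> is \<open>F^2\<close>, \<sigma> is \<open>F^2 / s\<close>, and \<kappa> comes
  from the off-diagonal threshold. An index with \<open>p i = 1\<close> is always sampled and adds
  no variance, so \<open>leverage\<close> and \<open>diagonal\<close> concern only
  \<open>p i < 1\<close>.\<close>

locale leverage_sampling = index_sampling n p + eigensystem "{..<n}" B \<alpha> u
  for n :: nat and p :: "nat \<Rightarrow> real" and B :: "nat \<Rightarrow> nat \<Rightarrow> real"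
    and \<alpha> :: "nat \<Rightarrow> real" and u :: "nat \<Rightarrow> nat \<Rightarrow> real" +
  fixes r :: "nat \<Rightarrow> real" and \<sigma> \<kappa> f \<beta> :: real
  assumes r_nonneg: "\<And>i. r i \<ge> 0" and \<kappa>_nonneg: "\<kappa> \<ge> 0" and \<beta>_pos: "\<beta> > 0" and \<sigma>_nonneg: "\<sigma> \<ge> 0"
    and row: "\<And>i. i < n \<Longrightarrow> (\<Sum>j<n. (B i j)\<^sup>2) \<le> (r i)\<^sup>2"
    and total: "(\<Sum>i<n. (r i)\<^sup>2) \<le> f"
    and leverage: "\<And>i. i < n \<Longrightarrow> p i < 1 \<Longrightarrow> (r i)\<^sup>2 \<le> \<sigma> * p i"
    and entry: "\<And>i j. i < n \<Longrightarrow> j < n \<Longrightarrow> i \<noteq> j \<Longrightarrow> \<bar>B i j\<bar> \<le> \<kappa> * r i * r j"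
    and diagonal: "\<And>i. i < n \<Longrightarrow> p i < 1 \<Longrightarrow> B i i = 0"
begin

abbreviation "K \<equiv> dominant n \<alpha> \<beta>"
abbreviation "H \<equiv> spectral_tail n B \<alpha> u \<beta>"
abbreviation "v i \<equiv> 1 / p i - 1"

lemma v_nonneg: "i < n \<Longrightarrow> v i \<ge> 0"
  using p_pos[of i] p_le_1[of i] by simp

lemma v_leverage: "i < n \<Longrightarrow> v i * (r i)\<^sup>2 \<le> \<sigma>"
proof (cases "p i < 1")
  case True
  assume i: "i < n"
  have "v i * (r i)\<^sup>2 \<le> (r i)\<^sup>2 / p i" using p_pos[OF i] by (simp add: algebra_simps)
  also have "\<dots> \<le> \<sigma>" using leverage[OF i True] p_pos[OF i] by (simp add: divide_simps)
  finally show ?thesis .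
next
  case False
  assume "i < n"
  then have "p i = 1" using False p_le_1[of i] by simp
  then show ?thesis using \<sigma>_nonneg by simp
qed

lemma B_sym: "i < n \<Longrightarrow> j < n \<Longrightarrow> B i j = B j i"
  by (simp add: decomp mult_ac)

lemma tail_sym: "i < n \<Longrightarrow> j < n \<Longrightarrow> H i j = H j i"
  by (simp add: spectral_tail_def B_sym mult_ac)

section \<open>Size of the tail and of the dominant part, in norm and by entries\<close>

definition tail_eigenvalue :: "nat \<Rightarrow> real" where
  "tail_eigenvalue a = (if a \<in> K then 0 else \<alpha> a)"

lemma tail_eigenvalue_le: "a < n \<Longrightarrow> \<bar>tail_eigenvalue a\<bar> \<le> \<beta>"
  using \<beta>_pos by (auto simp: tail_eigenvalue_def dominant_def)

lemma tail_decomp: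
  assumes "i < n" "j < n"
  shows "H i j = (\<Sum>a<n. tail_eigenvalue a * u a i * u a j)"
proof -
  have "(\<Sum>k\<in>K. \<alpha> k * u k i * u k j) = (\<Sum>a<n. if a \<in> K then \<alpha> a * u a i * u a j else 0)"
    by (intro sum.mono_neutral_cong_left) (auto simp: dominant_def)
  then show ?thesis
    using assms by (simp add: spectral_tail_def decomp sum_subtractf [symmetric] tail_eigenvalue_def)
      (intro sum.cong, auto)
qed

lemma sum_u_squares: "i < n \<Longrightarrow> (\<Sum>a<n. (u a i)\<^sup>2) = 1"
  using complete[of i i] by (simp add: power2_eq_square)

lemma tail_diagonal_le:
  assumes "i < n"
  shows "\<bar>H i i\<bar> \<le> \<beta>"
proof -
  have "\<bar>H i i\<bar> \<le> (\<Sum>a<n. \<bar>tail_eigenvalue a * u a i * u a i\<bar>)"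
    using assms by (simp only: tail_decomp sum_abs)
  also have "\<dots> \<le> (\<Sum>a<n. \<beta> * (u a i)\<^sup>2)"
    using tail_eigenvalue_le
    by (intro sum_mono) (auto simp: abs_mult power2_eq_square mult.assoc intro!: mult_right_mono)
  also have "\<dots> = \<beta>" using sum_u_squares[OF assms] by (simp flip: sum_distrib_left)
  finally show ?thesis .
qed

lemma eigen_row_le: "i < n \<Longrightarrow> (\<Sum>a<n. (\<alpha> a * u a i)\<^sup>2) \<le> (r i)\<^sup>2"
  using row[of i] row_sum_squares[of i] by simp

text \<open>In the eigenbasis a row of the tail has the coordinates of the same row of
  \<open>B\<close>, with the dominant ones set to zero.\<close>

lemma tail_row_le:
  assumes i: "i < n"
  shows "(\<Sum>j<n. (H i j)\<^sup>2) \<le> (r i)\<^sup>2"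
proof -
  have "(\<Sum>j<n. (H i j)\<^sup>2) = (\<Sum>j<n. (\<Sum>a<n. (tail_eigenvalue a * u a i) * u a j)\<^sup>2)"
    using i by (simp add: tail_decomp)
  also have "\<dots> = (\<Sum>a<n. (tail_eigenvalue a * u a i)\<^sup>2)"
    using synthesis_norm[of "\<lambda>a. tail_eigenvalue a * u a i"] by simp
  also have "\<dots> \<le> (\<Sum>a<n. (\<alpha> a * u a i)\<^sup>2)"
    by (intro sum_mono) (auto simp: tail_eigenvalue_def)
  finally show ?thesis using eigen_row_le[OF i] by simp
qed

lemma tail_operator_norm:
  "(\<Sum>i<n. (\<Sum>j<n. H i j * g j)\<^sup>2) \<le> \<beta>\<^sup>2 * (\<Sum>j<n. (g j)\<^sup>2)"
proof -
  define c where "c = (\<lambda>a. \<Sum>j<n. u a j * g j)"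
  have "(\<Sum>j<n. H i j * g j) = (\<Sum>a<n. (tail_eigenvalue a * c a) * u a i)" if "i < n" for i
  proof -
    have "(\<Sum>j<n. H i j * g j) = (\<Sum>j<n. \<Sum>a<n. tail_eigenvalue a * u a i * (u a j * g j))"
      using that by (simp add: tail_decomp sum_distrib_left mult_ac)
    also have "\<dots> = (\<Sum>a<n. \<Sum>j<n. tail_eigenvalue a * u a i * (u a j * g j))" by (rule sum.swap)
    finally show ?thesis by (simp add: c_def sum_distrib_left mult_ac)
  qed
  then have "(\<Sum>i<n. (\<Sum>j<n. H i j * g j)\<^sup>2) = (\<Sum>a<n. (tail_eigenvalue a * c a)\<^sup>2)"
    using synthesis_norm[of "\<lambda>a. tail_eigenvalue a * c a"] by simp
  also have "\<dots> \<le> (\<Sum>a<n. \<beta>\<^sup>2 * (c a)\<^sup>2)"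
    unfolding power_mult_distrib using tail_eigenvalue_le \<beta>_pos
    by (intro sum_mono mult_right_mono) (auto simp: abs_le_square_iff [symmetric])
  also have "\<dots> = \<beta>\<^sup>2 * (\<Sum>j<n. (g j)\<^sup>2)"
    using parseval[of g g] by (simp add: c_def power2_eq_square flip: sum_distrib_left)
  finally show ?thesis .
qed

text \<open>The incoherence estimate: on \<open>K\<close> the cut gives
  \<open>\<bar>\<alpha> k\<bar> \<le> (\<alpha> k)^2 / \<beta>\<close>, and the sum of
  \<open>(\<alpha> k * u k i)^2\<close> is at most the squared length of row
  \<open>i\<close>.\<close>

lemma dominant_mass:
  assumes i: "i < n"
  shows "(\<Sum>k\<in>K. \<bar>\<alpha> k\<bar> * (u k i)\<^sup>2) \<le> (r i)\<^sup>2 / \<beta>"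
proof -
  have "(\<Sum>k\<in>K. \<bar>\<alpha> k\<bar> * (u k i)\<^sup>2) \<le> (\<Sum>k\<in>K. (\<alpha> k * u k i)\<^sup>2 / \<beta>)"
  proof (rule sum_mono)
    fix k assume "k \<in> K"
    then have "\<beta> * \<bar>\<alpha> k\<bar> \<le> (\<alpha> k)\<^sup>2"
      using mult_right_mono[of \<beta> "\<bar>\<alpha> k\<bar>" "\<bar>\<alpha> k\<bar>"] by (simp add: dominant_def power2_eq_square)
    then have "\<bar>\<alpha> k\<bar> \<le> (\<alpha> k)\<^sup>2 / \<beta>" using \<beta>_pos by (simp add: field_simps)
    from mult_right_mono[OF this, of "(u k i)\<^sup>2"]
    show "\<bar>\<alpha> k\<bar> * (u k i)\<^sup>2 \<le> (\<alpha> k * u k i)\<^sup>2 / \<beta>" by (simp add: power_mult_distrib)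
  qed
  also have "\<dots> = (\<Sum>k\<in>K. (\<alpha> k * u k i)\<^sup>2) / \<beta>" by (simp add: sum_divide_distrib)
  also have "(\<Sum>k\<in>K. (\<alpha> k * u k i)\<^sup>2) \<le> (\<Sum>k<n. (\<alpha> k * u k i)\<^sup>2)"
    by (intro sum_mono2) (auto simp: dominant_def)
  also have "\<dots> \<le> (r i)\<^sup>2" by (rule eigen_row_le[OF i])
  finally show ?thesis using \<beta>_pos by (simp add: divide_right_mono)
qed

text \<open>Cauchy-Schwarz with \<open>\<bar>\<alpha> k\<bar>\<close> split evenly, so that each
  factor is an instance of \<open>dominant_mass\<close>.\<close>

lemma dominant_entry_le:
  assumes ij: "i < n" "j < n"
  shows "\<bar>\<Sum>k\<in>K. \<alpha> k * u k i * u k j\<bar> \<le> r i * r j / \<beta>"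
proof -
  let ?s = "\<lambda>i k. sqrt \<bar>\<alpha> k\<bar> * \<bar>u k i\<bar>"
  have s2: "(\<Sum>k\<in>K. (?s i k)\<^sup>2) = (\<Sum>k\<in>K. \<bar>\<alpha> k\<bar> * (u k i)\<^sup>2)" for i
    by (simp add: power_mult_distrib)
  have "(\<Sum>k\<in>K. ?s i k * ?s j k)\<^sup>2 \<le> (\<Sum>k\<in>K. (?s i k)\<^sup>2) * (\<Sum>k\<in>K. (?s j k)\<^sup>2)"
    by (rule Cauchy_Schwarz_ineq_sum)
  also have "\<dots> \<le> (r i)\<^sup>2 / \<beta> * ((r j)\<^sup>2 / \<beta>)"
    unfolding s2 using dominant_mass ij \<beta>_pos by (intro mult_mono) (auto intro!: sum_nonneg)
  also have "\<dots> = (r i * r j / \<beta>)\<^sup>2" by (simp add: power2_eq_square)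
  finally have "(\<Sum>k\<in>K. ?s i k * ?s j k) \<le> r i * r j / \<beta>"
    by (rule power2_le_imp_le) (use r_nonneg \<beta>_pos in simp)
  moreover have "?s i k * ?s j k = \<bar>\<alpha> k * u k i * u k j\<bar>" for k
  proof -
    have "?s i k * ?s j k = (sqrt \<bar>\<alpha> k\<bar> * sqrt \<bar>\<alpha> k\<bar>) * \<bar>u k i\<bar> * \<bar>u k j\<bar>" by (simp only: mult_ac)
    then show ?thesis by (simp add: abs_mult)
  qed
  ultimately have "(\<Sum>k\<in>K. \<bar>\<alpha> k * u k i * u k j\<bar>) \<le> r i * r j / \<beta>" by simp
  then show ?thesis by (rule order_trans[OF sum_abs])
qed

lemma tail_entry_le:
  assumes "i < n" "j < n" "i \<noteq> j"
  shows "\<bar>H i j\<bar> \<le> (\<kappa> + 1 / \<beta>) * (r i * r j)"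
proof -
  have "\<bar>H i j\<bar> \<le> \<bar>B i j\<bar> + \<bar>\<Sum>k\<in>K. \<alpha> k * u k i * u k j\<bar>"
    unfolding spectral_tail_def by (rule abs_triangle_ineq4)
  also have "\<dots> \<le> \<kappa> * r i * r j + r i * r j / \<beta>"
    using entry[OF assms] dominant_entry_le assms by (intro add_mono) auto
  finally show ?thesis by (simp add: algebra_simps)
qed

text \<open>If \<open>p i < 1\<close>, then \<open>B i i = 0\<close> and the tail entry is minus the
  dominant one, at most \<open>(r i)^2 / \<beta>\<close>, which the leverage bound makes
  proportional to \<open>p i\<close>. If \<open>p i = 1\<close>, the bound \<beta> suffices.\<close>

lemma tail_diagonal_scaled:
  assumes i: "i < n" and \<eta>: "\<beta> \<le> \<eta>" "\<sigma> / \<beta> \<le> \<eta>"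
  shows "\<bar>H i i\<bar> \<le> \<eta> * p i"
proof (cases "p i < 1")
  case True
  then have "\<bar>H i i\<bar> \<le> (r i)\<^sup>2 / \<beta>"
    using dominant_entry_le[OF i i] diagonal[OF i] by (simp add: spectral_tail_def power2_eq_square)
  also have "\<dots> \<le> (\<sigma> * p i) / \<beta>" using leverage[OF i True] \<beta>_pos by (simp add: divide_right_mono)
  also have "\<dots> = \<sigma> / \<beta> * p i" by simp
  also have "\<dots> \<le> \<eta> * p i" using \<eta>(2) p_pos[OF i] by (intro mult_right_mono) auto
  finally show ?thesis .
next
  case False
  then have "p i = 1" using p_le_1[OF i] by simp
  then show ?thesis using tail_diagonal_le[OF i] \<eta> by simp
qed

section \<open>Fourth moment of the tail off the diagonal\<close>

definition hollow_tail :: "nat \<Rightarrow> nat \<Rightarrow> real" where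
  "hollow_tail i j = (if i = j then 0 else H i j)"

abbreviation "G \<equiv> hollow_tail"

lemma hollow_row_le: "i < n \<Longrightarrow> (\<Sum>j<n. (G i j)\<^sup>2) \<le> (r i)\<^sup>2"
  using tail_row_le[of i] by (intro order_trans[OF sum_mono tail_row_le]) (auto simp: hollow_tail_def)

lemma hollow_total_le: "(\<Sum>i<n. \<Sum>j<n. (G i j)\<^sup>2) \<le> f"
  using sum_mono[of "{..<n}" "\<lambda>i. \<Sum>j<n. (G i j)\<^sup>2" "\<lambda>i. (r i)\<^sup>2"] hollow_row_le total by simp

lemma hollow_sym: "i < n \<Longrightarrow> j < n \<Longrightarrow> G i j = G j i"
  by (auto simp: hollow_tail_def tail_sym)

text \<open>The tail and its diagonal both have operator norm at most \<beta>;
  \<open>(a - b)^2 \<le> 2 * a^2 + 2 * b^2\<close> gives the factor 4.\<close>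

lemma hollow_operator_norm:
  "(\<Sum>i<n. (\<Sum>j<n. G i j * g j)\<^sup>2) \<le> 4 * \<beta>\<^sup>2 * (\<Sum>j<n. (g j)\<^sup>2)"
proof -
  have "(\<Sum>i<n. (\<Sum>j<n. G i j * g j)\<^sup>2) \<le> (\<Sum>i<n. 2 * (\<Sum>j<n. H i j * g j)\<^sup>2 + 2 * (\<beta>\<^sup>2 * (g i)\<^sup>2))"
  proof (rule sum_mono)
    fix i assume "i \<in> {..<n}"
    then have i: "i < n" by simp
    have "(\<Sum>j<n. H i j * g j) = (\<Sum>j<n. G i j * g j + (if j = i then H i i * g i else 0))"
      by (intro sum.cong) (auto simp: hollow_tail_def)
    then have "(\<Sum>j<n. G i j * g j) = (\<Sum>j<n. H i j * g j) - H i i * g i"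
      using i by (simp add: sum.distrib)
    moreover have "(a - b)\<^sup>2 \<le> 2 * a\<^sup>2 + 2 * b\<^sup>2" for a b :: real
      using sum_squares_ge_zero[of "a + b" 0] by (simp add: power2_eq_square algebra_simps)
    ultimately have "(\<Sum>j<n. G i j * g j)\<^sup>2 \<le> 2 * (\<Sum>j<n. H i j * g j)\<^sup>2 + 2 * (H i i * g i)\<^sup>2"
      by simp
    moreover have "(H i i)\<^sup>2 \<le> \<beta>\<^sup>2"
      using tail_diagonal_le[OF i] \<beta>_pos by (simp add: abs_le_square_iff [symmetric])
    then have "(H i i * g i)\<^sup>2 \<le> \<beta>\<^sup>2 * (g i)\<^sup>2"
      unfolding power_mult_distrib by (rule mult_right_mono) simp
    ultimately show "(\<Sum>j<n. G i j * g j)\<^sup>2 \<le> 2 * (\<Sum>j<n. H i j * g j)\<^sup>2 + 2 * (\<beta>\<^sup>2 * (g i)\<^sup>2)"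
      by simp
  qed
  also have "\<dots> = 2 * (\<Sum>i<n. (\<Sum>j<n. H i j * g j)\<^sup>2) + 2 * (\<beta>\<^sup>2 * (\<Sum>j<n. (g j)\<^sup>2))"
    by (simp add: sum.distrib sum_distrib_left)
  finally show ?thesis using tail_operator_norm[of g] by simp
qed

definition fourth_power_trace :: "nat set \<Rightarrow> real" where
  "fourth_power_trace S =
    (\<Sum>i<n. \<Sum>k<n. d S i * d S k * (\<Sum>j<n. d S j * (G i j * G j k))\<^sup>2)"

lemma weight_nonneg: "i < n \<Longrightarrow> d S i \<ge> 0"
  using p_pos[of i] by (simp add: sample_weight_def)

lemma fourth_power_trace_nonneg: "fourth_power_trace S \<ge> 0"
  unfolding fourth_power_trace_def
  by (intro sum_nonneg mult_nonneg_nonneg weight_nonneg) auto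

text \<open>Without coincidence the term is the squared Frobenius norm of \<open>G^2\<close>, at
  most the squared operator norm of \<open>G\<close> times its squared Frobenius norm. A single
  coincidence pairs \<open>v i\<close> with one \<open>(r i)^2\<close>. The double one pairs
  \<open>v i * v j\<close> with \<open>(r i * r j)^2\<close> from \<open>tail_entry_le\<close>. What
  is left sums to at most \<open>f\<close> in each case.\<close>

lemma expectation_fourth_power_trace:
  "E fourth_power_trace \<le> (4 * \<beta>\<^sup>2 + 2 * \<sigma> + ((\<kappa> + 1 / \<beta>) * \<sigma>)\<^sup>2) * f"
proof -
  have "(\<Sum>i<n. \<Sum>k<n. (\<Sum>j<n. G i j * G j k)\<^sup>2) \<le> 4 * \<beta>\<^sup>2 * f"
  proof -
    have "(\<Sum>i<n. \<Sum>k<n. (\<Sum>j<n. G i j * G j k)\<^sup>2) = (\<Sum>k<n. \<Sum>i<n. (\<Sum>j<n. G i j * G j k)\<^sup>2)"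
      by (rule sum.swap)
    also have "\<dots> \<le> (\<Sum>k<n. 4 * \<beta>\<^sup>2 * (\<Sum>j<n. (G j k)\<^sup>2))"
      by (intro sum_mono hollow_operator_norm)
    also have "\<dots> = 4 * \<beta>\<^sup>2 * (\<Sum>j<n. \<Sum>k<n. (G j k)\<^sup>2)"
      unfolding sum_distrib_left by (rule sum.swap)
    also have "\<dots> \<le> 4 * \<beta>\<^sup>2 * f" by (intro mult_left_mono hollow_total_le) auto
    finally show ?thesis .
  qed
  moreover have "(\<Sum>i<n. v i * (\<Sum>j<n. (G i j)\<^sup>2)\<^sup>2) \<le> \<sigma> * f"
  proof -
    have "(\<Sum>i<n. v i * (\<Sum>j<n. (G i j)\<^sup>2)\<^sup>2) \<le> (\<Sum>i<n. \<sigma> * (r i)\<^sup>2)"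
    proof (rule sum_mono)
      fix i assume "i \<in> {..<n}"
      then have i: "i < n" by simp
      have "(\<Sum>j<n. (G i j)\<^sup>2)\<^sup>2 \<le> ((r i)\<^sup>2)\<^sup>2"
        using hollow_row_le[OF i] by (intro power_mono sum_nonneg) auto
      then have "v i * (\<Sum>j<n. (G i j)\<^sup>2)\<^sup>2 \<le> v i * ((r i)\<^sup>2)\<^sup>2"
        using v_nonneg[OF i] by (rule mult_left_mono)
      also have "\<dots> = (v i * (r i)\<^sup>2) * (r i)\<^sup>2" by (simp add: power2_eq_square)
      also have "\<dots> \<le> \<sigma> * (r i)\<^sup>2" using v_leverage[OF i] by (rule mult_right_mono) simp
      finally show "v i * (\<Sum>j<n. (G i j)\<^sup>2)\<^sup>2 \<le> \<sigma> * (r i)\<^sup>2" .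
    qed
    also have "\<dots> \<le> \<sigma> * f" using total \<sigma>_nonneg by (simp add: mult_left_mono flip: sum_distrib_left)
    finally show ?thesis .
  qed
  moreover have "(\<Sum>i<n. \<Sum>j<n. v i * v j * (G i j) ^ 4) \<le> ((\<kappa> + 1 / \<beta>) * \<sigma>)\<^sup>2 * f"
  proof -
    let ?c = "\<kappa> + 1 / \<beta>"
    have "v i * v j * (G i j) ^ 4 \<le> (?c * \<sigma>)\<^sup>2 * (G i j)\<^sup>2" if ij: "i < n" "j < n" for i j
    proof -
      have "(G i j)\<^sup>2 \<le> (?c * (r i * r j))\<^sup>2"
        using tail_entry_le[OF ij] r_nonneg \<kappa>_nonneg \<beta>_pos
        by (auto simp: hollow_tail_def abs_le_square_iff [symmetric])
      then have "v i * v j * (G i j)\<^sup>2 \<le> v i * v j * (?c * (r i * r j))\<^sup>2"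
        using v_nonneg ij by (intro mult_left_mono) auto
      also have "\<dots> = ?c\<^sup>2 * ((v i * (r i)\<^sup>2) * (v j * (r j)\<^sup>2))"
        by (simp only: power_mult_distrib mult_ac)
      also have "\<dots> \<le> ?c\<^sup>2 * (\<sigma> * \<sigma>)"
        using v_leverage v_nonneg ij \<sigma>_nonneg by (intro mult_left_mono mult_mono) auto
      finally have "v i * v j * (G i j)\<^sup>2 * (G i j)\<^sup>2 \<le> ?c\<^sup>2 * (\<sigma> * \<sigma>) * (G i j)\<^sup>2"
        by (rule mult_right_mono) simp
      then show ?thesis by (simp add: power_mult_distrib power2_eq_square power4_eq_xxxx mult_ac)
    qed
    then have "(\<Sum>i<n. \<Sum>j<n. v i * v j * (G i j) ^ 4) \<le> (\<Sum>i<n. \<Sum>j<n. (?c * \<sigma>)\<^sup>2 * (G i j)\<^sup>2)"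
      by (intro sum_mono) auto
    also have "\<dots> = (?c * \<sigma>)\<^sup>2 * (\<Sum>i<n. \<Sum>j<n. (G i j)\<^sup>2)" by (simp only: sum_distrib_left)
    also have "\<dots> \<le> (?c * \<sigma>)\<^sup>2 * f" by (intro mult_left_mono hollow_total_le) auto
    finally show ?thesis .
  qed
  moreover have "E fourth_power_trace =
    (\<Sum>i<n. \<Sum>k<n. (\<Sum>j<n. G i j * G j k)\<^sup>2) + 2 * (\<Sum>i<n. v i * (\<Sum>j<n. (G i j)\<^sup>2)\<^sup>2)
    + (\<Sum>i<n. \<Sum>j<n. v i * v j * (G i j) ^ 4)"
    unfolding fourth_power_trace_def
    by (rule fourth_moment) (simp_all add: hollow_tail_def tail_sym)
  ultimately show ?thesis by (simp only: distrib_right)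
qed

section \<open>Second moment of the weighted Gram error\<close>

definition gram_deviation :: "nat set \<Rightarrow> real" where
  "gram_deviation S = (\<Sum>k\<in>K. \<Sum>l\<in>K. \<bar>\<alpha> k\<bar> * \<bar>\<alpha> l\<bar> * (gram_error S p u k l)\<^sup>2)"

lemma weighted_sum_eq:
  assumes "S \<subseteq> {..<n}"
  shows "(\<Sum>i<n. d S i * g i) = (\<Sum>i\<in>S. g i / p i)"
  using assms by (intro sum.mono_neutral_cong_right) (auto simp: sample_weight_def)

lemma gram_error_eq:
  assumes S: "S \<subseteq> {..<n}" and kl: "k < n" "l < n"
  shows "gram_error S p u k l = (\<Sum>i<n. (d S i - 1) * (u k i * u l i))"
  using orthonormal[of k l] kl weighted_sum_eq[OF S, of "\<lambda>i. u k i * u l i"]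
  by (simp add: gram_error_def left_diff_distrib sum_subtractf)

text \<open>Once the sum over \<open>i\<close> is outermost, the sums over \<open>k\<close> and
  \<open>l\<close> factor into the square of the dominant mass at \<open>i\<close>. This is at most
  \<open>((r i)^2 / \<beta>)^2\<close>: one \<open>(r i)^2\<close> absorbs the variance
  \<open>v i\<close>, the other is summed.\<close>

lemma expectation_gram_deviation: "E gram_deviation \<le> \<sigma> * f / \<beta>\<^sup>2"
proof -
  have "E gram_deviation = E (\<lambda>S. \<Sum>k\<in>K. \<Sum>l\<in>K. \<bar>\<alpha> k\<bar> * \<bar>\<alpha> l\<bar> * (\<Sum>i<n. (d S i - 1) * (u k i * u l i))\<^sup>2)"
  \<comment> \<open>\<open>gram_error\<close> sums over \<open>S\<close>, so the form with weights
    is valid only for \<open>S \<subseteq> {..<n}\<close>, that is, on the support.\<close>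
  proof (rule integral_cong_AE)
    show "AE S in random_index_set n p. gram_deviation S =
        (\<Sum>k\<in>K. \<Sum>l\<in>K. \<bar>\<alpha> k\<bar> * \<bar>\<alpha> l\<bar> * (\<Sum>i<n. (d S i - 1) * (u k i * u l i))\<^sup>2)"
    proof (rule AE_pmfI)
      fix S assume "S \<in> set_pmf (random_index_set n p)"
      then have "S \<subseteq> {..<n}" using set_pmf_random_index_set by blast
      then show "gram_deviation S =
          (\<Sum>k\<in>K. \<Sum>l\<in>K. \<bar>\<alpha> k\<bar> * \<bar>\<alpha> l\<bar> * (\<Sum>i<n. (d S i - 1) * (u k i * u l i))\<^sup>2)"
        unfolding gram_deviation_def
        by (intro sum.cong refl) (simp add: gram_error_eq dominant_def)
    qed
  qed simp_all
  also have "\<dots> = (\<Sum>k\<in>K. \<Sum>l\<in>K. \<bar>\<alpha> k\<bar> * \<bar>\<alpha> l\<bar> * (\<Sum>i<n. v i * (u k i * u l i)\<^sup>2))"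
    by (simp add: second_moment)
  also have "\<dots> = (\<Sum>k\<in>K. \<Sum>l\<in>K. \<Sum>i<n. v i * ((\<bar>\<alpha> k\<bar> * (u k i)\<^sup>2) * (\<bar>\<alpha> l\<bar> * (u l i)\<^sup>2)))"
    unfolding sum_distrib_left by (intro sum.cong refl) (simp only: power_mult_distrib mult_ac)
  also have "\<dots> = (\<Sum>k\<in>K. \<Sum>i<n. \<Sum>l\<in>K. v i * ((\<bar>\<alpha> k\<bar> * (u k i)\<^sup>2) * (\<bar>\<alpha> l\<bar> * (u l i)\<^sup>2)))"
    by (intro sum.cong refl sum.swap)
  also have "\<dots> = (\<Sum>i<n. \<Sum>k\<in>K. \<Sum>l\<in>K. v i * ((\<bar>\<alpha> k\<bar> * (u k i)\<^sup>2) * (\<bar>\<alpha> l\<bar> * (u l i)\<^sup>2)))"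
    by (rule sum.swap)
  also have "\<dots> = (\<Sum>i<n. v i * (\<Sum>k\<in>K. \<bar>\<alpha> k\<bar> * (u k i)\<^sup>2)\<^sup>2)"
    unfolding power2_eq_square[of "sum _ _"] sum_product by (simp only: sum_distrib_left)
  also have "\<dots> \<le> (\<Sum>i<n. \<sigma> * (r i)\<^sup>2 / \<beta>\<^sup>2)"
  proof (rule sum_mono)
    fix i assume "i \<in> {..<n}"
    then have i: "i < n" by simp
    have "(\<Sum>k\<in>K. \<bar>\<alpha> k\<bar> * (u k i)\<^sup>2)\<^sup>2 \<le> ((r i)\<^sup>2 / \<beta>)\<^sup>2"
      by (intro power_mono dominant_mass i sum_nonneg) auto
    then have "v i * (\<Sum>k\<in>K. \<bar>\<alpha> k\<bar> * (u k i)\<^sup>2)\<^sup>2 \<le> v i * ((r i)\<^sup>2 / \<beta>)\<^sup>2"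
      using v_nonneg[OF i] by (rule mult_left_mono)
    also have "\<dots> = (v i * (r i)\<^sup>2) * ((r i)\<^sup>2 / \<beta>\<^sup>2)" by (simp add: power2_eq_square)
    also have "\<dots> \<le> \<sigma> * ((r i)\<^sup>2 / \<beta>\<^sup>2)" using v_leverage[OF i] by (rule mult_right_mono) simp
    finally show "v i * (\<Sum>k\<in>K. \<bar>\<alpha> k\<bar> * (u k i)\<^sup>2)\<^sup>2 \<le> \<sigma> * (r i)\<^sup>2 / \<beta>\<^sup>2" by simp
  qed
  also have "\<dots> = \<sigma> * (\<Sum>i<n. (r i)\<^sup>2) / \<beta>\<^sup>2" by (simp only: sum_distrib_left sum_divide_distrib)
  also have "\<dots> \<le> \<sigma> * f / \<beta>\<^sup>2"
    using total \<sigma>_nonneg by (intro divide_right_mono mult_left_mono) auto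
  finally show ?thesis .
qed

text \<open>With \<open>x i = sqrt (p i) * y i\<close>, the off-diagonal tail becomes the form of
  \<open>?M\<close>, whose fourth power has trace \<open>fourth_power_trace S\<close>; this costs
  \<open>\<eta>\<^sub>1\<close>. The diagonal is bounded entry by entry and costs
  \<open>\<eta>\<^sub>2\<close>.\<close>

lemma spectral_sampleI:
  assumes S: "S \<subseteq> {..<n}" and trace: "fourth_power_trace S \<le> \<eta>\<^sub>1 ^ 4"
    and gram: "gram_deviation S \<le> \<tau>\<^sup>2"
    and \<eta>: "\<eta>\<^sub>1 \<ge> 0" "\<beta> \<le> \<eta>\<^sub>2" "\<sigma> / \<beta> \<le> \<eta>\<^sub>2" and \<tau>: "\<tau> \<ge> 0"
  shows "spectral_sample n B \<alpha> u \<beta> S p (\<eta>\<^sub>1 + \<eta>\<^sub>2) \<tau>"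
proof (rule spectral_sample.intro)
  show "eigensystem {..<n} B \<alpha> u" by (rule eigensystem_axioms)
  show "(\<Sum>k\<in>K. \<Sum>l\<in>K. \<bar>\<alpha> k\<bar> * \<bar>\<alpha> l\<bar> * (gram_error S p u k l)\<^sup>2) \<le> \<tau>\<^sup>2"
    using gram by (simp only: gram_deviation_def)
  have fin: "finite S" using S finite_subset by blast
  have p: "p i > 0" if "i \<in> S" for i using that S p_pos by auto
  fix y
  let ?x = "\<lambda>i. sqrt (p i) * y i" and ?M = "\<lambda>i j. G i j / (sqrt (p i) * sqrt (p j))"
  define Y where "Y = (\<Sum>i\<in>S. p i * (y i)\<^sup>2)"
  have norm: "(\<Sum>i\<in>S. (?x i)\<^sup>2) = Y"
    unfolding Y_def using p by (intro sum.cong) (auto simp: power_mult_distrib less_imp_le)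
  have "(\<Sum>i\<in>S. \<Sum>k\<in>S. (\<Sum>j\<in>S. ?M i j * ?M j k)\<^sup>2) = fourth_power_trace S"
  proof -
    have "(\<Sum>j\<in>S. ?M i j * ?M j k)\<^sup>2 = (\<Sum>j\<in>S. G i j * G j k / p j)\<^sup>2 / p k / p i" if "i \<in> S" "k \<in> S" for i k
    proof -
      have "(\<Sum>j\<in>S. ?M i j * ?M j k) = (\<Sum>j\<in>S. G i j * G j k / p j / (sqrt (p i) * sqrt (p k)))"
      proof (rule sum.cong)
        fix j assume "j \<in> S"
        have "(sqrt (p i) * sqrt (p j)) * (sqrt (p j) * sqrt (p k)) =
            (sqrt (p j) * sqrt (p j)) * (sqrt (p i) * sqrt (p k))" by (simp only: mult_ac)
        also have "sqrt (p j) * sqrt (p j) = p j" using p[OF \<open>j \<in> S\<close>] by simp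
        finally have "(sqrt (p i) * sqrt (p j)) * (sqrt (p j) * sqrt (p k)) = p j * (sqrt (p i) * sqrt (p k))" .
        then show "?M i j * ?M j k = G i j * G j k / p j / (sqrt (p i) * sqrt (p k))"
          by (simp only: times_divide_times_eq divide_divide_eq_left)
      qed simp
      also have "\<dots> = (\<Sum>j\<in>S. G i j * G j k / p j) / (sqrt (p i) * sqrt (p k))"
        by (simp only: sum_divide_distrib)
      finally show ?thesis
        using p[OF that(1)] p[OF that(2)] by (simp only: power_divide power_mult_distrib) (simp add: mult.commute)
    qed
    then have "(\<Sum>i\<in>S. \<Sum>k\<in>S. (\<Sum>j\<in>S. ?M i j * ?M j k)\<^sup>2) =
        (\<Sum>i\<in>S. (\<Sum>k\<in>S. (\<Sum>j\<in>S. G i j * G j k / p j)\<^sup>2 / p k) / p i)"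
      by (simp add: sum_divide_distrib)
    also have "\<dots> = (\<Sum>i<n. d S i * (\<Sum>k<n. d S k * (\<Sum>j<n. d S j * (G i j * G j k))\<^sup>2))"
      by (simp only: weighted_sum_eq[OF S])
    finally show ?thesis
      by (simp only: fourth_power_trace_def sum_distrib_left mult.assoc)
  qed
  then have "\<bar>\<Sum>i\<in>S. \<Sum>j\<in>S. ?M i j * ?x i * ?x j\<bar> \<le> \<eta>\<^sub>1 * Y"
    unfolding norm [symmetric] using S trace \<eta>(1)
    by (intro quadratic_form_fourth_power_le) (auto simp: hollow_sym subset_iff)
  also have "(\<Sum>i\<in>S. \<Sum>j\<in>S. ?M i j * ?x i * ?x j) = (\<Sum>i\<in>S. \<Sum>j\<in>S. G i j * y i * y j)"
    using p by (intro sum.cong refl) (simp add: less_imp_neq[symmetric])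
  finally have off: "\<bar>\<Sum>i\<in>S. \<Sum>j\<in>S. G i j * y i * y j\<bar> \<le> \<eta>\<^sub>1 * Y" .
  have "\<bar>\<Sum>i\<in>S. H i i * (y i)\<^sup>2\<bar> \<le> (\<Sum>i\<in>S. \<bar>H i i * (y i)\<^sup>2\<bar>)" by (rule sum_abs)
  also have "\<dots> \<le> (\<Sum>i\<in>S. \<eta>\<^sub>2 * p i * (y i)\<^sup>2)"
    using S tail_diagonal_scaled[OF _ \<eta>(2,3)]
    by (intro sum_mono) (auto simp: abs_mult intro!: mult_right_mono)
  also have "\<dots> = \<eta>\<^sub>2 * Y" by (simp add: Y_def sum_distrib_left mult.assoc)
  finally have diag: "\<bar>\<Sum>i\<in>S. H i i * (y i)\<^sup>2\<bar> \<le> \<eta>\<^sub>2 * Y" .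
  have "(\<Sum>i\<in>S. H i i * (y i)\<^sup>2) = (\<Sum>i\<in>S. \<Sum>j\<in>S. if j = i then H i j * y i * y j else 0)"
    using fin by (simp add: power2_eq_square mult.assoc)
  then have "(\<Sum>i\<in>S. \<Sum>j\<in>S. H i j * y i * y j) =
      (\<Sum>i\<in>S. \<Sum>j\<in>S. G i j * y i * y j) + (\<Sum>i\<in>S. H i i * (y i)\<^sup>2)"
    by (simp only: sum.distrib [symmetric] hollow_tail_def) (intro sum.cong refl, auto)
  then have "\<bar>\<Sum>i\<in>S. \<Sum>j\<in>S. H i j * y i * y j\<bar> \<le> (\<eta>\<^sub>1 + \<eta>\<^sub>2) * Y"
    using abs_triangle_ineq[of "\<Sum>i\<in>S. \<Sum>j\<in>S. G i j * y i * y j" "\<Sum>i\<in>S. H i i * (y i)\<^sup>2"] off diag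
    by (simp only: distrib_right)
  then show "\<bar>\<Sum>i\<in>S. \<Sum>j\<in>S. H i j * y i * y j\<bar> \<le> (\<eta>\<^sub>1 + \<eta>\<^sub>2) * (\<Sum>i\<in>S. p i * (y i)\<^sup>2)"
    by (simp only: Y_def)
qed (use S p_pos \<beta>_pos \<tau> in auto)

lemma markov:
  fixes X :: "nat set \<Rightarrow> real"
  assumes "\<And>S. X S \<ge> 0" "c > 0"
  shows "measure_pmf.prob (random_index_set n p) {S. X S > c} \<le> E X / c"
proof -
  have "measure_pmf.prob (random_index_set n p) {S. X S > c} \<le>
      measure_pmf.prob (random_index_set n p) {S. X S \<ge> c}"
    by (intro measure_pmf.finite_measure_mono) auto
  also have "\<dots> \<le> E X / c"
    using integral_Markov_inequality_measure[of "measure_pmf (random_index_set n p)" X UNIV c] assms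
    by simp
  finally show ?thesis .
qed

lemma prob_spectral_sample:
  assumes \<eta>: "\<eta>\<^sub>1 > 0" "\<beta> \<le> \<eta>\<^sub>2" "\<sigma> / \<beta> \<le> \<eta>\<^sub>2" and \<tau>: "\<tau> > 0"
  shows "measure_pmf.prob (random_index_set n p) {S. spectral_sample n B \<alpha> u \<beta> S p (\<eta>\<^sub>1 + \<eta>\<^sub>2) \<tau>}
    \<ge> 1 - (4 * \<beta>\<^sup>2 + 2 * \<sigma> + ((\<kappa> + 1 / \<beta>) * \<sigma>)\<^sup>2) * f / \<eta>\<^sub>1 ^ 4 - \<sigma> * f / \<beta>\<^sup>2 / \<tau>\<^sup>2"
proof -
  let ?P = "measure_pmf.prob (random_index_set n p)"
  let ?bad1 = "{S. fourth_power_trace S > \<eta>\<^sub>1 ^ 4}" and ?bad2 = "{S. gram_deviation S > \<tau>\<^sup>2}"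
  let ?good = "{S. spectral_sample n B \<alpha> u \<beta> S p (\<eta>\<^sub>1 + \<eta>\<^sub>2) \<tau>}"
  have "?P ?bad1 \<le> E fourth_power_trace / \<eta>\<^sub>1 ^ 4"
    using \<eta>(1) by (intro markov fourth_power_trace_nonneg) auto
  also have "\<dots> \<le> (4 * \<beta>\<^sup>2 + 2 * \<sigma> + ((\<kappa> + 1 / \<beta>) * \<sigma>)\<^sup>2) * f / \<eta>\<^sub>1 ^ 4"
    using expectation_fourth_power_trace by (intro divide_right_mono) auto
  finally have bad1: "?P ?bad1 \<le> (4 * \<beta>\<^sup>2 + 2 * \<sigma> + ((\<kappa> + 1 / \<beta>) * \<sigma>)\<^sup>2) * f / \<eta>\<^sub>1 ^ 4" .
  have "?P ?bad2 \<le> E gram_deviation / \<tau>\<^sup>2"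
    using \<tau> by (intro markov) (auto simp: gram_deviation_def intro!: sum_nonneg)
  also have "\<dots> \<le> \<sigma> * f / \<beta>\<^sup>2 / \<tau>\<^sup>2"
    using expectation_gram_deviation by (intro divide_right_mono) auto
  finally have bad2: "?P ?bad2 \<le> \<sigma> * f / \<beta>\<^sup>2 / \<tau>\<^sup>2" .
  have "1 - ?P (?bad1 \<union> ?bad2) = ?P (- (?bad1 \<union> ?bad2))"
    by (subst measure_pmf.prob_compl [symmetric]) (auto simp: Compl_eq_Diff_UNIV)
  also have "\<dots> \<le> ?P ?good"
  proof (rule measure_pmf.finite_measure_mono_AE)
    show "AE S in random_index_set n p. S \<in> - (?bad1 \<union> ?bad2) \<longrightarrow> S \<in> ?good"
    proof (rule AE_pmfI, rule impI)
      fix S assume "S \<in> set_pmf (random_index_set n p)" "S \<in> - (?bad1 \<union> ?bad2)"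
      then show "S \<in> ?good"
        using set_pmf_random_index_set \<eta> \<tau> by (auto intro!: spectral_sampleI)
    qed
  qed simp
  finally have "1 - ?P (?bad1 \<union> ?bad2) \<le> ?P ?good" .
  moreover have "?P (?bad1 \<union> ?bad2) \<le> ?P ?bad1 + ?P ?bad2"
    by (rule measure_Un_le) auto
  ultimately show ?thesis using bad1 bad2 by simp
qed

end

section \<open>The main theorem\<close>

text \<open>All quantities are freed of \<open>F\<close>: \<open>b\<close> is \<beta> / F,
  \<open>1 / s\<close> is \<sigma> / F^2, \<open>L\<close> is \<kappa> F. The conclusions serve, in
  order, the vanishing diagonal, the two bounds on the diagonal of the tail, Markov for the trace
  with \<open>\<eta>\<^sub>1 = \<epsilon> * F / 64\<close>, and Markov for the Gram error with
  \<tau> = \<epsilon> F / 32, where 1024 is the square of 32.\<close>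

lemma sample_size_numerics:
  fixes \<epsilon> \<delta> s c2 N :: real
  assumes \<epsilon>: "0 < \<epsilon>" "\<epsilon> < 1" and \<delta>: "0 < \<delta>" "\<delta> < 1" and c2: "c2 \<ge> 16" and N: "N \<ge> 1"
    and s: "s > 0" "s \<ge> 2 ^ 50 * c2 * N ^ 10 / (\<epsilon> ^ 8 * \<delta> ^ 4)"
  defines "b \<equiv> \<epsilon>\<^sup>2 * \<delta> / 2 ^ 15" and "L \<equiv> sqrt c2 * N\<^sup>2 / \<epsilon>"
  shows "4 \<le> s * \<epsilon>\<^sup>2" "b \<le> \<epsilon> / 64" "1 / (s * b) \<le> \<epsilon> / 64"
    "(4 * b\<^sup>2 + 2 / s + ((L + 1 / b) / s)\<^sup>2) * (64 / \<epsilon>) ^ 4 \<le> \<delta> / 2"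
    "1024 / (s * b\<^sup>2 * \<epsilon>\<^sup>2) \<le> \<delta> / 4"
proof -
  \<comment> \<open>The upper bound for \<open>1 / s\<close> that the sample size
    guarantees.\<close>
  define z where "z = \<epsilon> ^ 8 * \<delta> ^ 4 / 2 ^ 50"
  have pow_le: "\<epsilon> ^ a * \<delta> ^ b \<le> \<epsilon> ^ a' * \<delta> ^ b'" if "a' \<le> a" "b' \<le> b" for a a' b b'
    using that \<epsilon> \<delta> by (intro mult_mono power_decreasing) auto
  have b: "b > 0" using \<epsilon> \<delta> by (simp add: b_def)
  have z_pos: "z > 0" using \<epsilon> \<delta> by (simp add: z_def)
  have N210: "N\<^sup>2 \<le> N ^ 10" and N1: "1 \<le> N\<^sup>2" using N by (auto intro: power_increasing one_le_power)
  have "2 ^ 50 * c2 * N ^ 10 \<le> s * (\<epsilon> ^ 8 * \<delta> ^ 4)"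
    using s(2) \<epsilon> \<delta> by (simp add: pos_divide_le_eq)
  moreover have "2 ^ 50 * c2 * N\<^sup>2 \<le> 2 ^ 50 * c2 * N ^ 10"
    using N210 c2 by (intro mult_left_mono) auto
  ultimately have sz: "c2 * N\<^sup>2 \<le> s * z" by (simp add: z_def)
  then have t2: "c2 * N\<^sup>2 / s \<le> z" using s(1) by (simp add: field_simps)
  have "1 * 1 \<le> c2 * N\<^sup>2" using c2 N1 by (intro mult_mono) auto
  then have t: "1 / s \<le> z"
    using t2 s(1) by (intro order_trans[OF _ t2] divide_right_mono) auto
  have z_le: "z \<le> \<epsilon> ^ a * \<delta> ^ b / 2 ^ 50" if "a \<le> 8" "b \<le> 4" for a b
    using pow_le[OF that] by (simp add: z_def)
  have "4 * 1 \<le> c2 * N\<^sup>2" using c2 N1 by (intro mult_mono) auto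
  also have "\<dots> \<le> s * z" by (rule sz)
  also have "\<dots> \<le> s * \<epsilon>\<^sup>2" using z_le[of 2 0] z_pos s(1) by (intro mult_left_mono) auto
  finally show "4 \<le> s * \<epsilon>\<^sup>2" by simp
  show "b \<le> \<epsilon> / 64"
  proof -
    have "\<epsilon>\<^sup>2 * \<delta> \<le> \<epsilon>" using pow_le[of 1 2 0 1] by simp
    then have "b \<le> \<epsilon> / 2 ^ 15" unfolding b_def by (rule divide_right_mono) simp
    also have "\<dots> \<le> \<epsilon> / 64" using \<epsilon>(1) by simp
    finally show ?thesis .
  qed
  have sb: "1 / (s * b) \<le> \<epsilon> ^ 6 * \<delta> ^ 3 / 2 ^ 35"
  proof -
    have "1 / (s * b) = 1 / s / b" by simp
    also have "\<dots> \<le> z / b" using t b by (intro divide_right_mono) auto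
    also have "\<dots> = \<epsilon> ^ 6 * \<delta> ^ 3 / 2 ^ 35"
      using \<epsilon> \<delta> by (simp add: z_def b_def field_simps power_numeral_reduce)
    finally show ?thesis .
  qed
  also have "\<dots> \<le> \<epsilon> / 2 ^ 35" using pow_le[of 1 6 0 3] by (intro divide_right_mono) auto
  also have "\<dots> \<le> \<epsilon> / 64" using \<epsilon> by simp
  finally show "1 / (s * b) \<le> \<epsilon> / 64" .
  have "L / s \<le> \<epsilon>\<^sup>2 * \<delta> / 2 ^ 50"
  proof -
    have "sqrt c2 \<le> c2" using c2 by (intro real_le_lsqrt) (auto simp: power2_eq_square)
    then have "L / s \<le> c2 * N\<^sup>2 / \<epsilon> / s"
      using \<epsilon> s(1) unfolding L_def by (intro divide_right_mono mult_right_mono) auto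
    also have "\<dots> = c2 * N\<^sup>2 / s / \<epsilon>" by simp
    also have "\<dots> \<le> (\<epsilon> ^ 3 * \<delta> ^ 1 / 2 ^ 50) / \<epsilon>"
      using order_trans[OF t2 z_le[of 3 1]] \<epsilon> by (intro divide_right_mono) auto
    also have "\<dots> = \<epsilon>\<^sup>2 * \<delta> / 2 ^ 50" using \<epsilon> by (simp add: power_numeral_reduce)
    finally show ?thesis .
  qed
  moreover have "1 / (s * b) \<le> \<epsilon>\<^sup>2 * \<delta> / 2 ^ 35"
    using pow_le[of 2 6 1 3] by (intro order_trans[OF sb] divide_right_mono) auto
  moreover have "(L + 1 / b) / s = L / s + 1 / (s * b)" by (simp add: add_divide_distrib mult.commute)
  moreover have "x / 2 ^ 50 + x / 2 ^ 35 \<le> x / 2 ^ 20" if "x \<ge> 0" for x :: real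
    using that by simp
  moreover have "\<epsilon>\<^sup>2 * \<delta> \<ge> 0" using \<epsilon> \<delta> by simp
  ultimately have y: "(L + 1 / b) / s \<le> \<epsilon>\<^sup>2 * \<delta> / 2 ^ 20" by (smt (verit))
  have "L \<ge> 0" using c2 \<epsilon> by (simp add: L_def)
  then have "((L + 1 / b) / s)\<^sup>2 \<le> (\<epsilon>\<^sup>2 * \<delta> / 2 ^ 20)\<^sup>2"
    using b s(1) by (intro power_mono[OF y]) auto
  also have "\<dots> = \<epsilon> ^ 4 * \<delta> ^ 2 / 2 ^ 40" by (simp add: power_divide power_mult_distrib)
  also have "\<dots> \<le> \<epsilon> ^ 4 * \<delta> ^ 1 / 2 ^ 40" using pow_le[of 4 4 1 2] by simp
  finally have y2: "((L + 1 / b) / s)\<^sup>2 \<le> \<epsilon> ^ 4 * \<delta> / 2 ^ 40" by simp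
  have "4 * b\<^sup>2 = \<epsilon> ^ 4 * \<delta> ^ 2 / 2 ^ 28" by (simp add: b_def power_divide power_mult_distrib)
  also have "\<dots> \<le> \<epsilon> ^ 4 * \<delta> / 2 ^ 28" using pow_le[of 4 4 1 2] by simp
  finally have b2: "4 * b\<^sup>2 \<le> \<epsilon> ^ 4 * \<delta> / 2 ^ 28" .
  have "2 / s \<le> 2 * (\<epsilon> ^ 4 * \<delta> / 2 ^ 50)"
    using mult_left_mono[OF order_trans[OF t z_le[of 4 1]], of 2] by simp
  moreover have "x / 2 ^ 28 + 2 * (x / 2 ^ 50) + x / 2 ^ 40 \<le> x / 2 ^ 27" if "x \<ge> 0" for x :: real
    using that by simp
  moreover have "\<epsilon> ^ 4 * \<delta> \<ge> 0" using \<epsilon> \<delta> by simp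
  ultimately have "4 * b\<^sup>2 + 2 / s + ((L + 1 / b) / s)\<^sup>2 \<le> \<epsilon> ^ 4 * \<delta> / 2 ^ 27"
    using y2 b2 by (smt (verit))
  then have "(4 * b\<^sup>2 + 2 / s + ((L + 1 / b) / s)\<^sup>2) * (64 / \<epsilon>) ^ 4 \<le> \<epsilon> ^ 4 * \<delta> / 2 ^ 27 * (64 / \<epsilon>) ^ 4"
    using \<epsilon> by (intro mult_right_mono) auto
  also have "\<dots> \<le> \<delta> / 2" using \<epsilon> \<delta> by (simp add: power_divide)
  finally show "(4 * b\<^sup>2 + 2 / s + ((L + 1 / b) / s)\<^sup>2) * (64 / \<epsilon>) ^ 4 \<le> \<delta> / 2" .
  have "1024 / (s * b\<^sup>2 * \<epsilon>\<^sup>2) = 1 / s * (1024 / (b\<^sup>2 * \<epsilon>\<^sup>2))" by simp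
  also have "\<dots> \<le> (\<epsilon> ^ 6 * \<delta> ^ 3 / 2 ^ 50) * (1024 / (b\<^sup>2 * \<epsilon>\<^sup>2))"
    using order_trans[OF t z_le[of 6 3]] by (intro mult_right_mono) auto
  also have "\<dots> = \<delta> / 2 ^ 10"
    using \<epsilon> \<delta> by (simp add: b_def field_simps power_numeral_reduce)
  also have "\<dots> \<le> \<delta> / 4" using \<delta> by simp
  finally show "1024 / (s * b\<^sup>2 * \<epsilon>\<^sup>2) \<le> \<delta> / 4" .
qed

section \<open>The thresholded matrix under row-norm sampling\<close>

lemma thresholded_entry_sym:
  assumes "A \<in> carrier_mat n n" "A\<^sup>T = A" "i < n" "j < n"
  shows "thresholded_entry c2 \<epsilon> A i j = thresholded_entry c2 \<epsilon> A j i"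
proof -
  have "A $$ (i, j) = A $$ (j, i)"
    using assms by (metis carrier_matD index_transpose_mat(1))
  then show ?thesis by (auto simp: thresholded_entry_def mult_ac)
qed

text \<open>An entry that survives satisfies the reverse of the threshold inequality; taking square
  roots gives the bound.\<close>

lemma thresholded_entry_bound:
  assumes A: "A \<in> carrier_mat n n" and "i \<noteq> j" "\<epsilon> > 0" "c2 > 0" "frobenius_norm A > 0"
  shows "\<bar>thresholded_entry c2 \<epsilon> A i j\<bar> \<le>
    sqrt c2 * (log1 (real n))\<^sup>2 / \<epsilon> / frobenius_norm A * row_norm A i * row_norm A j"
proof (cases "thresholded_entry c2 \<epsilon> A i j = 0")
  case True
  then show ?thesis
    using assms row_norm_nonneg by (auto intro!: mult_nonneg_nonneg divide_nonneg_nonneg)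
next
  case False
  let ?F = "frobenius_norm A" and ?N = "log1 (real n)"
  have N: "?N > 0" using log1_ge_1[of "real n"] by simp
  have thr: "thresholded_entry c2 \<epsilon> A i j = A $$ (i, j)"
    and "\<epsilon>\<^sup>2 * ?F\<^sup>2 * \<bar>A $$ (i, j)\<bar>\<^sup>2 / (c2 * ?N ^ 4) \<le> (row_norm A i)\<^sup>2 * (row_norm A j)\<^sup>2"
    using False A \<open>i \<noteq> j\<close> by (auto simp: thresholded_entry_def not_less split: if_splits)
  then have "\<epsilon>\<^sup>2 * ?F\<^sup>2 * \<bar>A $$ (i, j)\<bar>\<^sup>2 \<le> (row_norm A i)\<^sup>2 * (row_norm A j)\<^sup>2 * (c2 * ?N ^ 4)"
    using N assms by (simp add: divide_le_eq)
  also have "\<dots> = (sqrt c2 * ?N\<^sup>2 * row_norm A i * row_norm A j)\<^sup>2"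
    using assms by (simp add: power_mult_distrib flip: power_mult)
  finally have "(\<epsilon> * ?F * \<bar>A $$ (i, j)\<bar>)\<^sup>2 \<le> (sqrt c2 * ?N\<^sup>2 * row_norm A i * row_norm A j)\<^sup>2"
    by (simp add: power_mult_distrib)
  then have "\<epsilon> * ?F * \<bar>A $$ (i, j)\<bar> \<le> sqrt c2 * ?N\<^sup>2 * row_norm A i * row_norm A j"
    by (rule power2_le_imp_le) (use assms row_norm_nonneg in simp)
  then show ?thesis using assms by (simp add: thr field_simps)
qed

lemma frobenius_norm_pos:
  assumes "A \<in> carrier_mat n m" "A \<noteq> 0\<^sub>m n m"
  shows "frobenius_norm A > 0"
proof -
  obtain i j where ij: "i < n" "j < m" "A $$ (i, j) \<noteq> 0"
    using assms by (metis carrier_matD eq_matI index_zero_mat)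
  then have "row_norm A i > 0" using entry_le_row_norm[OF assms(1) ij(2), of i] by simp
  then have "(\<Sum>i<n. (row_norm A i)\<^sup>2) > 0" using ij(1) by (intro sum_pos2[of _ i]) auto
  then show ?thesis
    using frobenius_norm_power2[OF assms(1)] frobenius_norm_nonneg[of A] by (cases "frobenius_norm A = 0") auto
qed

text \<open>If \<open>p i < 1\<close>, the minimum in \<open>sample_prob\<close> is not 1, so
  \<open>p i\<close> is at least \<open>s * (r i)^2 / F^2\<close>: this is the leverage bound with
  \<sigma> = F^2 / s. It also gives \<open>(r i)^2 < F^2 / s\<close>, which by
  \<open>s * \<epsilon>^2 \<ge> 4\<close> lies below the diagonal threshold, so the diagonal entry
  is zero.\<close>

lemma leverage_sampling_thresholded:
  assumes A: "A \<in> carrier_mat n n" and "A \<noteq> 0\<^sub>m n n" and \<epsilon>: "\<epsilon> > 0" and c2: "c2 > 0"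
    and s: "s > 0" "s * \<epsilon>\<^sup>2 \<ge> 4" and "b > 0"
    and eig: "eigensystem {..<n} (thresholded_entry c2 \<epsilon> A) \<alpha> u"
  shows "leverage_sampling n (sample_prob A s) (thresholded_entry c2 \<epsilon> A) \<alpha> u (row_norm A)
    ((frobenius_norm A)\<^sup>2 / s) (sqrt c2 * (log1 (real n))\<^sup>2 / \<epsilon> / frobenius_norm A)
    ((frobenius_norm A)\<^sup>2) (b * frobenius_norm A)"
proof -
  let ?F = "frobenius_norm A" and ?p = "sample_prob A s" and ?r = "row_norm A"
  have F: "?F > 0" using frobenius_norm_pos assms(1,2) by blast
  have p_lt: "s * (?r i)\<^sup>2 / ?F\<^sup>2 + 1 / (real n)\<^sup>2 = ?p i" if "?p i < 1" for i
    using that A by (auto simp: sample_prob_def)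
  have "index_sampling n ?p"
  proof
    \<comment> \<open>The summand \<open>1 / n^2\<close> keeps the probability positive even for a
      zero row.\<close>
    fix i assume "i < n"
    then show "?p i > 0"
      using A s(1) by (auto simp: sample_prob_def intro!: add_nonneg_pos)
  qed (simp add: sample_prob_def)
  then show ?thesis
  proof (intro leverage_sampling.intro leverage_sampling_axioms.intro eig)
    fix i assume i: "i < n"
    have "(\<Sum>j<n. (thresholded_entry c2 \<epsilon> A i j)\<^sup>2) \<le> (\<Sum>j<n. (A $$ (i, j))\<^sup>2)"
      by (intro sum_mono) (simp add: thresholded_entry_def)
    then show "(\<Sum>j<n. (thresholded_entry c2 \<epsilon> A i j)\<^sup>2) \<le> (?r i)\<^sup>2"
      by (simp add: row_norm_power2[OF A])
  next
    fix i assume "i < n" and p: "?p i < 1"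
    have "s * (?r i)\<^sup>2 / ?F\<^sup>2 \<le> ?p i"
      unfolding p_lt[OF p, symmetric] by simp
    then show "(?r i)\<^sup>2 \<le> ?F\<^sup>2 / s * ?p i" using F s(1) by (simp add: field_simps)
    show "thresholded_entry c2 \<epsilon> A i i = 0"
    proof (rule ccontr)
      assume "thresholded_entry c2 \<epsilon> A i i \<noteq> 0"
      then have "\<epsilon>\<^sup>2 / 4 * ?F\<^sup>2 \<le> (?r i)\<^sup>2" by (auto simp: thresholded_entry_def split: if_splits)
      then have "s * (\<epsilon>\<^sup>2 / 4 * ?F\<^sup>2) \<le> s * (?r i)\<^sup>2" using s(1) by (intro mult_left_mono) auto
      moreover have "1 * ?F\<^sup>2 \<le> (s * \<epsilon>\<^sup>2 / 4) * ?F\<^sup>2" using s(2) by (intro mult_right_mono) auto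
      ultimately have "?F\<^sup>2 \<le> s * (?r i)\<^sup>2" by (simp add: mult.assoc)
      then have "1 \<le> s * (?r i)\<^sup>2 / ?F\<^sup>2" using F by simp
      moreover have "0 \<le> 1 / (real n)\<^sup>2" by simp
      ultimately show False using p p_lt[OF p] by linarith
    qed
  next
    fix i j assume "i < n" "j < n" "i \<noteq> j"
    then show "\<bar>thresholded_entry c2 \<epsilon> A i j\<bar> \<le>
        sqrt c2 * (log1 (real n))\<^sup>2 / \<epsilon> / ?F * ?r i * ?r j"
      using thresholded_entry_bound[OF A] \<epsilon> c2 F by blast
  next
    show "(\<Sum>i<n. (?r i)\<^sup>2) \<le> ?F\<^sup>2" by (simp add: frobenius_norm_power2[OF A])
  qed (use F \<epsilon> c2 s(1) \<open>b > 0\<close> row_norm_nonneg in auto)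
qed

text \<open>Sampling costs at most 2 \<epsilon> F / 8, thresholding at most 3/4 \<epsilon> F by
  Weyl's inequality in both directions.\<close>

lemma eigenvalue_estimate_close:
  assumes A: "A \<in> carrier_mat n n" "A\<^sup>T = A" and \<epsilon>: "\<epsilon> > 0" and c2: "c2 \<ge> 16"
    and sample: "spectral_sample n (thresholded_entry c2 \<epsilon> A) \<alpha> u \<beta> S (sample_prob A s) \<eta> \<tau>"
    and \<theta>: "\<beta> \<le> \<epsilon> * frobenius_norm A / 8" "2 * \<tau> + \<eta> \<le> \<epsilon> * frobenius_norm A / 8" "\<eta> \<ge> 0"
    and i: "i < n"
  shows "\<bar>eigenvalue_estimate c2 \<epsilon> s A S i - eigenvalues_desc A ! i\<bar> \<le> \<epsilon> * frobenius_norm A"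
proof -
  interpret spectral_sample n "thresholded_entry c2 \<epsilon> A" \<alpha> u \<beta> S "sample_prob A s" \<eta> \<tau> by fact
  let ?C = "rescaled_entry c2 \<epsilon> s A" and ?F = "frobenius_norm A" and ?B = "thresholded_entry c2 \<epsilon> A"
  have "?C i j = ?C j i" if "i \<in> S" "j \<in> S" for i j
    using thresholded_entry_sym[OF A, of i j c2 \<epsilon>] that S_subset
    by (auto simp: rescaled_entry_eq mult.commute)
  then obtain w where "eigensystem S ?C
      (\<lambda>a. eigenvalues_desc (submatrix (mat n n (\<lambda>(i, j). ?C i j)) S S) ! a) w"
    using submatrix_eigensystem[OF S_subset, of ?C] by blast
  then have "eigensystem S ?C (\<lambda>a. eigenvalues_desc (sampled_matrix c2 \<epsilon> s A S) ! a) w"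
    using A(1) by (simp add: sampled_matrix_def)
  from aligned_eigenvalue_close[OF this rescaled_entry_eq \<theta> i]
  have est: "\<bar>eigenvalue_estimate c2 \<epsilon> s A S i - \<alpha> i\<bar> \<le> 2 * (\<epsilon> * ?F / 8)"
    using A(1) by (simp add: eigenvalue_estimate_def Let_def)
  obtain a where eigA: "eigensystem {..<n} (\<lambda>i j. A $$ (i, j)) (\<lambda>k. eigenvalues_desc A ! k) a"
    using real_symmetric_eigensystem[OF A] by blast
  let ?t = "3 / 4 * (\<epsilon> * ?F)"
  note err = thresholding_error[OF A \<epsilon> c2]
  have "\<alpha> i \<ge> eigenvalues_desc A ! i - ?t"
  proof (rule eigensystem_weyl[OF eigA eigensystem])
    fix x
    have "(\<Sum>i<n. \<Sum>j<n. (?B i j - A $$ (i, j)) * x i * x j) =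
        - (\<Sum>i<n. \<Sum>j<n. (A $$ (i, j) - ?B i j) * x i * x j)"
      by (simp add: algebra_simps flip: sum_negf)
    then show "(\<Sum>i<n. \<Sum>j<n. (?B i j - A $$ (i, j)) * x i * x j) \<ge> - ?t * (\<Sum>i<n. (x i)\<^sup>2)"
      using abs_le_D1[OF err[of x]] by simp
  qed (use i in simp)
  moreover have "eigenvalues_desc A ! i \<ge> \<alpha> i - ?t"
  proof (rule eigensystem_weyl[OF eigensystem eigA])
    fix x
    show "(\<Sum>i<n. \<Sum>j<n. (A $$ (i, j) - ?B i j) * x i * x j) \<ge> - ?t * (\<Sum>i<n. (x i)\<^sup>2)"
      using abs_le_D2[OF err[of x]] by simp
  qed (use i in simp)
  ultimately show ?thesis using est unfolding abs_le_iff by linarith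
qed

lemma prob_eigenvalue_estimates_close:
  fixes \<epsilon> \<delta> s c2 :: real
  assumes c2: "c2 \<ge> 16" and \<epsilon>: "0 < \<epsilon>" "\<epsilon> < 1" and \<delta>: "0 < \<delta>" "\<delta> < 1"
    and A: "A \<in> carrier_mat n n" "A\<^sup>T = A" "A \<noteq> 0\<^sub>m n n"
    and s: "s > 0" "s \<ge> 2 ^ 50 * c2 * log1 (real n) ^ 10 / (\<epsilon> ^ 8 * \<delta> ^ 4)"
  shows "measure_pmf.prob (random_index_set n (sample_prob A s))
    {S. \<forall>i<n. \<bar>eigenvalue_estimate c2 \<epsilon> s A S i - eigenvalues_desc A ! i\<bar> \<le> \<epsilon> * frobenius_norm A} \<ge> 1 - \<delta>"
proof -
  let ?F = "frobenius_norm A" and ?B = "thresholded_entry c2 \<epsilon> A"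
  let ?P = "measure_pmf.prob (random_index_set n (sample_prob A s))"
  define b where "b = \<epsilon>\<^sup>2 * \<delta> / 2 ^ 15"
  define L where "L = sqrt c2 * (log1 (real n))\<^sup>2 / \<epsilon>"
  note numerics = sample_size_numerics[OF \<epsilon> \<delta> c2 log1_ge_1 s, folded b_def L_def]
  have F: "?F > 0" using frobenius_norm_pos A(1,3) by blast
  have b: "b > 0" using \<epsilon> \<delta> by (simp add: b_def)
  obtain \<alpha> u where eig: "eigensystem {..<n} ?B \<alpha> u"
    using submatrix_eigensystem[OF subset_refl, of n ?B] thresholded_entry_sym[OF A(1,2)] by blast
  interpret leverage_sampling n "sample_prob A s" ?B \<alpha> u "row_norm A" "?F\<^sup>2 / s" "L / ?F" "?F\<^sup>2" "b * ?F"
    unfolding L_def using leverage_sampling_thresholded[OF A(1,3) \<epsilon>(1) _ s(1) numerics(1) b eig] c2 by simp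
  \<comment> \<open>Both parts of \<eta> are set to \<epsilon> F / 64, so 2 \<tau> + \<eta> = 3/32
    \<epsilon> F, within the allowed \<epsilon> F / 8.\<close>
  define \<eta>\<^sub>1 \<tau> where "\<eta>\<^sub>1 = \<epsilon> * ?F / 64" and "\<tau> = \<epsilon> * ?F / 32"
  have bF: "b * ?F \<le> \<eta>\<^sub>1"
    using mult_right_mono[OF numerics(2), of ?F] F by (simp add: \<eta>\<^sub>1_def)
  have "?F\<^sup>2 / s / (b * ?F) = 1 / (s * b) * ?F" using F by (simp add: power2_eq_square)
  also have "\<dots> \<le> \<eta>\<^sub>1"
    using mult_right_mono[OF numerics(3), of ?F] F by (simp add: \<eta>\<^sub>1_def)
  finally have \<sigma>: "?F\<^sup>2 / s / (b * ?F) \<le> \<eta>\<^sub>1" .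
  \<comment> \<open>The failure bounds are homogeneous of degree 0 in \<open>F\<close>, so they
    reduce to the scale-free quantities estimated before.\<close>
  have e1: "(4 * (b * ?F)\<^sup>2 + 2 * (?F\<^sup>2 / s) + ((L / ?F + 1 / (b * ?F)) * (?F\<^sup>2 / s))\<^sup>2) * ?F\<^sup>2 / \<eta>\<^sub>1 ^ 4
      = (4 * b\<^sup>2 + 2 / s + ((L + 1 / b) / s)\<^sup>2) * (64 / \<epsilon>) ^ 4"
  proof -
    have "(L / ?F + 1 / (b * ?F)) * (?F\<^sup>2 / s) = (L + 1 / b) / s * ?F"
    proof -
      have "L / ?F * (?F\<^sup>2 / s) = L / s * ?F" "1 / (b * ?F) * (?F\<^sup>2 / s) = 1 / b / s * ?F"
        using F by (simp_all add: power2_eq_square)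
      then show ?thesis by (simp only: distrib_right add_divide_distrib)
    qed
    then have "(4 * (b * ?F)\<^sup>2 + 2 * (?F\<^sup>2 / s) + ((L / ?F + 1 / (b * ?F)) * (?F\<^sup>2 / s))\<^sup>2) * ?F\<^sup>2
        = (4 * b\<^sup>2 + 2 / s + ((L + 1 / b) / s)\<^sup>2) * ?F ^ 4"
      by (simp only:) (simp add: power_mult_distrib algebra_simps power2_eq_square power4_eq_xxxx)
    moreover have "?F ^ 4 / \<eta>\<^sub>1 ^ 4 = (64 / \<epsilon>) ^ 4"
      using F \<epsilon> by (simp add: \<eta>\<^sub>1_def flip: power_divide)
    ultimately show ?thesis by (simp only: times_divide_eq_right [symmetric])
  qed
  have e2: "?F\<^sup>2 / s * ?F\<^sup>2 / (b * ?F)\<^sup>2 / \<tau>\<^sup>2 = 1024 / (s * b\<^sup>2 * \<epsilon>\<^sup>2)"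
    using F by (simp add: \<tau>_def power2_eq_square)
  let ?good = "{S. spectral_sample n ?B \<alpha> u (b * ?F) S (sample_prob A s) (\<eta>\<^sub>1 + \<eta>\<^sub>1) \<tau>}"
  have pos: "\<eta>\<^sub>1 > 0" "\<tau> > 0" using F \<epsilon> by (auto simp: \<eta>\<^sub>1_def \<tau>_def)
  have "1 - \<delta> \<le> 1 - \<delta> / 2 - \<delta> / 4" using \<delta> by simp
  also have "\<dots> \<le> ?P ?good"
    using prob_spectral_sample[OF pos(1) bF \<sigma> pos(2)] numerics(4,5) unfolding e1 e2 by linarith
  also have "\<dots> \<le> ?P {S. \<forall>i<n. \<bar>eigenvalue_estimate c2 \<epsilon> s A S i - eigenvalues_desc A ! i\<bar> \<le> \<epsilon> * ?F}"
  proof (rule measure_pmf.finite_measure_mono, rule subsetI, rule CollectI, intro allI impI)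
    fix S i assume S: "S \<in> ?good" and i: "i < n"
    show "\<bar>eigenvalue_estimate c2 \<epsilon> s A S i - eigenvalues_desc A ! i\<bar> \<le> \<epsilon> * ?F"
      using S pos bF F \<epsilon>
      by (intro eigenvalue_estimate_close[OF A(1,2) \<epsilon>(1) c2 _ _ _ _ i]) (auto simp: \<eta>\<^sub>1_def \<tau>_def)
  qed simp
  finally show "1 - \<delta> \<le> ?P {S. \<forall>i<n. \<bar>eigenvalue_estimate c2 \<epsilon> s A S i - eigenvalues_desc A ! i\<bar> \<le> \<epsilon> * ?F}" .
qed

theorem theorem3:
  shows "\<exists>c0::real. \<forall>c2\<ge>c0. \<exists>c::real. c > 0 \<and>
    (\<forall>(n::nat) (A::real mat) (\<epsilon>::real) (\<delta>::real) (s::real).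
       0 < \<epsilon> \<and> \<epsilon> < 1 \<and> 0 < \<delta> \<and> \<delta> < 1 \<and>
       A \<in> carrier_mat n n \<and> A\<^sup>T = A \<and> A \<noteq> 0\<^sub>m n n \<and>
       s > 0 \<and> s \<ge> c * log1 (real n) ^ 10 / (\<epsilon> ^ 8 * \<delta> ^ 4) \<longrightarrow>
       measure_pmf.prob (random_index_set n (sample_prob A s))
         {S. \<forall>i<n. \<bar>eigenvalue_estimate c2 \<epsilon> s A S i - eigenvalues_desc A ! i\<bar>
                    \<le> \<epsilon> * frobenius_norm A} \<ge> 1 - \<delta>)"
proof (rule exI[of _ 16], intro allI impI)
  \<comment> \<open>16 is the value for which the off-diagonal thresholding error is at most
    \<epsilon> F / 4; the witness \<open>c = 2 ^ 50 * c2\<close> is the constant of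
    \<open>sample_size_numerics\<close>.\<close>
  fix c2 :: real assume "c2 \<ge> 16"
  then show "\<exists>c::real. c > 0 \<and>
    (\<forall>(n::nat) (A::real mat) (\<epsilon>::real) (\<delta>::real) (s::real).
       0 < \<epsilon> \<and> \<epsilon> < 1 \<and> 0 < \<delta> \<and> \<delta> < 1 \<and>
       A \<in> carrier_mat n n \<and> A\<^sup>T = A \<and> A \<noteq> 0\<^sub>m n n \<and>
       s > 0 \<and> s \<ge> c * log1 (real n) ^ 10 / (\<epsilon> ^ 8 * \<delta> ^ 4) \<longrightarrow>
       measure_pmf.prob (random_index_set n (sample_prob A s))
         {S. \<forall>i<n. \<bar>eigenvalue_estimate c2 \<epsilon> s A S i - eigenvalues_desc A ! i\<bar>
                    \<le> \<epsilon> * frobenius_norm A} \<ge> 1 - \<delta>)"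
    by (intro exI[of _ "2 ^ 50 * c2"] conjI allI impI prob_eigenvalue_estimates_close) auto
qed

end
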